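(* Let $F$ be an imaginary (i.e. totally imaginary) cyclic sextic number field. Then the function $h^0$ on the Arakelov class group $\mathrm{Pic}^0_F$ attains its unique global maximum at the class $[D_0]=[(O_F,1)]$ of the trivial Arakelov divisor. Equivalently, $h^0(O_F,1)>h^0(I,u)$ for every Arakelov divisor $(I,u)$ of degree $0$ whose class differs from $[(O_F,1)]$.
   Context: Let $F$ be a totally imaginary number field that is Galois over $\mathbb{Q}$ with cyclic Galois group of order $6$, generated by $\tau$, and $O_F$ its ring of integers. Fix the three complex embeddings $\tau_1=\mathrm{id},\tau_2=\tau,\tau_3=\tau^2$ (one from each pair of complex-conjugate embeddings). For $u=(u_1,u_2,u_3)\in\mathbb{R}_{>0}^3$ and $f\in F$ put $\|uf\|^2=2\sum_{i=1}^3u_i^2|\tau_i(f)|^2$, and $N(u)=u_1u_2u_3$. An Arakelov divisor is a pair $D=(I,u)$ with $I$ a fractional ideal of $F$ and $u\in\mathbb{R}_{>0}^3$; these form a group (ideals multiplied, vectors multiplied componentwise), and $\deg D=\log(N(u)N(I))$. For $f\in F^\times$ the principal divisor is $(f)=(f^{-1}O_F,(|\tau_i(f)|)_{i=1}^3)$, which has degree $0$. $\mathrm{Pic}^0_F$ is the group of degree-$0$ divisors modulo principal divisors. Define $k^0(I,u)=\sum_{f\in I}e^{-\pi\|uf\|^2}$ and $h^0(I,u)=\log k^0(I,u)$; $h^0$ is well defined on $\mathrm{Pic}^0_F$.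
   Formalization: The degree uses N(u) = (u_1 u_2 u_3)^2, the product over all six embeddings, instead of N(u) = u_1 u_2 u_3; with the latter, principal divisors would not have degree 0 and the claim fails, e.g. for (nO_F, n^{-2}) with n at least 2. *)

theory Defs
  imports "HOL-Analysis.Analysis"
begin

text \<open>A number field is modelled as a subfield F of the complex numbers, so that the
  first fixed embedding tau_1 is the identity (inclusion).\<close>

definition subfield_of_complex :: "complex set \<Rightarrow> bool" where
  "subfield_of_complex F \<longleftrightarrow> 0 \<in> F \<and> 1 \<in> F \<and>
     (\<forall>x\<in>F. \<forall>y\<in>F. x + y \<in> F \<and> x * y \<in> F) \<and>
     (\<forall>x\<in>F. - x \<in> F) \<and> (\<forall>x\<in>F. x \<noteq> 0 \<longrightarrow> inverse x \<in> F)"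

definition rat_dim :: "complex set \<Rightarrow> nat \<Rightarrow> bool" where
  "rat_dim F n \<longleftrightarrow> (\<exists>b :: nat \<Rightarrow> complex. (\<forall>i<n. b i \<in> F) \<and>
     (\<forall>x\<in>F. \<exists>!q :: nat \<Rightarrow> rat. (\<forall>i\<ge>n. q i = 0) \<and> x = (\<Sum>i<n. of_rat (q i) * b i)))"

definition number_field_of_degree :: "complex set \<Rightarrow> nat \<Rightarrow> bool" where
  "number_field_of_degree F n \<longleftrightarrow> subfield_of_complex F \<and> rat_dim F n"

definition field_emb_on :: "complex set \<Rightarrow> (complex \<Rightarrow> complex) \<Rightarrow> bool" where
  "field_emb_on F \<sigma> \<longleftrightarrow> inj_on \<sigma> F \<and> \<sigma> 1 = 1 \<and>
     (\<forall>x\<in>F. \<forall>y\<in>F. \<sigma> (x + y) = \<sigma> x + \<sigma> y \<and> \<sigma> (x * y) = \<sigma> x * \<sigma> y)"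

definition field_aut_on :: "complex set \<Rightarrow> (complex \<Rightarrow> complex) \<Rightarrow> bool" where
  "field_aut_on F \<sigma> \<longleftrightarrow> field_emb_on F \<sigma> \<and> bij_betw \<sigma> F F"

definition totally_imaginary :: "complex set \<Rightarrow> bool" where
  "totally_imaginary F \<longleftrightarrow> (\<forall>\<sigma>. field_emb_on F \<sigma> \<longrightarrow> (\<exists>x\<in>F. Im (\<sigma> x) \<noteq> 0))"

definition cyclic_sextic_galois :: "complex set \<Rightarrow> (complex \<Rightarrow> complex) \<Rightarrow> bool" where
  "cyclic_sextic_galois F \<tau> \<longleftrightarrow> number_field_of_degree F 6 \<and> field_aut_on F \<tau> \<and>
     (\<forall>x\<in>F. (\<tau> ^^ 6) x = x) \<and>
     (\<forall>k\<in>{1..5}. \<exists>x\<in>F. (\<tau> ^^ k) x \<noteq> x) \<and>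
     (\<forall>\<sigma>. field_aut_on F \<sigma> \<longrightarrow> (\<exists>k<6. \<forall>x\<in>F. \<sigma> x = (\<tau> ^^ k) x))"

definition algebraic_integer :: "complex \<Rightarrow> bool" where
  "algebraic_integer x \<longleftrightarrow>
     (\<exists>n (c :: nat \<Rightarrow> int). x ^ n + (\<Sum>i<n. of_int (c i) * x ^ i) = 0)"

definition ring_of_integers :: "complex set \<Rightarrow> complex set" where
  "ring_of_integers F = {x \<in> F. algebraic_integer x}"

definition fractional_ideal :: "complex set \<Rightarrow> complex set \<Rightarrow> bool" where
  "fractional_ideal F I \<longleftrightarrow> I \<subseteq> F \<and> 0 \<in> I \<and> I \<noteq> {0} \<and>
     (\<forall>x\<in>I. \<forall>y\<in>I. x + y \<in> I) \<and>
     (\<forall>a\<in>ring_of_integers F. \<forall>x\<in>I. a * x \<in> I) \<and>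
     (\<exists>d\<in>ring_of_integers F. d \<noteq> 0 \<and> (\<forall>x\<in>I. d * x \<in> ring_of_integers F))"

definition add_index :: "complex set \<Rightarrow> complex set \<Rightarrow> nat" where
  "add_index A B = card ((\<lambda>x. (\<lambda>y. x + y) ` B) ` A)"

text \<open>Norm of a fractional ideal I: the generalized index [O_F : I]
  = [O_F : O_F \<inter> I] / [I : O_F \<inter> I].\<close>
definition ideal_norm :: "complex set \<Rightarrow> complex set \<Rightarrow> real" where
  "ideal_norm F I = real (add_index (ring_of_integers F) (ring_of_integers F \<inter> I))
                   / real (add_index I (ring_of_integers F \<inter> I))"

text \<open>Embeddings tau_1 = id, tau_2 = tau, tau_3 = tau^2, indexed by i = 0,1,2 as tau^^i;
  the vector u is indexed by 0,1,2 likewise.\<close>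
definition arak_norm_sq :: "(complex \<Rightarrow> complex) \<Rightarrow> (nat \<Rightarrow> real) \<Rightarrow> complex \<Rightarrow> real" where
  "arak_norm_sq \<tau> u f = 2 * (\<Sum>i<3. (u i)\<^sup>2 * (cmod ((\<tau> ^^ i) f))\<^sup>2)"

text \<open>Norm of u: product over all six complex embeddings, i.e. each complex place
  counted twice (this is what makes principal divisors have degree 0).\<close>
definition u_norm :: "(nat \<Rightarrow> real) \<Rightarrow> real" where
  "u_norm u = (\<Prod>i<3. (u i)\<^sup>2)"

definition arak_degree :: "complex set \<Rightarrow> complex set \<Rightarrow> (nat \<Rightarrow> real) \<Rightarrow> real" where
  "arak_degree F I u = ln (u_norm u * ideal_norm F I)"

definition principal_divisor :: "complex set \<Rightarrow> (complex \<Rightarrow> complex) \<Rightarrow> complex set \<Rightarrow> (nat \<Rightarrow> real) \<Rightarrow> bool" where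
  "principal_divisor F \<tau> I u \<longleftrightarrow> (\<exists>f\<in>F. f \<noteq> 0 \<and>
      I = (\<lambda>x. inverse f * x) ` ring_of_integers F \<and> (\<forall>i<3. u i = cmod ((\<tau> ^^ i) f)))"

definition k0 :: "(complex \<Rightarrow> complex) \<Rightarrow> complex set \<Rightarrow> (nat \<Rightarrow> real) \<Rightarrow> real" where
  "k0 \<tau> I u = (\<Sum>\<^sub>\<infinity>f\<in>I. exp (- pi * arak_norm_sq \<tau> u f))"

definition h0 :: "(complex \<Rightarrow> complex) \<Rightarrow> complex set \<Rightarrow> (nat \<Rightarrow> real) \<Rightarrow> real" where
  "h0 \<tau> I u = ln (k0 \<tau> I u)"

end

theory Submission
  imports Defs "Jordan_Normal_Form.Char_Poly"
begin

text \<open>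
  Put \<open>v i = (u i)\<^sup>2\<close> and let \<open>a i f\<close> be the square of the modulus of the i-th conjugate of \<open>f\<close>, so that
  \<open>k0\<close> is the sum of \<open>exp (- 2 \<pi> Q f)\<close> with \<open>Q f = (\<Sum>i<3. v i * a i f)\<close>. For \<open>f\<close> in \<open>I\<close> the product of
  the \<open>v i * a i f\<close> is the index of \<open>f O\<close> in \<open>I\<close>, so \<open>Q f \<ge> 3\<close> for nonzero \<open>f\<close>, and \<open>Q f \<ge> 3.779\<close> when \<open>f\<close>
  does not generate \<open>I\<close>. Counting modulo 2, at most 126 nonzero vectors have \<open>Q f < 6\<close>, and
  counting modulo m bounds the remaining tail. As \<open>2 exp (- 6 \<pi>)\<close> beats \<open>126 exp (- 2 \<pi> 3.779)\<close>,
  this settles nonprincipal ideals.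

  If \<open>I\<close> is principal, one may take \<open>I = O\<close> and \<open>s = v 0 + v 1 + v 2\<close> minimal among the values of \<open>Q\<close>
  on units. For an integer \<open>f\<close> not all of whose conjugates have modulus 1, the \<open>a i f\<close> are the
  roots of an integral cubic with square discriminant, which forces their trace to be at least 5 and
  the sum of the first two elementary symmetric functions to be at least 11. The resulting lower
  bounds for \<open>Q f\<close> suffice unless \<open>s\<close> is close to 3 or large. For large \<open>s\<close> only a few units can be
  short. For \<open>s\<close> close to 3 one averages over the Galois group: the first order variation has the
  right sign, and the second order one is small because the trace is at least 5.
\<close>

section \<open>Algebraic integers and linear algebra\<close>

text \<open>The squared moduli \<open>a i x\<close> are the conjugates of \<open>x * cnj x\<close>,
  which lies in the real cubic subfield. \<open>\<tau>\<close> permutes them cyclically, so the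
  product of their differences is a rational integer: this is why the discriminant is a square. The
  number w of integers all of whose conjugates have modulus 1 is never determined; only w \<ge> 2 is
  known. The trivial divisor gains w exp (- 6 \<pi>) (1 - exp (- 2 \<pi> (s - 3))) on these
  integers, and all other vectors have to stay below that gain. Two obstacles shape the principal
  case. As s tends to 3 the gain vanishes linearly, so a termwise bound on the other vectors, which
  leaves a fixed loss, cannot work. For larger s other units get short, and only a count
  proportional to w can be balanced against the gain. The constant 3.779 is 3 times the cube root of
  2, rounded down: the arithmetic-geometric bound at index 2. The norm of an ideal is a quotient of
  indices, so the arithmetic rests on counting cosets, and no integral basis of the ring of integers
  or of an ideal is constructed.\<close>

lemma algebraic_integer_iff_algebraic_int: "algebraic_integer x \<longleftrightarrow> algebraic_int x"
proof
  assume "algebraic_integer x"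
  then obtain n and c :: "nat \<Rightarrow> int" where h: "x ^ n + (\<Sum>i<n. of_int (c i) * x ^ i) = 0"
    unfolding algebraic_integer_def by blast
  define p :: "complex poly" where "p = monom 1 n + (\<Sum>i<n. monom (of_int (c i)) i)"
  have co: "coeff p k = (if k = n then 1 else if k < n then of_int (c k) else 0)" for k
    unfolding p_def by (auto simp: coeff_sum)
  have deg: "degree p = n"
    by (rule antisym) (auto intro!: degree_le le_degree simp: co)
  have "poly p x = 0"
    using h unfolding p_def by (simp add: poly_sum poly_monom)
  moreover have "lead_coeff p = 1" "\<And>i. coeff p i \<in> \<int>" by (auto simp: deg co)
  ultimately show "algebraic_int x"
    by (intro algebraic_int.intros[of p]) auto
next
  assume "algebraic_int x"
  then obtain p where p: "lead_coeff p = 1" "\<And>i. coeff p i \<in> \<int>" "poly p x = 0"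
    by (auto elim!: algebraic_int.cases)
  define c where "c i = (SOME z. coeff p i = of_int z)" for i
  have c: "coeff p i = of_int (c i)" for i
    unfolding c_def using p(2)[of i] by (auto elim!: Ints_cases intro: someI)
  have "x ^ degree p + (\<Sum>i<degree p. of_int (c i) * x ^ i) = 0"
    using p(1,3) unfolding poly_altdef lessThan_Suc_atMost[symmetric] by (simp add: c add.commute)
  then show "algebraic_integer x" unfolding algebraic_integer_def by blast
qed

text \<open>The vector \<open>e\<close> is an eigenvector of the integer matrix \<open>c\<close>, so
  \<open>x\<close> is a root of its characteristic polynomial, which is monic with integer
  coefficients.\<close>

lemma algebraic_int_eigenvalue:
  fixes e :: "nat \<Rightarrow> complex" and c :: "nat \<Rightarrow> nat \<Rightarrow> int"
  assumes "j < n" "e j \<noteq> 0"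
    and eig: "\<And>j. j < n \<Longrightarrow> x * e j = (\<Sum>k<n. of_int (c j k) * e k)"
  shows "algebraic_int x"
proof -
  define C where "C = Matrix.mat n n (\<lambda>(i, k). c i k)"
  have C: "C \<in> carrier_mat n n" unfolding C_def by simp
  define D where "D = (map_mat of_int C :: complex mat)"
  have D: "D \<in> carrier_mat n n" unfolding D_def using C by simp
  have "eigenvector D (Matrix.vec n e) x"
    unfolding eigenvector_def
  proof (intro conjI)
    show "Matrix.vec n e \<in> carrier_vec (dim_row D)" using D by auto
    show "Matrix.vec n e \<noteq> 0\<^sub>v (dim_row D)"
      using assms(1,2) D by (metis carrier_matD(1) index_vec index_zero_vec(1))
    show "D *\<^sub>v Matrix.vec n e = x \<cdot>\<^sub>v Matrix.vec n e"
    proof (rule eq_vecI)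
      fix i assume "i < dim_vec (x \<cdot>\<^sub>v Matrix.vec n e)"
      then have i: "i < n" by simp
      then show "vec_index (D *\<^sub>v Matrix.vec n e) i = vec_index (x \<cdot>\<^sub>v Matrix.vec n e) i"
        using eig[OF i] by (simp add: D_def C_def scalar_prod_def atLeast0LessThan)
    qed (use D in auto)
  qed
  then have "eigenvalue D x" unfolding eigenvalue_def by blast
  then have "poly (char_poly D) x = 0" using eigenvalue_root_char_poly[OF D] by blast
  moreover have "char_poly D = map_poly of_int (char_poly C)"
    unfolding D_def by (rule of_int_hom.char_poly_hom[OF C])
  ultimately have "poly (map_poly of_int (char_poly C)) x = 0" by simp
  moreover have "lead_coeff (char_poly C) = 1" using degree_monic_char_poly[OF C] by auto
  ultimately show ?thesis
    using algebraic_int_altdef_ipoly[of x] by blast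
qed

lemma algebraic_integer_power_reduction:
  assumes "algebraic_integer (x::complex)"
  obtains n and c :: "nat \<Rightarrow> int" where "n > 0" "x ^ n = (\<Sum>i<n. of_int (c i) * x ^ i)"
proof -
  obtain n and c :: "nat \<Rightarrow> int" where h: "x ^ n + (\<Sum>i<n. of_int (c i) * x ^ i) = 0"
    using assms unfolding algebraic_integer_def by blast
  have "n > 0" using h by (cases n) auto
  moreover have "x ^ n = (\<Sum>i<n. of_int (- c i) * x ^ i)"
    using h by (simp add: sum_negf eq_neg_iff_add_eq_0)
  ultimately show ?thesis by (rule that)
qed

text \<open>The integer combinations of the \<open>n * m\<close> monomials in \<open>x\<close> and
  \<open>y\<close> form a module stable under both multiplications. The monomial with exponents
  \<open>i\<close> and \<open>j\<close> gets the number \<open>i * m + j\<close>. The disjunction in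
  \<open>z\<close> lets one module serve for the sum and for the product.\<close>

lemma algebraic_int_bivariate:
  fixes x y z :: complex
  assumes "algebraic_int x" "algebraic_int y"
    and z: "z = x + y \<or> z = x * y"
  shows "algebraic_int z"
proof -
  obtain n c where n: "n > 0" and c: "x ^ n = (\<Sum>i<n. of_int (c i :: int) * x ^ i)"
    using algebraic_integer_power_reduction assms(1) algebraic_integer_iff_algebraic_int by metis
  obtain m d where m: "m > 0" and d: "y ^ m = (\<Sum>i<m. of_int (d i :: int) * y ^ i)"
    using algebraic_integer_power_reduction assms(2) algebraic_integer_iff_algebraic_int by metis
  define e where "e k = x ^ (k div m) * y ^ (k mod m)" for k
  define S where "S = {s. \<exists>c::nat \<Rightarrow> int. s = (\<Sum>k<n*m. of_int (c k) * e k)}"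
  have S_add: "a + b \<in> S" if ab: "a \<in> S" "b \<in> S" for a b
  proof -
    obtain c1 :: "nat \<Rightarrow> int" where "a = (\<Sum>k<n*m. of_int (c1 k) * e k)"
      using ab(1) unfolding S_def by blast
    moreover obtain c2 :: "nat \<Rightarrow> int" where "b = (\<Sum>k<n*m. of_int (c2 k) * e k)"
      using ab(2) unfolding S_def by blast
    ultimately have "a + b = (\<Sum>k<n*m. of_int (c1 k + c2 k) * e k)"
      by (simp add: sum.distrib ring_distribs)
    then show ?thesis unfolding S_def by (intro CollectI exI[of _ "\<lambda>k. c1 k + c2 k"])
  qed
  have S_scale: "of_int t * a \<in> S" if ab: "a \<in> S" for a t
  proof -
    obtain c1 :: "nat \<Rightarrow> int" where "a = (\<Sum>k<n*m. of_int (c1 k) * e k)"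
      using ab unfolding S_def by blast
    then have "of_int t * a = (\<Sum>k<n*m. of_int (t * c1 k) * e k)"
      by (simp add: sum_distrib_left mult.assoc)
    then show ?thesis unfolding S_def by (intro CollectI exI[of _ "\<lambda>k. t * c1 k"])
  qed
  have S_0: "0 \<in> S" unfolding S_def by (intro CollectI exI[of _ "\<lambda>_. 0"]) simp
  have S_sum: "(\<Sum>i\<in>I. of_int (f i) * g i) \<in> S" if "\<And>i. i \<in> I \<Longrightarrow> g i \<in> S" for f g and I :: "nat set"
    using that by (induction I rule: infinite_finite_induct) (auto intro: S_add S_scale S_0)
  have mon: "x ^ i * y ^ j \<in> S" if "i < n" "j < m" for i j
  proof -
    have "i * m + j < n * m"
    proof -
      have "i * m + j < Suc i * m" using that by simp
      also have "\<dots> \<le> n * m" using that by (intro mult_right_mono) auto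
      finally show ?thesis .
    qed
    moreover have "e (i * m + j) = x ^ i * y ^ j" unfolding e_def using that by simp
    ultimately show ?thesis unfolding S_def
      by (intro CollectI exI[of _ "\<lambda>k. if k = i * m + j then 1 else 0"])
         (auto simp: if_distrib[of of_int] if_distrib[of "\<lambda>c. c * _"] cong: if_cong)
  qed
  have idx: "k div m < n \<and> k mod m < m" if "k < n * m" for k
    using that m by (auto simp: less_mult_imp_div_less)
  have xe: "x * e k \<in> S" if "k < n * m" for k
  proof (cases "Suc (k div m) < n")
    case True
    then show ?thesis using mon[of "Suc (k div m)" "k mod m"] m unfolding e_def by (simp add: mult.assoc)
  next
    case False
    then have "Suc (k div m) = n" using idx[OF that] by simp
    then have "x * e k = x ^ n * y ^ (k mod m)" unfolding e_def by (metis mult.assoc power_Suc)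
    also have "\<dots> = (\<Sum>i<n. of_int (c i) * (x ^ i * y ^ (k mod m)))"
      by (simp add: c sum_distrib_right mult.assoc)
    also have "\<dots> \<in> S" using idx[OF that] by (intro S_sum mon) auto
    finally show ?thesis .
  qed
  have ye: "y * e k \<in> S" if "k < n * m" for k
  proof (cases "Suc (k mod m) < m")
    case True
    then show ?thesis using mon[of "k div m" "Suc (k mod m)"] idx[OF that]
      unfolding e_def by (simp add: mult.assoc mult.left_commute)
  next
    case False
    then have "Suc (k mod m) = m" using idx[OF that] by simp
    then have "y * e k = y ^ m * x ^ (k div m)" unfolding e_def
      by (metis mult.assoc mult.commute power_Suc)
    also have "\<dots> = (\<Sum>i<m. of_int (d i) * (x ^ (k div m) * y ^ i))"
      by (simp add: d sum_distrib_left mult_ac)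
    also have "\<dots> \<in> S" using idx[OF that] by (intro S_sum mon) auto
    finally show ?thesis .
  qed
  have Smul: "x * s \<in> S" if ab: "s \<in> S" for s
  proof -
    obtain c1 :: "nat \<Rightarrow> int" where "s = (\<Sum>k<n*m. of_int (c1 k) * e k)"
      using ab unfolding S_def by blast
    then have "x * s = (\<Sum>k<n*m. of_int (c1 k) * (x * e k))"
      by (simp add: sum_distrib_left mult_ac)
    also have "\<dots> \<in> S" by (intro S_sum xe) auto
    finally show ?thesis .
  qed
  have eS: "e k \<in> S" if "k < n * m" for k
    using mon idx[OF that] unfolding e_def by blast
  have ze: "\<exists>c::nat \<Rightarrow> int. z * e k = (\<Sum>j<n*m. of_int (c j) * e j)" if "k < n * m" for k
  proof -
    have "z * e k \<in> S"
      using z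
    proof
      assume "z = x + y"
      then show ?thesis using S_add[OF xe[OF that] ye[OF that]] by (simp add: ring_distribs)
    next
      assume "z = x * y"
      then show ?thesis using Smul[OF ye[OF that]] by (simp add: mult.assoc)
    qed
    then show ?thesis unfolding S_def by blast
  qed
  obtain C where C: "z * e k = (\<Sum>j<n*m. of_int (C k j :: int) * e j)" if "k < n * m" for k
    using ze by metis
  show ?thesis
    by (rule algebraic_int_eigenvalue[of 0 "n * m" e z C]) (use n m C in \<open>auto simp: e_def\<close>)
qed

lemma algebraic_int_add: "algebraic_int x \<Longrightarrow> algebraic_int y \<Longrightarrow> algebraic_int (x + y :: complex)"
  using algebraic_int_bivariate by blast

lemma algebraic_int_mult: "algebraic_int x \<Longrightarrow> algebraic_int y \<Longrightarrow> algebraic_int (x * y :: complex)"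
  using algebraic_int_bivariate by blast

section \<open>Independence of characters and square linear systems\<close>

text \<open>Artin's argument: subtracting \<open>\<phi> l y\<close> times the relation at
  \<open>x\<close> from the relation at \<open>y * x\<close> removes the index \<open>l\<close> and
  leaves the coefficients \<open>c j * (\<phi> j y - \<phi> l y)\<close>. The family is arbitrary
  because complex conjugation will be put next to the six powers of \<open>\<tau>\<close>.\<close>

lemma characters_independent:
  fixes \<phi> :: "'k \<Rightarrow> complex \<Rightarrow> complex"
  assumes "finite K"
    and "\<And>k x y. k \<in> K \<Longrightarrow> x \<in> F \<Longrightarrow> y \<in> F \<Longrightarrow> \<phi> k (x * y) = \<phi> k x * \<phi> k y"
    and "\<And>x y. x \<in> F \<Longrightarrow> y \<in> F \<Longrightarrow> x * y \<in> F"
    and "1 \<in> F" and "\<And>k. k \<in> K \<Longrightarrow> \<phi> k 1 = 1"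
    and "\<And>k l. k \<in> K \<Longrightarrow> l \<in> K \<Longrightarrow> k \<noteq> l \<Longrightarrow> \<exists>x\<in>F. \<phi> k x \<noteq> \<phi> l x"
    and "\<And>x. x \<in> F \<Longrightarrow> (\<Sum>k\<in>K. c k * \<phi> k x) = 0"
  shows "\<forall>k\<in>K. c k = 0"
  using assms
proof (induction K arbitrary: c)
  case empty
  then show ?case by simp
next
  case (insert l K)
  have z: "\<forall>k\<in>K. c k = 0"
  proof
    fix k assume k: "k \<in> K"
    then obtain y where y: "y \<in> F" "\<phi> k y \<noteq> \<phi> l y"
      using insert.prems(5)[of k l] insert.hyps by blast
    have "\<forall>j\<in>K. c j * (\<phi> j y - \<phi> l y) = 0"
    proof (rule insert.IH)
      fix x assume x: "x \<in> F"
      have "c l * \<phi> l (y * x) + (\<Sum>j\<in>K. c j * \<phi> j (y * x)) = 0"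
        using insert.prems(6)[of "y * x"] insert.prems(2)[OF y(1) x] insert.hyps by simp
      moreover have "\<phi> l y * (c l * \<phi> l x + (\<Sum>j\<in>K. c j * \<phi> j x)) = 0"
        using insert.prems(6)[OF x] insert.hyps by simp
      moreover have "(\<Sum>j\<in>K. c j * \<phi> j (y * x)) = (\<Sum>j\<in>K. c j * \<phi> j y * \<phi> j x)"
        using insert.prems(1) x y by (intro sum.cong) auto
      moreover have "\<phi> l (y * x) = \<phi> l y * \<phi> l x" using insert.prems(1) x y by blast
      ultimately show "(\<Sum>j\<in>K. c j * (\<phi> j y - \<phi> l y) * \<phi> j x) = 0"
        by (simp add: algebra_simps sum_subtractf sum_distrib_left)
           (metis (no_types, lifting) add_left_cancel)
    qed (use insert.prems in blast)+
    then show "c k = 0" using k y by auto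
  qed
  have "(\<Sum>j\<in>insert l K. c j * \<phi> j 1) = 0" by (rule insert.prems(6)[OF insert.prems(3)])
  moreover have "(\<Sum>j\<in>K. c j * \<phi> j 1) = 0" by (rule sum.neutral) (use z in auto)
  ultimately have "c l = 0" using insert.hyps insert.prems(4)[of l] by simp
  then show ?case using z by simp
qed

lemma square_system_solvable:
  fixes A :: "nat \<Rightarrow> nat \<Rightarrow> complex"
  assumes inj: "\<And>c. (\<And>i. i < n \<Longrightarrow> (\<Sum>k<n. A i k * c k) = 0) \<Longrightarrow> \<forall>k<n. c k = 0"
  shows "\<exists>c. \<forall>i<n. (\<Sum>k<n. A i k * c k) = r i"
proof -
  define M where "M = Matrix.mat n n (\<lambda>(i, k). A i k)"
  have M: "M \<in> carrier_mat n n" unfolding M_def by simp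
  have mv: "vec_index (M *\<^sub>v v) i = (\<Sum>k<n. A i k * vec_index v k)" if "i < n" "v \<in> carrier_vec n" for v i
    using that by (simp add: M_def scalar_prod_def atLeast0LessThan)
  have "det M \<noteq> 0"
  proof
    assume "det M = 0"
    then obtain v where v: "v \<in> carrier_vec n" "v \<noteq> 0\<^sub>v n" "M *\<^sub>v v = 0\<^sub>v n"
      using det_0_iff_vec_prod_zero_field[OF M] by blast
    have "\<forall>k<n. vec_index v k = 0" by (rule inj) (use mv[OF _ v(1)] v(3) in auto)
    then have "v = 0\<^sub>v n" using v(1) by auto
    then show False using v by blast
  qed
  then obtain N where N: "N \<in> carrier_mat n n" "M * N = 1\<^sub>m n"
    using det_non_zero_imp_unit[OF M, of "()"] unfolding Units_def ring_mat_def by auto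
  define c where "c = N *\<^sub>v Matrix.vec n r"
  have c: "c \<in> carrier_vec n" unfolding c_def using N by simp
  have "M *\<^sub>v c = M * N *\<^sub>v Matrix.vec n r"
    unfolding c_def by (rule assoc_mult_mat_vec[OF M N(1), symmetric]) simp
  also have "\<dots> = Matrix.vec n r" using N by simp
  finally have "\<forall>i<n. (\<Sum>k<n. A i k * vec_index c k) = r i" using mv[OF _ c] by simp
  then show ?thesis by blast
qed

section \<open>Indices of subgroups and short vectors of lattices\<close>

definition add_subgroup :: "complex set \<Rightarrow> bool" where
  "add_subgroup A \<longleftrightarrow> 0 \<in> A \<and> (\<forall>x\<in>A. \<forall>y\<in>A. x - y \<in> A)"

lemma add_subgroupD:
  assumes "add_subgroup A"
  shows "0 \<in> A" "x \<in> A \<Longrightarrow> y \<in> A \<Longrightarrow> x - y \<in> A" "x \<in> A \<Longrightarrow> - x \<in> A"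
    "x \<in> A \<Longrightarrow> y \<in> A \<Longrightarrow> x + y \<in> A"
proof -
  show 0: "0 \<in> A" and d: "x \<in> A \<Longrightarrow> y \<in> A \<Longrightarrow> x - y \<in> A" for x y
    using assms unfolding add_subgroup_def by auto
  show m: "x \<in> A \<Longrightarrow> - x \<in> A" for x using d[OF 0, of x] by simp
  show "x \<in> A \<Longrightarrow> y \<in> A \<Longrightarrow> x + y \<in> A" using d[OF _ m, of x y] by simp
qed

lemma add_subgroup_of_nat_mult:
  assumes "add_subgroup A" "x \<in> A" shows "of_nat n * x \<in> A"
  by (induction n) (use add_subgroupD[OF assms(1)] assms(2) in \<open>auto simp: ring_distribs\<close>)

lemma add_subgroup_image:
  assumes "add_subgroup A" and add: "\<And>x y. x \<in> A \<Longrightarrow> y \<in> A \<Longrightarrow> \<sigma> (x + y) = \<sigma> x + \<sigma> y"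
  shows "add_subgroup (\<sigma> ` A)"
proof -
  have 0: "\<sigma> 0 = 0" using add[of 0 0] add_subgroupD[OF assms(1)] by simp
  have "\<sigma> x - \<sigma> y = \<sigma> (x - y)" if "x \<in> A" "y \<in> A" for x y
    using add[of "x - y" y] that add_subgroupD[OF assms(1)] by simp
  then show ?thesis unfolding add_subgroup_def
    using 0 add_subgroupD[OF assms(1)] by (auto simp: image_iff)
qed

lemma coset_eq_iff:
  assumes "add_subgroup B"
  shows "(\<lambda>y. x + y) ` B = (\<lambda>y. z + y) ` B \<longleftrightarrow> x - z \<in> B"
proof
  assume h: "(\<lambda>y. x + y) ` B = (\<lambda>y. z + y) ` B"
  have "x \<in> (\<lambda>y. x + y) ` B" using add_subgroupD(1)[OF assms] by force
  then obtain y where "y \<in> B" "x = z + y" using h by auto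
  then show "x - z \<in> B" by simp
next
  assume h: "x - z \<in> B"
  have *: "(\<lambda>y. x + y) ` B \<subseteq> (\<lambda>y. z + y) ` B" if "x - z \<in> B" for x z
  proof
    fix w assume "w \<in> (\<lambda>y. x + y) ` B"
    then obtain y where y: "y \<in> B" "w = x + y" by auto
    then have "w = z + ((x - z) + y)" "(x - z) + y \<in> B" using add_subgroupD(4)[OF assms that] by auto
    then show "w \<in> (\<lambda>y. z + y) ` B" by blast
  qed
  have "z - x \<in> B" using add_subgroupD(3)[OF assms h] by simp
  then show "(\<lambda>y. x + y) ` B = (\<lambda>y. z + y) ` B" using *[OF h] *[of z x] by blast
qed

text \<open>With a representative \<open>r X\<close> fixed in every coset of \<open>B\<close>, a
  coset of \<open>C\<close> is determined by a coset \<open>X\<close> of \<open>B\<close> and a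
  coset of \<open>C\<close> inside \<open>B\<close>. Infinite sets have \<open>card\<close> 0, so
  the formula holds for infinite indices as well, and a positive \<open>add_index\<close> is how
  finiteness is expressed from here on.\<close>

lemma add_index_tower:
  assumes A: "add_subgroup A" and B: "add_subgroup B" and C: "add_subgroup C"
    and sub: "C \<subseteq> B" "B \<subseteq> A"
  shows "add_index A C = add_index A B * add_index B C"
proof -
  define cs where "cs A B = (\<lambda>x. (\<lambda>y. x + y) ` B) ` A" for A B :: "complex set"
  have "\<forall>X\<in>cs A B. \<exists>a\<in>A. X = (\<lambda>y. a + y) ` B" unfolding cs_def by blast
  then obtain r where r: "\<And>X. X \<in> cs A B \<Longrightarrow> r X \<in> A" "\<And>X. X \<in> cs A B \<Longrightarrow> X = (\<lambda>y. r X + y) ` B"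
    by metis
  define \<Phi> where "\<Phi> = (\<lambda>(X, Y). (\<lambda>y. r X + y) ` (Y :: complex set))"
  have "bij_betw \<Phi> (cs A B \<times> cs B C) (cs A C)"
  proof (rule bij_betw_imageI)
    show "inj_on \<Phi> (cs A B \<times> cs B C)"
    proof (rule inj_onI, clarify)
      fix X Y X' Y'
      assume h: "X \<in> cs A B" "Y \<in> cs B C" "X' \<in> cs A B" "Y' \<in> cs B C" "\<Phi> (X, Y) = \<Phi> (X', Y')"
      obtain b b' where b: "b \<in> B" "Y = (\<lambda>y. b + y) ` C" "b' \<in> B" "Y' = (\<lambda>y. b' + y) ` C"
        using h unfolding cs_def by blast
      have "(\<lambda>y. (r X + b) + y) ` C = (\<lambda>y. (r X' + b') + y) ` C"
        using h(5) unfolding \<Phi>_def b by (simp add: image_image add.assoc)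
      then have e: "(r X + b) - (r X' + b') \<in> C" using coset_eq_iff[OF C] by blast
      then have "(r X + b) - (r X' + b') - (b - b') \<in> B"
        using sub(1) by (intro add_subgroupD(2)[OF B _ add_subgroupD(2)[OF B b(1,3)]]) (rule subsetD)
      then have "r X - r X' \<in> B" by (simp add: algebra_simps)
      then have "(\<lambda>y. r X + y) ` B = (\<lambda>y. r X' + y) ` B" using coset_eq_iff[OF B] by blast
      then have "X = X'" using r(2)[OF h(1)] r(2)[OF h(3)] by simp
      moreover from this have "b - b' \<in> C" using e by simp
      then have "Y = Y'" unfolding b(2,4) using coset_eq_iff[OF C] by blast
      ultimately show "X = X' \<and> Y = Y'" by blast
    qed
    show "\<Phi> ` (cs A B \<times> cs B C) = cs A C"
    proof
      show "\<Phi> ` (cs A B \<times> cs B C) \<subseteq> cs A C"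
      proof clarify
        fix X Y assume h: "X \<in> cs A B" "Y \<in> cs B C"
        then obtain b where b: "b \<in> B" "Y = (\<lambda>y. b + y) ` C" unfolding cs_def by blast
        have "\<Phi> (X, Y) = (\<lambda>y. (r X + b) + y) ` C"
          unfolding \<Phi>_def b by (simp add: image_image add.assoc)
        moreover have "r X + b \<in> A" using r h b sub add_subgroupD(4)[OF A] by blast
        ultimately show "\<Phi> (X, Y) \<in> cs A C" unfolding cs_def by blast
      qed
      show "cs A C \<subseteq> \<Phi> ` (cs A B \<times> cs B C)"
      proof
        fix Z assume "Z \<in> cs A C"
        then obtain a where a: "a \<in> A" "Z = (\<lambda>y. a + y) ` C" unfolding cs_def by blast
        define X where "X = (\<lambda>y. a + y) ` B"
        have X: "X \<in> cs A B" unfolding X_def cs_def using a by blast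
        have "a - r X \<in> B" using r(2)[OF X] unfolding X_def using coset_eq_iff[OF B] by blast
        moreover have "Z = \<Phi> (X, (\<lambda>y. (a - r X) + y) ` C)"
          unfolding a \<Phi>_def by (simp add: image_image)
        ultimately show "Z \<in> \<Phi> ` (cs A B \<times> cs B C)" using X unfolding cs_def by blast
      qed
    qed
  qed
  then have "card (cs A B \<times> cs B C) = card (cs A C)" by (rule bij_betw_same_card)
  then show ?thesis unfolding add_index_def cs_def by (simp add: card_cartesian_product)
qed

lemma add_index_image:
  assumes "inj_on \<sigma> A" and add: "\<And>x y. x \<in> A \<Longrightarrow> y \<in> A \<Longrightarrow> \<sigma> (x + y) = \<sigma> x + \<sigma> y"
    and A: "add_subgroup A" and "B \<subseteq> A"
  shows "add_index (\<sigma> ` A) (\<sigma> ` B) = add_index A B"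
proof -
  have e: "(\<lambda>y. \<sigma> x + y) ` (\<sigma> ` B) = \<sigma> ` ((\<lambda>y. x + y) ` B)" if "x \<in> A" for x
    unfolding image_image using add[OF that] assms(4) by (intro image_cong) auto
  have "(\<lambda>x. (\<lambda>y. x + y) ` (\<sigma> ` B)) ` (\<sigma> ` A) = (\<lambda>X. \<sigma> ` X) ` ((\<lambda>x. (\<lambda>y. x + y) ` B) ` A)"
    unfolding image_image[of _ \<sigma> A] image_image[of "\<lambda>X. \<sigma> ` X"] by (rule image_cong[OF refl e])
  moreover have "inj_on (\<lambda>X. \<sigma> ` X) ((\<lambda>x. (\<lambda>y. x + y) ` B) ` A)"
  proof (rule inj_on_subset[OF inj_on_image_Pow[OF assms(1)]])
    show "(\<lambda>x. (\<lambda>y. x + y) ` B) ` A \<subseteq> Pow A"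
      using add_subgroupD(4)[OF A] assms(4) by auto
  qed
  ultimately show ?thesis unfolding add_index_def by (simp add: card_image)
qed

text \<open>The index of k C in A is computed through C and through k A; the factor [A : C] =
  [k A : k C] cancels. This carries the count of classes modulo k between commensurable groups, so
  that a free subgroup of finite index is enough.\<close>

lemma add_index_multiple_mono:
  assumes A: "add_subgroup A" and C: "add_subgroup C" and "C \<subseteq> A" "add_index A C > 0" "k > 0"
  shows "add_index A ((\<lambda>x. of_nat k * x) ` A) = add_index C ((\<lambda>x. of_nat k * x) ` C)"
proof -
  let ?s = "\<lambda>X. (\<lambda>x. of_nat k * x :: complex) ` X"
  have sub: "add_subgroup (?s X)" "?s X \<subseteq> X" if "add_subgroup X" for X
    using that by (auto intro!: add_subgroup_image add_subgroup_of_nat_mult simp: ring_distribs)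
  have "add_index A C * add_index C (?s C) = add_index A (?s A) * add_index (?s A) (?s C)"
    using add_index_tower[OF A C sub(1)[OF C] sub(2)[OF C] assms(3)]
      add_index_tower[OF A sub(1)[OF A] sub(1)[OF C] _ sub(2)[OF A]] assms(3) by auto
  moreover have "add_index (?s A) (?s C) = add_index A C"
    using assms(3,5) by (intro add_index_image A) (auto simp: inj_on_def ring_distribs)
  ultimately show ?thesis using assms(4) by auto
qed

definition int_span :: "nat \<Rightarrow> (nat \<Rightarrow> complex) \<Rightarrow> complex set" where
  "int_span d b = range (\<lambda>c :: nat \<Rightarrow> int. \<Sum>i<d. of_int (c i) * b i)"

lemma int_span_subgroup: "add_subgroup (int_span d b)"
  unfolding add_subgroup_def int_span_def
proof (intro conjI ballI)
  show "0 \<in> range (\<lambda>c :: nat \<Rightarrow> int. \<Sum>i<d. of_int (c i) * b i)"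
    by (rule range_eqI[of _ _ "\<lambda>_. 0"]) simp
  fix x y assume "x \<in> range (\<lambda>c :: nat \<Rightarrow> int. \<Sum>i<d. of_int (c i) * b i)"
    "y \<in> range (\<lambda>c :: nat \<Rightarrow> int. \<Sum>i<d. of_int (c i) * b i)"
  then obtain c c' :: "nat \<Rightarrow> int" where "x = (\<Sum>i<d. of_int (c i) * b i)" "y = (\<Sum>i<d. of_int (c' i) * b i)"
    by blast
  then show "x - y \<in> range (\<lambda>c :: nat \<Rightarrow> int. \<Sum>i<d. of_int (c i) * b i)"
    by (intro range_eqI[of _ _ "\<lambda>i. c i - c' i"]) (simp add: sum_subtractf ring_distribs)
qed

text \<open>Two combinations are congruent modulo k exactly if their coefficients are; the functions
  in \<open>P\<close> are the reduced coefficient vectors.\<close>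

lemma add_index_int_span:
  fixes b :: "nat \<Rightarrow> complex"
  assumes indep: "\<And>c :: nat \<Rightarrow> int. (\<Sum>i<d. of_int (c i) * b i) = 0 \<Longrightarrow> \<forall>i<d. c i = 0" and "k > 0"
  shows "add_index (int_span d b) ((\<lambda>x. of_nat k * x) ` int_span d b) = k ^ d"
proof -
  define M where "M = int_span d b"
  define kM where "kM = (\<lambda>x. of_nat k * x) ` M"
  have kM: "add_subgroup kM"
    unfolding kM_def M_def by (intro add_subgroup_image int_span_subgroup) (simp add: ring_distribs)
  define \<Phi> where "\<Phi> c = (\<Sum>i<d. of_int (c i) * b i)" for c :: "nat \<Rightarrow> int"
  have M: "M = range \<Phi>" unfolding M_def int_span_def \<Phi>_def by simp
  have diff: "\<Phi> c - \<Phi> c' = \<Phi> (\<lambda>i. c i - c' i)" for c c'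
    unfolding \<Phi>_def by (simp add: sum_subtractf ring_distribs)
  have scale: "of_nat k * \<Phi> c = \<Phi> (\<lambda>i. int k * c i)" for c
    unfolding \<Phi>_def by (simp add: sum_distrib_left mult.assoc)
  have mem: "\<Phi> c - \<Phi> c' \<in> kM \<longleftrightarrow> (\<forall>i<d. c i mod int k = c' i mod int k)" for c c'
  proof
    assume "\<Phi> c - \<Phi> c' \<in> kM"
    then obtain e where "\<Phi> c - \<Phi> c' = \<Phi> (\<lambda>i. int k * e i)"
      unfolding kM_def M using scale by auto
    then have "\<Phi> (\<lambda>i. c i - c' i - int k * e i) = 0"
      using diff[of "\<lambda>i. c i - c' i" "\<lambda>i. int k * e i"] diff[of c c'] by simp
    then have "\<forall>i<d. c i - c' i - int k * e i = 0" unfolding \<Phi>_def by (rule indep)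
    then have "\<forall>i<d. c i = c' i + int k * e i" by (auto simp: algebra_simps)
    then show "\<forall>i<d. c i mod int k = c' i mod int k" by simp
  next
    assume h: "\<forall>i<d. c i mod int k = c' i mod int k"
    have "\<Phi> (\<lambda>i. c i - c' i) = \<Phi> (\<lambda>i. int k * ((c i - c' i) div int k))"
      unfolding \<Phi>_def
    proof (rule sum.cong[OF refl])
      fix i assume "i \<in> {..<d}"
      then have "int k dvd c i - c' i" using h by (auto simp: mod_eq_dvd_iff)
      then show "of_int (c i - c' i) * b i = of_int (int k * ((c i - c' i) div int k)) * b i" by simp
    qed
    then have "\<Phi> c - \<Phi> c' = of_nat k * \<Phi> (\<lambda>i. (c i - c' i) div int k)"
      unfolding diff scale .
    then show "\<Phi> c - \<Phi> c' \<in> kM" unfolding kM_def M by blast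
  qed
  define cs where "cs x = (\<lambda>y. x + y) ` kM" for x
  have cs: "cs (\<Phi> c) = cs (\<Phi> c') \<longleftrightarrow> (\<forall>i<d. c i mod int k = c' i mod int k)" for c c'
    unfolding cs_def coset_eq_iff[OF kM] mem ..
  define P where "P = PiE {..<d} (\<lambda>_. {0..<int k})"
  have "inj_on (\<lambda>c. cs (\<Phi> c)) P"
  proof (rule inj_onI)
    fix c c' assume h: "c \<in> P" "c' \<in> P" "cs (\<Phi> c) = cs (\<Phi> c')"
    have "c i = c' i" if "i < d" for i
    proof -
      have "c i \<in> {0..<int k}" "c' i \<in> {0..<int k}" using h that unfolding P_def by auto
      then show ?thesis using h(3) that unfolding cs by auto
    qed
    then show "c = c'" using h unfolding P_def by (intro PiE_ext[of c "{..<d}" _ c']) auto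
  qed
  moreover have "(\<lambda>c. cs (\<Phi> c)) ` P = cs ` M"
  proof
    show "cs ` M \<subseteq> (\<lambda>c. cs (\<Phi> c)) ` P"
    proof
      fix X assume "X \<in> cs ` M"
      then obtain c where c: "X = cs (\<Phi> c)" unfolding M by blast
      have "restrict (\<lambda>i. c i mod int k) {..<d} \<in> P" unfolding P_def using assms(2) by auto
      moreover have "cs (\<Phi> c) = cs (\<Phi> (restrict (\<lambda>i. c i mod int k) {..<d}))"
        unfolding cs by auto
      ultimately show "X \<in> (\<lambda>c. cs (\<Phi> c)) ` P" using c by blast
    qed
  qed (auto simp: M)
  ultimately have "card (cs ` M) = card P" by (metis card_image)
  then show ?thesis unfolding add_index_def cs_def kM_def M_def P_def by (simp add: card_PiE)
qed

text \<open>The left side will bound the number of lattice vectors with \<open>Q\<close> between k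
  and k + 1. It equals 4096 at k = 6, and Bernoulli's inequality bounds its growth by a factor
  (9/8)^6 < 3 per step, so that it can be summed against a geometric series of ratio at most
  1/6.\<close>

lemma shell_count_bound:
  fixes k :: nat
  assumes k: "k \<ge> 6" shows "real ((k div 2 + 1) ^ 6) \<le> 4096 * 3 ^ (k - 6)"
proof -
  define j where "j = k - 6"
  have "2 * (k div 2) \<le> k" by simp
  then have "real (k div 2 + 1) \<le> real k / 2 + 1" by linarith
  also have "\<dots> = 4 * (1 + real j * (1/8))" using k by (simp add: j_def of_nat_diff field_simps)
  also have "\<dots> \<le> 4 * (1 + 1/8) ^ j"
    by (intro mult_left_mono Bernoulli_inequality) auto
  finally have "real (k div 2 + 1) ^ 6 \<le> (4 * (1 + 1/8) ^ j) ^ 6"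
    by (intro power_mono) auto
  also have "\<dots> = 4096 * ((9/8) ^ 6) ^ j"
    by (simp add: power_mult_distrib power_mult[symmetric] mult.commute)
  also have "\<dots> \<le> 4096 * 3 ^ j"
    by (intro mult_left_mono power_mono) (auto simp: power_divide)
  finally show ?thesis unfolding j_def by simp
qed

text \<open>All that the counting arguments take from a positive definite quadratic form on a
  lattice of rank 6: the rank enters through the indices of the multiples, the form through the
  parallelogram law and its minimum. Instances are the ring of integers and fractional ideals of a
  degree-zero divisor.\<close>

locale lattice6 =
  fixes L :: "complex set" and Q :: "complex \<Rightarrow> real"
  assumes subgroup: "add_subgroup L"
    and index: "\<And>m. m > 0 \<Longrightarrow> add_index L ((\<lambda>x. of_nat m * x) ` L) = m ^ 6"
    and parallelogram: "\<And>x y. x \<in> L \<Longrightarrow> y \<in> L \<Longrightarrow> Q (x + y) + Q (x - y) = 2 * Q x + 2 * Q y"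
    and Q_mult: "\<And>m x. x \<in> L \<Longrightarrow> Q (of_nat m * x) = (real m)\<^sup>2 * Q x"
    and Q_nonneg: "\<And>x. x \<in> L \<Longrightarrow> Q x \<ge> 0"
    and Q_min: "\<And>x. x \<in> L \<Longrightarrow> x \<noteq> 0 \<Longrightarrow> Q x \<ge> 3"
begin

lemmas L = add_subgroupD[OF subgroup]

lemma multiple_subgroup: "add_subgroup ((\<lambda>x. of_nat m * x) ` L)"
  by (intro add_subgroup_image subgroup) (simp add: ring_distribs)

lemma Q_0: "Q 0 = 0"
  using Q_mult[of 0 0] L(1) by simp

lemma coset_count: 
  assumes "m > 0"
  shows "finite ((\<lambda>x. (\<lambda>y. x + y) ` ((\<lambda>x. of_nat m * x) ` L)) ` L)"
    "card ((\<lambda>x. (\<lambda>y. x + y) ` ((\<lambda>x. of_nat m * x) ` L)) ` L) = m ^ 6"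
proof -
  show *: "card ((\<lambda>x. (\<lambda>y. x + y) ` ((\<lambda>x. of_nat m * x) ` L)) ` L) = m ^ 6"
    using index[OF assms] unfolding add_index_def by simp
  show "finite ((\<lambda>x. (\<lambda>y. x + y) ` ((\<lambda>x. of_nat m * x) ` L)) ` L)"
    by (rule card_ge_0_finite) (use * assms in simp)
qed

text \<open>Two short vectors in the same class modulo m differ by m times a nonzero vector,
  which is too long.\<close>
lemma count_short:
  assumes "m > 0" "t \<le> 3 * (real m)\<^sup>2 / 4"
  shows "finite {x\<in>L. Q x < t}" "card {x\<in>L. Q x < t} \<le> m ^ 6"
proof -
  let ?cs = "\<lambda>x. (\<lambda>y. x + y) ` ((\<lambda>x. of_nat m * x) ` L)"
  have inj: "inj_on ?cs {x\<in>L. Q x < t}"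
  proof (rule inj_onI, rule ccontr)
    fix x y assume h: "x \<in> {x\<in>L. Q x < t}" "y \<in> {x\<in>L. Q x < t}" "?cs x = ?cs y" "x \<noteq> y"
    then obtain z where z: "z \<in> L" "x - y = of_nat m * z"
      unfolding coset_eq_iff[OF multiple_subgroup] by blast
    then have "Q z \<ge> 3" using h by (intro Q_min) auto
    then have "(real m)\<^sup>2 * 3 \<le> Q (x - y)"
      unfolding z(2) Q_mult[OF z(1)] by (intro mult_left_mono) auto
    moreover have "Q (x + y) \<ge> 0" using h L by (intro Q_nonneg) auto
    \<comment> \<open>The parallelogram law gives \<open>Q (x - y) < 4 * t\<close>, which is where
      the threshold on \<open>t\<close> comes from.\<close>
    ultimately show False using parallelogram[of x y] h assms(2) by simp
  qed
  have sub: "?cs ` {x\<in>L. Q x < t} \<subseteq> ?cs ` L" by blast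
  show "finite {x\<in>L. Q x < t}"
    by (rule finite_imageD[OF finite_subset[OF sub coset_count(1)[OF assms(1)]] inj])
  show "card {x\<in>L. Q x < t} \<le> m ^ 6"
    using card_inj_on_le[OF inj sub coset_count(1)[OF assms(1)]] coset_count(2)[OF assms(1)] by simp
qed

lemma finite_less_6: "finite {x\<in>L. Q x < 6}"
  by (rule count_short(1)[of 3]) (auto simp: power2_eq_square)

text \<open>A class modulo 2 contains at most one pair of opposite vectors of norm below 6,
  and the zero class contains none.\<close>
lemma count_below_6: "card {x\<in>L. x \<noteq> 0 \<and> Q x < 6} \<le> 126"
proof -
  define cs where "cs x = (\<lambda>y. x + y) ` ((\<lambda>x. of_nat 2 * x) ` L)" for x
  have cs_eq: "cs x = cs y \<longleftrightarrow> (\<exists>z\<in>L. x - y = 2 * z)" for x y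
    unfolding cs_def coset_eq_iff[OF multiple_subgroup] by auto
  define S where "S = {x\<in>L. x \<noteq> 0 \<and> Q x < 6}"
  have Q2: "Q (2 * z) = 4 * Q z" if "z \<in> L" for z using Q_mult[OF that, of 2] by simp
  have finS: "finite S" by (rule finite_subset[OF _ finite_less_6]) (auto simp: S_def)
  have pair: "y = x \<or> y = - x" if xy: "x \<in> S" "y \<in> S" "cs x = cs y" for x y
  proof (rule ccontr)
    assume ne: "\<not> (y = x \<or> y = - x)"
    obtain z where z: "z \<in> L" "x - y = 2 * z" using xy(3) cs_eq by blast
    then have z': "z + y \<in> L" "x + y = 2 * (z + y)"
      using xy L by (auto simp: S_def algebra_simps)
    have "z \<noteq> 0" using ne z(2) by auto
    moreover have "z + y \<noteq> 0"
    proof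
      assume "z + y = 0"
      then have "x + y = 0" using z'(2) by simp
      then show False using ne by (metis add.inverse_inverse minus_unique)
    qed
    ultimately have "Q z \<ge> 3" "Q (z + y) \<ge> 3" using Q_min z z' by auto
    \<comment> \<open>The two bounds add up to 24, while the parallelogram law leaves less than 2 *
      6 + 2 * 6: the value 6 is the largest for which this works.\<close>
    then have "Q (x - y) \<ge> 12" "Q (x + y) \<ge> 12" unfolding z(2) z'(2) Q2[OF z(1)] Q2[OF z'(1)] by auto
    then show False using parallelogram[of x y] xy by (auto simp: S_def)
  qed
  have nz: "cs x \<noteq> cs 0" if "x \<in> S" for x
  proof
    assume "cs x = cs 0"
    then obtain z where z: "z \<in> L" "x = 2 * z" unfolding cs_eq by auto
    then have "Q z \<ge> 3" using that by (intro Q_min) (auto simp: S_def)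
    then show False using Q2[OF z(1)] z that by (auto simp: S_def)
  qed
  have fin: "finite (cs ` L)" and card: "card (cs ` L) = 64"
    using coset_count[of 2] unfolding cs_def by auto
  define T where "T = cs ` L - {cs 0}"
  have T: "finite T" "card T = 63"
    unfolding T_def using fin card L(1) by auto
  have "card S \<le> card (\<Union>X\<in>T. {x\<in>S. cs x = X})"
  proof (rule card_mono)
    show "finite (\<Union>X\<in>T. {x\<in>S. cs x = X})" using T(1) finS by auto
    show "S \<subseteq> (\<Union>X\<in>T. {x\<in>S. cs x = X})" using nz unfolding T_def by (auto simp: S_def)
  qed
  also have "\<dots> \<le> (\<Sum>X\<in>T. card {x\<in>S. cs x = X})" by (rule card_UN_le[OF T(1)])
  also have "\<dots> \<le> (\<Sum>X\<in>T. 2)"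
  proof (rule sum_mono)
    fix X
    show "card {x\<in>S. cs x = X} \<le> 2"
    proof (cases "{x\<in>S. cs x = X} = {}")
      case False
      then obtain x where x: "x \<in> S" "cs x = X" by blast
      have "{x\<in>S. cs x = X} \<subseteq> {x, - x}" using pair[OF x(1)] x(2) by auto
      then have "card {x\<in>S. cs x = X} \<le> card {x, - x}" by (intro card_mono) auto
      also have "\<dots> \<le> 2" by (simp add: card_insert_if)
      finally show ?thesis .
    qed (metis card.empty zero_le)
  qed
  also have "\<dots> = 126" using T by simp
  finally show ?thesis unfolding S_def .
qed

text \<open>The vectors are grouped by the integer part of \<open>Q\<close>. The shells grow by a
  factor of at most 3, so the total is at most a geometric series of ratio
  \<open>3 * \<rho>\<close>, hence at most twice its first term; 8192 is 2 * 4096. The free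
  \<open>C\<close> and \<open>\<rho>\<close> allow weights that carry a polynomial factor.\<close>

lemma tail_bound:
  fixes G :: "complex \<Rightarrow> real"
  assumes nonneg: "\<And>x. x \<in> L \<Longrightarrow> G x \<ge> 0"
    and decay: "\<And>x. x \<in> L \<Longrightarrow> Q x \<ge> 6 \<Longrightarrow> G x \<le> C * \<rho> ^ nat \<lfloor>Q x\<rfloor>"
    and \<rho>: "0 \<le> \<rho>" "\<rho> \<le> 1/6" and "C \<ge> 0"
  shows "G summable_on {x\<in>L. Q x \<ge> 6}" "infsum G {x\<in>L. Q x \<ge> 6} \<le> 8192 * C * \<rho> ^ 6"
proof -
  have fin: "sum G X \<le> 8192 * C * \<rho> ^ 6" if X: "finite X" "X \<subseteq> {x\<in>L. Q x \<ge> 6}" for X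
  proof -
    define fl where "fl x = nat \<lfloor>Q x\<rfloor>" for x
    define N where "N = Suc (Max (insert 6 (fl ` X)))"
    have N: "fl ` X \<subseteq> {6..<N}"
    proof
      fix k assume k: "k \<in> fl ` X"
      then have "k \<le> Max (insert 6 (fl ` X))" using X(1) by (intro Max_ge) auto
      moreover have "6 \<le> k" using k X(2) unfolding fl_def by (auto simp: le_nat_iff le_floor_iff)
      ultimately show "k \<in> {6..<N}" unfolding N_def by simp
    qed
    have "sum G X = (\<Sum>k\<in>{6..<N}. \<Sum>x\<in>{x\<in>X. fl x = k}. G x)"
      by (rule sum.group[symmetric, OF X(1) _ N]) simp
    also have "\<dots> \<le> (\<Sum>k\<in>{6..<N}. 4096 * 3 ^ (k - 6) * (C * \<rho> ^ k))"
    proof (rule sum_mono)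
      fix k assume k: "k \<in> {6..<N}"
      have le: "{x\<in>X. fl x = k} \<subseteq> {x\<in>L. Q x < real (k + 1)}"
      proof clarify
        fix x assume x: "x \<in> X" "k = fl x"
        then have "Q x \<ge> 6" "x \<in> L" using X(2) by auto
        then show "x \<in> L \<and> Q x < real (fl x + 1)" unfolding fl_def
          using real_of_int_floor_add_one_gt[of "Q x"] by (auto simp: add.commute)
      qed
      \<comment> \<open>The modulus \<open>m = k div 2 + 1\<close> satisfies 2 m \<ge> k + 1, so it
        is enough that 16 (k + 1) \<le> 3 (k + 1)^2, which holds from k = 5 on.\<close>
      have m: "real (k + 1) \<le> 3 * (real (k div 2 + 1))\<^sup>2 / 4"
      proof -
        have "real k + 1 \<le> 2 * real (k div 2 + 1)"
        proof -
          have "k + 1 \<le> 2 * (k div 2 + 1)" by simp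
          then show ?thesis by linarith
        qed
        then have "(real k + 1)\<^sup>2 \<le> (2 * real (k div 2 + 1))\<^sup>2" by (intro power_mono) auto
        then have "(real k + 1)\<^sup>2 \<le> 4 * (real (k div 2 + 1))\<^sup>2"
          unfolding power_mult_distrib by simp
        moreover have "(real k + 1) * 16 \<le> (real k + 1) * (3 * (real k + 1))"
          using k by (intro mult_left_mono) auto
        then have "16 * (real k + 1) \<le> 3 * (real k + 1)\<^sup>2"
          by (simp add: power2_eq_square algebra_simps)
        ultimately show ?thesis by simp
      qed
      have "(\<Sum>x\<in>{x\<in>X. fl x = k}. G x) \<le> (\<Sum>x\<in>{x\<in>X. fl x = k}. C * \<rho> ^ k)"
        using X(2) decay by (intro sum_mono) (auto simp: fl_def)
      also have "\<dots> = real (card {x\<in>X. fl x = k}) * (C * \<rho> ^ k)" by simp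
      also have "\<dots> \<le> 4096 * 3 ^ (k - 6) * (C * \<rho> ^ k)"
      proof (rule mult_right_mono)
        have "card {x\<in>X. fl x = k} \<le> card {x\<in>L. Q x < real (k + 1)}"
          by (rule card_mono[OF _ le], rule count_short(1)[OF _ m]) simp
        also have "\<dots> \<le> (k div 2 + 1) ^ 6" by (rule count_short(2)[OF _ m]) simp
        finally show "real (card {x\<in>X. fl x = k}) \<le> 4096 * 3 ^ (k - 6)"
          using shell_count_bound[of k] k by (meson atLeastLessThan_iff le_trans of_nat_le_iff order_trans)
      qed (use \<rho> \<open>C \<ge> 0\<close> in auto)
      finally show "(\<Sum>x\<in>{x\<in>X. fl x = k}. G x) \<le> 4096 * 3 ^ (k - 6) * (C * \<rho> ^ k)" .
    qed
    also have "\<dots> = (\<Sum>k\<in>{6..<N}. 4096 * C * \<rho> ^ 6 * (3 * \<rho>) ^ (k - 6))"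
    proof (rule sum.cong[OF refl])
      fix k assume "k \<in> {6..<N}"
      then have "\<rho> ^ k = \<rho> ^ 6 * \<rho> ^ (k - 6)" by (simp add: power_add[symmetric])
      then show "4096 * 3 ^ (k - 6) * (C * \<rho> ^ k) = 4096 * C * \<rho> ^ 6 * (3 * \<rho>) ^ (k - 6)"
        by (simp add: power_mult_distrib)
    qed
    also have "\<dots> = 4096 * C * \<rho> ^ 6 * (\<Sum>k\<in>{6..<N}. (3 * \<rho>) ^ (k - 6))"
      by (simp add: sum_distrib_left)
    also have "(\<Sum>k\<in>{6..<N}. (3 * \<rho>) ^ (k - 6)) = (\<Sum>j<N - 6. (3 * \<rho>) ^ j)"
      by (rule sum.reindex_bij_witness[of _ "\<lambda>j. j + 6" "\<lambda>k. k - 6"]) auto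
    also have "\<dots> \<le> (\<Sum>j<N - 6. (1/2) ^ j)" using \<rho> by (intro sum_mono power_mono) auto
    also have "\<dots> \<le> 2"
      using geometric_sum[of "1/2::real" "N - 6"] by simp
    finally show ?thesis using \<rho> \<open>C \<ge> 0\<close> by (simp add: mult_left_mono)
  qed
  show "G summable_on {x\<in>L. Q x \<ge> 6}"
    by (rule nonneg_bdd_above_summable_on) (use nonneg fin in \<open>auto intro!: bdd_aboveI\<close>)
  then show "infsum G {x\<in>L. Q x \<ge> 6} \<le> 8192 * C * \<rho> ^ 6"
    by (rule infsum_le_finite_sums) (use fin in auto)
qed

lemma summable_if_tail:
  fixes G :: "complex \<Rightarrow> real"
  assumes "G summable_on {x\<in>L. Q x \<ge> 6}"
  shows "G summable_on L"
proof -
  have "G summable_on ({x\<in>L. Q x < 6} \<union> {x\<in>L. Q x \<ge> 6})"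
    using summable_on_finite[OF finite_less_6] assms by (rule summable_on_Un_disjoint) auto
  moreover have "{x\<in>L. Q x < 6} \<union> {x\<in>L. Q x \<ge> 6} = L" by auto
  ultimately show ?thesis by simp
qed

end

section \<open>Conjugates in a cyclic sextic field\<close>

locale cyclic_sextic =
  fixes F :: "complex set" and \<tau> :: "complex \<Rightarrow> complex"
  assumes galois: "cyclic_sextic_galois F \<tau>" and imaginary: "totally_imaginary F"
begin

abbreviation "t k \<equiv> \<tau> ^^ k"

lemma shows F_0: "0 \<in> F" and F_1: "1 \<in> F"
  and F_add: "x \<in> F \<Longrightarrow> y \<in> F \<Longrightarrow> x + y \<in> F"
  and F_mult: "x \<in> F \<Longrightarrow> y \<in> F \<Longrightarrow> x * y \<in> F"
  and F_uminus: "x \<in> F \<Longrightarrow> - x \<in> F"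
  and F_inverse: "x \<in> F \<Longrightarrow> inverse x \<in> F"
proof -
  have "subfield_of_complex F"
    using galois unfolding cyclic_sextic_galois_def number_field_of_degree_def by blast
  then show "0 \<in> F" "1 \<in> F" "x \<in> F \<Longrightarrow> y \<in> F \<Longrightarrow> x + y \<in> F" "x \<in> F \<Longrightarrow> y \<in> F \<Longrightarrow> x * y \<in> F"
    "x \<in> F \<Longrightarrow> - x \<in> F" "x \<in> F \<Longrightarrow> inverse x \<in> F"
    unfolding subfield_of_complex_def by (blast, blast, blast, blast, blast, cases "x = 0", auto)
qed

lemma F_diff: "x \<in> F \<Longrightarrow> y \<in> F \<Longrightarrow> x - y \<in> F"
  using F_add[OF _ F_uminus, of x y] by simp

lemma F_sum: "(\<And>i. i \<in> I \<Longrightarrow> f i \<in> F) \<Longrightarrow> sum f I \<in> F"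
  by (induction I rule: infinite_finite_induct) (auto intro: F_0 F_add)

lemma F_prod: "(\<And>i. i \<in> I \<Longrightarrow> f i \<in> F) \<Longrightarrow> prod f I \<in> F"
  by (induction I rule: infinite_finite_induct) (auto intro: F_1 F_mult)

lemma F_of_nat: "of_nat n \<in> F"
  by (induction n) (auto intro: F_0 F_1 F_add)

lemma F_of_int: "of_int n \<in> F"
  by (cases n rule: int_cases2) (auto intro: F_of_nat F_uminus)

lemma F_of_rat: "of_rat r \<in> F"
proof (cases r)
  case (Fract a b)
  then have "(of_rat r :: complex) = of_int a * inverse (of_int b)"
    by (simp add: of_rat_rat field_simps)
  then show ?thesis using F_mult F_of_int F_inverse by metis
qed

lemma F_power: "x \<in> F \<Longrightarrow> x ^ n \<in> F"
  by (induction n) (auto intro: F_1 F_mult)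

lemma tau_F: "x \<in> F \<Longrightarrow> \<tau> x \<in> F"
  using galois unfolding cyclic_sextic_galois_def field_aut_on_def bij_betw_def by blast

lemma t_F: "x \<in> F \<Longrightarrow> t k x \<in> F"
  by (induction k) (auto intro: tau_F)

lemma shows t_add: "x \<in> F \<Longrightarrow> y \<in> F \<Longrightarrow> t k (x + y) = t k x + t k y"
  and t_mult: "x \<in> F \<Longrightarrow> y \<in> F \<Longrightarrow> t k (x * y) = t k x * t k y"
  and t_1: "t k 1 = 1"
proof -
  have "\<tau> (x + y) = \<tau> x + \<tau> y" "\<tau> (x * y) = \<tau> x * \<tau> y" if "x \<in> F" "y \<in> F" for x y
    using galois that unfolding cyclic_sextic_galois_def field_aut_on_def field_emb_on_def by auto
  moreover have "\<tau> 1 = 1"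
    using galois unfolding cyclic_sextic_galois_def field_aut_on_def field_emb_on_def by auto
  ultimately show "x \<in> F \<Longrightarrow> y \<in> F \<Longrightarrow> t k (x + y) = t k x + t k y"
    "x \<in> F \<Longrightarrow> y \<in> F \<Longrightarrow> t k (x * y) = t k x * t k y" "t k 1 = 1"
    by (induction k) (auto simp: t_F)
qed

lemma t_0: "t k 0 = 0"
  using t_add[OF F_0 F_0, of k] by simp

lemma t_uminus: "x \<in> F \<Longrightarrow> t k (- x) = - t k x"
  using t_add[OF _ F_uminus, of x x k] by (simp add: t_0 eq_neg_iff_add_eq_0 add.commute)

lemma t_diff: "x \<in> F \<Longrightarrow> y \<in> F \<Longrightarrow> t k (x - y) = t k x - t k y"
  using t_add[OF _ F_uminus, of x y k] by (simp add: t_uminus)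

lemma t_sum: "(\<And>i. i \<in> I \<Longrightarrow> f i \<in> F) \<Longrightarrow> t k (sum f I) = (\<Sum>i\<in>I. t k (f i))"
  by (induction I rule: infinite_finite_induct) (auto simp: t_0 t_add F_sum)

lemma t_prod: "(\<And>i. i \<in> I \<Longrightarrow> f i \<in> F) \<Longrightarrow> t k (prod f I) = (\<Prod>i\<in>I. t k (f i))"
  by (induction I rule: infinite_finite_induct) (auto simp: t_1 t_mult F_prod)

lemma t_of_nat: "t k (of_nat n) = of_nat n"
  by (induction n) (auto simp: t_0 t_1 t_add F_1 F_of_nat)

lemma t_of_int: "t k (of_int n) = of_int n"
  by (cases n rule: int_cases2) (auto simp: t_of_nat t_uminus F_of_nat)

lemma t_inverse: 
  assumes "x \<in> F" "x \<noteq> 0" shows "t k (inverse x) = inverse (t k x)"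
proof -
  have "t k x * t k (inverse x) = 1"
    using t_mult[OF assms(1) F_inverse[OF assms(1)], of k] assms(2) by (simp add: t_1)
  then show ?thesis by (simp add: inverse_unique)
qed

lemma t_of_rat: "t k (of_rat r) = of_rat r"
proof (cases r)
  case (Fract a b)
  then have "(of_rat r :: complex) = of_int a * inverse (of_int b)"
    by (simp add: of_rat_rat field_simps)
  moreover have "(of_int b :: complex) \<noteq> 0" using Fract by simp
  ultimately show ?thesis by (simp add: t_mult t_inverse t_of_int F_of_int F_inverse)
qed

lemma t_power: "x \<in> F \<Longrightarrow> t k (x ^ n) = t k x ^ n"
  by (induction n) (auto simp: t_1 t_mult F_power)

lemma t_eq_0: "x \<in> F \<Longrightarrow> t k x = 0 \<longleftrightarrow> x = 0"
  using t_mult[OF _ F_inverse, of x x k] t_1[of k] t_0[of k] by (cases "x = 0") auto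

lemma t_inj: "inj_on (t k) F"
  by (rule inj_onI) (metis F_diff eq_iff_diff_eq_0 t_diff t_eq_0)

lemma t_6: "x \<in> F \<Longrightarrow> t 6 x = x"
  using galois unfolding cyclic_sextic_galois_def by blast

lemma t_plus: "t (k + l) x = t k (t l x)"
  by (simp add: funpow_add)

lemma t_plus_6: "x \<in> F \<Longrightarrow> t (k + 6) x = t k x"
  by (simp add: t_plus t_6)

lemma t_nontrivial: "k \<in> {1..5} \<Longrightarrow> \<exists>x\<in>F. t k x \<noteq> x"
  using galois unfolding cyclic_sextic_galois_def by blast

lemma t_distinct:
  assumes "k < l" "l < 6" shows "\<exists>x\<in>F. t k x \<noteq> t l x"
proof (rule ccontr)
  assume "\<not> ?thesis"
  then have e: "t k x = t l x" if "x \<in> F" for x using that by blast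
  have "t (l - k) x = x" if "x \<in> F" for x
  proof -
    have "t (l - k) x = t (l - k + 6) x" using t_plus_6[OF that] by simp
    also have "l - k + 6 = 6 - k + l" using assms by simp
    also have "t (6 - k + l) x = t (6 - k) (t k x)" using e[OF that] by (simp only: t_plus)
    also have "\<dots> = t (6 - k + k) x" by (simp only: t_plus)
    also have "\<dots> = x" using assms t_6[OF that] by simp
    finally show ?thesis .
  qed
  then show False using t_nontrivial[of "l - k"] assms by force
qed

lemma t_distinct':
  assumes "k \<noteq> l" "k < 6" "l < 6" shows "\<exists>x\<in>F. t k x \<noteq> t l x"
proof (cases "k < l")
  case False
  then obtain x where "x \<in> F" "t l x \<noteq> t k x" using t_distinct[of l k] assms by auto
  then show ?thesis by (intro bexI[of _ x]) auto
qed (use t_distinct assms in blast)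

section \<open>Rational coordinates, fixed elements and complex conjugation\<close>

definition basis :: "nat \<Rightarrow> complex" where
  "basis = (SOME b. (\<forall>i<6. b i \<in> F) \<and>
     (\<forall>x\<in>F. \<exists>!q :: nat \<Rightarrow> rat. (\<forall>i\<ge>6. q i = 0) \<and> x = (\<Sum>i<6. of_rat (q i) * b i)))"

lemma basis: "(\<forall>i<6. basis i \<in> F) \<and>
     (\<forall>x\<in>F. \<exists>!q :: nat \<Rightarrow> rat. (\<forall>i\<ge>6. q i = 0) \<and> x = (\<Sum>i<6. of_rat (q i) * basis i))"
proof -
  have "rat_dim F 6"
    using galois unfolding cyclic_sextic_galois_def number_field_of_degree_def by blast
  then show ?thesis unfolding basis_def rat_dim_def by (rule someI_ex)
qed

lemma basis_F: "i < 6 \<Longrightarrow> basis i \<in> F"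
  using basis by blast

lemma basis_coords:
  assumes "x \<in> F" obtains q :: "nat \<Rightarrow> rat" where "x = (\<Sum>i<6. of_rat (q i) * basis i)"
proof -
  have "\<exists>!q :: nat \<Rightarrow> rat. (\<forall>i\<ge>6. q i = 0) \<and> x = (\<Sum>i<6. of_rat (q i) * basis i)"
    using basis assms by (elim conjE) (rule bspec)
  then have "\<exists>q :: nat \<Rightarrow> rat. x = (\<Sum>i<6. of_rat (q i) * basis i)" by (elim ex1E conjE) (rule exI)
  then show ?thesis by (elim exE) (rule that)
qed

lemma basis_independent:
  fixes q :: "nat \<Rightarrow> rat"
  assumes "(\<Sum>i<6. of_rat (q i) * basis i) = 0" "i < 6"
  shows "q i = 0"
proof -
  define q' where "q' i = (if i < 6 then q i else 0)" for i
  define P where "P q \<longleftrightarrow> (\<forall>i\<ge>6. q i = 0) \<and> 0 = (\<Sum>i<6. of_rat (q i) * basis i)" for q :: "nat \<Rightarrow> rat"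
  have "P q'" unfolding P_def q'_def using assms(1) by simp
  moreover have "P (\<lambda>_. 0)" unfolding P_def by simp
  moreover have "\<exists>!q. P q"
    unfolding P_def using basis F_0 by (elim conjE) (rule bspec)
  ultimately have "q' = (\<lambda>_. 0)" by blast
  then have "q' i = 0" by simp
  then show ?thesis using assms(2) unfolding q'_def by simp
qed

text \<open>By the independence of characters, the matrix of the conjugates of a basis is
  invertible.\<close>
lemma rational_linear_is_combination:
  fixes r :: "nat \<Rightarrow> complex"
  obtains c where "\<And>q :: nat \<Rightarrow> rat.
    (\<Sum>k<6. c k * t k (\<Sum>i<6. of_rat (q i) * basis i)) = (\<Sum>i<6. of_rat (q i) * r i)"
proof -
  have ex: "(\<Sum>k<6. c k * t k (\<Sum>i<6. of_rat (q i) * basis i)) =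
      (\<Sum>i<6. of_rat (q i) * (\<Sum>k<6. t k (basis i) * c k))" for c and q :: "nat \<Rightarrow> rat"
  proof -
    have "t k (\<Sum>i<6. of_rat (q i) * basis i) = (\<Sum>i<6. of_rat (q i) * t k (basis i))" for k
      by (subst t_sum) (auto simp: t_mult t_of_rat F_of_rat F_mult basis_F)
    then have "(\<Sum>k<6. c k * t k (\<Sum>i<6. of_rat (q i) * basis i)) =
        (\<Sum>k<6. \<Sum>i<6. of_rat (q i) * (t k (basis i) * c k))"
      by (simp add: sum_distrib_left mult_ac)
    also have "\<dots> = (\<Sum>i<6. \<Sum>k<6. of_rat (q i) * (t k (basis i) * c k))" by (rule sum.swap)
    finally show ?thesis by (simp add: sum_distrib_left)
  qed
  have "\<exists>c. \<forall>i<6. (\<Sum>k<6. t k (basis i) * c k) = r i"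
  proof (rule square_system_solvable)
    fix c assume h: "\<And>i. i < 6 \<Longrightarrow> (\<Sum>k<6. t k (basis i) * c k) = 0"
    have "\<forall>k\<in>{..<6}. c k = 0"
    proof (rule characters_independent[where \<phi> = "\<lambda>k. t k" and F = F])
      fix x assume "x \<in> F"
      then obtain q :: "nat \<Rightarrow> rat" where "x = (\<Sum>i<6. of_rat (q i) * basis i)" by (rule basis_coords)
      then show "(\<Sum>k<6. c k * t k x) = 0" using ex[of c q] h by simp
    next
      fix k l :: nat assume "k \<in> {..<6}" "l \<in> {..<6}" "k \<noteq> l"
      then show "\<exists>x\<in>F. t k x \<noteq> t l x"
        using t_distinct'[of k l] by auto
    qed (auto simp: t_mult t_1 F_1 F_mult)
    then show "\<forall>k<6. c k = 0" by simp
  qed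
  then obtain c where "\<forall>i<6. (\<Sum>k<6. t k (basis i) * c k) = r i" by blast
  then show ?thesis by (intro that[of c]) (simp add: ex)
qed

text \<open>A rational functional of the coordinates is a combination of the powers of
  \<open>\<tau>\<close>, and on a fixed element \<open>y\<close> such a combination takes
  \<open>y\<close> times its value at 1. Every functional that vanishes at 1 therefore vanishes at
  \<open>y\<close>, so the coordinates of \<open>y\<close> are proportional to those of 1.\<close>

lemma fixed_imp_rational:
  assumes y: "y \<in> F" "\<tau> y = y"
  obtains r where "y = of_rat r"
proof -
  have ty: "t k y = y" for k using y(2) by (induction k) auto
  obtain p :: "nat \<Rightarrow> rat" where p: "1 = (\<Sum>i<6. of_rat (p i) * basis i)" by (rule basis_coords[OF F_1])
  obtain q :: "nat \<Rightarrow> rat" where q: "y = (\<Sum>i<6. of_rat (q i) * basis i)" by (rule basis_coords[OF y(1)])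
  have "\<exists>j<6. p j \<noteq> 0"
  proof (rule ccontr)
    assume "\<not> ?thesis"
    then have "(1::complex) = 0" unfolding p by (intro sum.neutral) auto
    then show False by simp
  qed
  then obtain j where j: "j < 6" "p j \<noteq> 0" by blast
  have prp: "q i * p j = q j * p i" if i: "i < 6" for i
  proof (cases "i = j")
    case False
    \<comment> \<open>The functional taking \<open>s\<close> to
      \<open>s i * p j - s j * p i\<close>, which vanishes on the coordinates \<open>p\<close> of
      1.\<close>
    define r :: "nat \<Rightarrow> complex" where "r = (\<lambda>k. if k = i then of_rat (p j) else if k = j then - of_rat (p i) else 0)"
    have r: "(\<Sum>k<6. of_rat (s k) * r k) = of_rat (s i * p j - s j * p i)" for s :: "nat \<Rightarrow> rat"
    proof -
      have "(\<Sum>k<6. of_rat (s k) * r k) = (\<Sum>k\<in>{i, j}. of_rat (s k) * r k)"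
        using i j by (intro sum.mono_neutral_right) (auto simp: r_def)
      then show ?thesis using False by (simp add: r_def of_rat_diff of_rat_mult)
    qed
    obtain c where c: "\<And>s :: nat \<Rightarrow> rat.
        (\<Sum>k<6. c k * t k (\<Sum>i<6. of_rat (s i) * basis i)) = (\<Sum>i<6. of_rat (s i) * r i)"
      by (rule rational_linear_is_combination[of r]) (rule that)
    have "(\<Sum>k<6. c k) = 0" using c[of p] unfolding p[symmetric] r by (simp add: t_1 mult.commute)
    moreover have "(\<Sum>k<6. c k * y) = of_rat (q i * p j - q j * p i)"
      using c[of q] unfolding q[symmetric] r by (simp add: ty)
    ultimately have "of_rat (q i * p j - q j * p i) = (0 :: complex)"
      by (metis mult_zero_left sum_distrib_right)
    then show ?thesis by (simp only: of_rat_eq_0_iff)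
  qed simp
  have "of_rat (q j / p j) = (\<Sum>i<6. of_rat (q j / p j) * (of_rat (p i) * basis i))"
    using p by (simp add: sum_distrib_left[symmetric])
  also have "\<dots> = y"
    unfolding q
  proof (rule sum.cong[OF refl])
    fix i assume "i \<in> {..<6::nat}"
    then have "q i = q j / p j * p i" using prp[of i] j by (simp add: field_simps)
    then show "of_rat (q j / p j) * (of_rat (p i) * basis i) = of_rat (q i) * basis i"
      by (simp add: of_rat_mult[symmetric] mult.assoc[symmetric])
  qed
  finally show ?thesis by (intro that[of "q j / p j"]) simp
qed

text \<open>That conjugation maps \<open>F\<close> to itself is part of the claim. Being rational
  linear on \<open>F\<close>, it is a combination of the six powers of \<open>\<tau>\<close>; if it
  differed from all of them, this would be a relation among seven distinct characters.\<close>

lemma cnj_is_power: "\<exists>k<6. \<forall>x\<in>F. cnj x = t k x"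
proof (rule ccontr)
  assume no: "\<not> ?thesis"
  obtain c where c: "\<And>s :: nat \<Rightarrow> rat.
      (\<Sum>k<6. c k * t k (\<Sum>i<6. of_rat (s i) * basis i)) = (\<Sum>i<6. of_rat (s i) * cnj (basis i))"
    by (rule rational_linear_is_combination[of "\<lambda>i. cnj (basis i)"]) (rule that)
  have cnj_rat: "cnj (of_rat q) = of_rat q" for q
    by (cases q) (simp add: of_rat_rat)
  define \<phi> where "\<phi> k = (if k < 6 then t k else cnj)" for k
  define d where "d k = (if k < 6 then c k else - 1)" for k :: nat
  have "\<forall>k\<in>{..<7}. d k = 0"
  proof (rule characters_independent[where \<phi> = \<phi> and F = F])
    fix x assume "x \<in> F"
    then obtain q :: "nat \<Rightarrow> rat" where q: "x = (\<Sum>i<6. of_rat (q i) * basis i)" by (rule basis_coords)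
    have "(\<Sum>k<6. c k * t k x) = cnj x" unfolding q c by (simp add: cnj_rat)
    moreover have "(\<Sum>k<7. d k * \<phi> k x) = (\<Sum>k<6. c k * t k x) - cnj x"
    proof -
      have "{..<7::nat} = insert 6 {..<6}" by auto
      then show ?thesis by (simp add: d_def \<phi>_def)
    qed
    ultimately show "(\<Sum>k<7. d k * \<phi> k x) = 0" by simp
  next
    fix k l :: nat assume kl: "k \<in> {..<7}" "l \<in> {..<7}" "k \<noteq> l"
    have 1: "\<exists>x\<in>F. t k x \<noteq> cnj x" if "k < 6" for k using no that by metis
    show "\<exists>x\<in>F. \<phi> k x \<noteq> \<phi> l x"
    proof (cases "k < 6 \<and> l < 6")
      case True
      then show ?thesis using t_distinct'[of k l] kl unfolding \<phi>_def by auto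
    next
      case False
      then have "(k < 6 \<and> \<not> l < 6) \<or> (\<not> k < 6 \<and> l < 6)" using kl by auto
      then show ?thesis using 1[of k] 1[of l] unfolding \<phi>_def by (auto simp: eq_commute[of "cnj _"])
    qed
  qed (auto simp: \<phi>_def t_mult t_1 F_1 F_mult)
  then have "d 6 = 0" by simp
  then show False unfolding d_def by simp
qed

text \<open>Conjugation is an involution, nontrivial on \<open>F\<close> because \<open>F\<close> is
  not real, and \<open>t 3\<close> is the only element of order 2 in the cyclic group.\<close>

lemma cnj_eq: 
  assumes "x \<in> F" shows "cnj x = t 3 x"
proof -
  obtain k where k: "k < 6" "\<And>x. x \<in> F \<Longrightarrow> cnj x = t k x" using cnj_is_power by blast
  have kk: "t (k + k) x = x" if "x \<in> F" for x
    using k(2)[OF that] k(2)[OF t_F[OF that], of k] by (metis complex_cnj_cnj t_plus)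
  have "k \<noteq> 0"
  proof
    assume "k = 0"
    then have "Im x = 0" if "x \<in> F" for x using k(2)[OF that] by (simp add: complex_eq_iff)
    moreover have "field_emb_on F (\<lambda>x. x)" unfolding field_emb_on_def by auto
    ultimately show False using imaginary unfolding totally_imaginary_def by blast
  qed
  moreover have "k + k \<notin> {1..5}" using kk t_nontrivial[of "k + k"] by force
  \<comment> \<open>The subtraction is truncated, so this says something only for \<open>k\<close>
    above 3; smaller values are excluded by the preceding fact.\<close>
  moreover have "k + k - 6 \<notin> {1..5}"
  proof
    assume h: "k + k - 6 \<in> {1..5}"
    then have "t (k + k - 6) x = x" if "x \<in> F" for x
    proof -
      have "k + k - 6 + 6 = k + k" using h by auto
      then show ?thesis using t_plus_6[OF that, of "k + k - 6"] kk[OF that] by (simp only:)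
    qed
    then show False using t_nontrivial[OF h] by blast
  qed
  ultimately have "k = 3" using k(1) by (auto simp: not_le)
  then show ?thesis using k(2) assms by blast
qed

lemma complex_norm_t: "x \<in> F \<Longrightarrow> of_real ((cmod (t i x))\<^sup>2) = t i (x * t 3 x)"
  using cnj_eq[OF t_F, of x i] complex_norm_square[of "t i x"]
  by (simp add: t_mult t_F t_plus[symmetric] add.commute)

end

section \<open>The ring of integers: denominators, norms and rank\<close>

lemma common_denominator:
  assumes "finite S" obtains d :: nat where "d > 0" "\<And>r::rat. r \<in> S \<Longrightarrow> of_nat d * r \<in> \<int>"
proof -
  have "\<exists>d::nat. d > 0 \<and> (\<forall>r::rat\<in>S. of_nat d * r \<in> \<int>)"
    using assms
  proof (induction S)
    case (insert r S)
    then obtain d :: nat where d: "d > 0" "\<And>r. r \<in> S \<Longrightarrow> of_nat d * r \<in> \<int>" by blast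
    obtain a b where q: "r = of_int a / of_int b" "b > 0"
      by (metis quotient_of_denom_pos quotient_of_div surj_pair)
    have b: "of_nat (nat b) = (of_int b :: rat)" using q(2) by simp
    have "of_nat (d * nat b) * r = of_int (int d * a)"
      using q by (simp add: b)
    moreover have "of_nat (d * nat b) * s = of_nat (nat b) * (of_nat d * s)" for s :: rat by simp
    ultimately have "\<forall>s\<in>insert r S. of_nat (d * nat b) * s \<in> \<int>"
      using d(2) by (metis Ints_mult Ints_of_int Ints_of_nat insert_iff)
    then show ?case using d(1) q(2) by (intro exI[of _ "d * nat b"]) auto
  qed (auto intro: exI[of _ 1])
  then show ?thesis using that by blast
qed

context cyclic_sextic
begin

abbreviation "\<O> \<equiv> ring_of_integers F"

lemma O_iff: "x \<in> \<O> \<longleftrightarrow> x \<in> F \<and> algebraic_int x"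
  unfolding ring_of_integers_def by (simp add: algebraic_integer_iff_algebraic_int)

lemma O_F: "x \<in> \<O> \<Longrightarrow> x \<in> F" by (simp add: O_iff)

lemma O_add: "x \<in> \<O> \<Longrightarrow> y \<in> \<O> \<Longrightarrow> x + y \<in> \<O>"
  and O_mult: "x \<in> \<O> \<Longrightarrow> y \<in> \<O> \<Longrightarrow> x * y \<in> \<O>"
  and O_uminus: "x \<in> \<O> \<Longrightarrow> - x \<in> \<O>"
  and O_of_int: "of_int n \<in> \<O>"
  by (auto simp: O_iff F_add F_mult F_uminus F_of_int algebraic_int_add algebraic_int_mult
      int_imp_algebraic_int)

lemma O_of_nat: "of_nat n \<in> \<O>" using O_of_int[of "int n"] by simp

lemma O_0: "0 \<in> \<O>" and O_1: "1 \<in> \<O>" using O_of_nat[of 0] O_of_nat[of 1] by auto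

lemma O_subgroup: "add_subgroup \<O>"
  unfolding add_subgroup_def using O_0 O_add[OF _ O_uminus] by auto

lemma O_diff: "x \<in> \<O> \<Longrightarrow> y \<in> \<O> \<Longrightarrow> x - y \<in> \<O>"
  using add_subgroupD(2)[OF O_subgroup] .

lemma O_sum: "(\<And>i. i \<in> I \<Longrightarrow> f i \<in> \<O>) \<Longrightarrow> sum f I \<in> \<O>"
  by (induction I rule: infinite_finite_induct) (auto intro: O_0 O_add)

lemma O_prod: "(\<And>i. i \<in> I \<Longrightarrow> f i \<in> \<O>) \<Longrightarrow> prod f I \<in> \<O>"
  by (induction I rule: infinite_finite_induct) (auto intro: O_1 O_mult)

lemma t_O: assumes "x \<in> \<O>" shows "t k x \<in> \<O>"
proof -
  have x: "x \<in> F" using assms by (rule O_F)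
  obtain n and c :: "nat \<Rightarrow> int" where h: "x ^ n + (\<Sum>i<n. of_int (c i) * x ^ i) = 0"
    using assms unfolding ring_of_integers_def algebraic_integer_def by blast
  have "t k (x ^ n + (\<Sum>i<n. of_int (c i) * x ^ i)) = t k x ^ n + (\<Sum>i<n. of_int (c i) * t k x ^ i)"
    using x by (simp add: t_add t_sum t_mult t_power t_of_int F_power F_sum F_mult F_of_int)
  then have "t k x ^ n + (\<Sum>i<n. of_int (c i) * t k x ^ i) = 0" unfolding h by (simp add: t_0)
  then show ?thesis using t_F[OF x] unfolding ring_of_integers_def algebraic_integer_def by blast
qed

lemma t_image_O: "t k ` \<O> = \<O>"
proof -
  have 1: "\<tau> ` \<O> = \<O>"
  proof
    show "\<tau> ` \<O> \<subseteq> \<O>" using t_O[of _ 1] by auto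
    have "x = \<tau> (t 5 x)" if "x \<in> \<O>" for x
      using t_6[OF O_F[OF that]] t_plus[of 1 5 x] by simp
    then show "\<O> \<subseteq> \<tau> ` \<O>" using t_O[of _ 5] by blast
  qed
  show ?thesis
  proof (induction k)
    case (Suc k)
    have "t (Suc k) ` \<O> = \<tau> ` (t k ` \<O>)" by (simp add: image_comp)
    then show ?case using 1 Suc by simp
  qed simp
qed

lemma O_fixed_imp_int:
  assumes "x \<in> \<O>" "\<tau> x = x" obtains z :: int where "x = of_int z"
proof -
  obtain r where "x = of_rat r" using fixed_imp_rational O_F[OF assms(1)] assms(2) by blast
  then have "x \<in> \<rat>" by simp
  then have "x \<in> \<int>" using rational_algebraic_int_is_int assms(1) unfolding O_iff by blast
  then show ?thesis using that by (auto elim: Ints_cases)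
qed

text \<open>After clearing denominators, multiplication by \<open>x\<close> acts on the basis by an
  integer matrix with the basis itself as eigenvector.\<close>

lemma multiple_in_O:
  assumes x: "x \<in> F" obtains d :: nat where "d > 0" "of_nat d * x \<in> \<O>"
proof -
  have "\<exists>q :: nat \<Rightarrow> rat. x * basis i = (\<Sum>j<6. of_rat (q j) * basis j)" if "i < 6" for i
    using basis_coords[OF F_mult[OF x basis_F[OF that]]] by blast
  then obtain q :: "nat \<Rightarrow> nat \<Rightarrow> rat"
    where q: "\<And>i. i < 6 \<Longrightarrow> x * basis i = (\<Sum>j<6. of_rat (q i j) * basis j)" by metis
  obtain d :: nat where d: "d > 0" "\<And>r. r \<in> (\<lambda>(i, j). q i j) ` ({..<6} \<times> {..<6}) \<Longrightarrow> of_nat d * r \<in> \<int>"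
    using common_denominator[of "(\<lambda>(i, j). q i j) ` ({..<6} \<times> {..<6})"] by blast
  define c where "c i j = \<lfloor>of_nat d * q i j\<rfloor>" for i j
  have c: "of_int (c i j) = of_nat d * q i j" if "i < 6" "j < 6" for i j
  proof -
    have "q i j \<in> (\<lambda>(i, j). q i j) ` ({..<6} \<times> {..<6})"
      using that by (intro image_eqI[of _ _ "(i, j)"]) auto
    then show ?thesis unfolding c_def using d(2) by (auto elim: Ints_cases)
  qed
  have c': "of_nat d * (of_rat (q i j) :: complex) = of_int (c i j)" if "i < 6" "j < 6" for i j
    using arg_cong[OF c[OF that], of "of_rat :: rat \<Rightarrow> complex"] by (simp add: of_rat_mult)
  have b0: "basis 0 \<noteq> 0"
  proof
    assume h: "basis 0 = 0"
    have "(\<Sum>i<6. of_rat (if i = 0 then 1 else 0) * basis i) = of_rat 1 * basis 0"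
      by (subst sum.mono_neutral_right[of _ "{0}"]) auto
    then have "(\<Sum>i<6. of_rat ((\<lambda>i. if i = 0 then 1 else 0) i) * basis i) = 0" using h by simp
    then have "(if 0 = (0::nat) then 1 else 0 :: rat) = 0" by (rule basis_independent) simp
    then show False by simp
  qed
  have "algebraic_int (of_nat d * x)"
  proof (rule algebraic_int_eigenvalue[of 0 6 basis _ c])
    fix i :: nat assume i: "i < 6"
    have "of_nat d * x * basis i = (\<Sum>j<6. of_nat d * (of_rat (q i j) * basis j))"
      using q[OF i] by (simp add: sum_distrib_left mult.assoc)
    also have "\<dots> = (\<Sum>j<6. of_int (c i j) * basis j)"
      by (rule sum.cong[OF refl]) (use c' i in \<open>simp add: mult.assoc[symmetric]\<close>)
    finally show "of_nat d * x * basis i = (\<Sum>j<6. of_int (c i j) * basis j)" .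
  qed (use b0 in auto)
  then show ?thesis using that[OF d(1)] x by (simp add: O_iff F_mult F_of_nat)
qed

text \<open>The field norm of \<open>F\<close> over the rationals: the three conjugates left out are
  the complex conjugates of those present.\<close>

definition Nm :: "complex \<Rightarrow> real" where
  "Nm x = (\<Prod>i<3. (cmod (t i x))\<^sup>2)"

lemma Nm_conjugates: 
  assumes x: "x \<in> F" shows "of_real (Nm x) = (\<Prod>k<6. t k x)"
proof -
  have "of_real (Nm x) = (\<Prod>i<3. t i x * t (i + 3) x)"
    unfolding Nm_def of_real_prod
    by (intro prod.cong refl) (use x in \<open>simp only: complex_norm_t t_mult t_F t_plus\<close>)
  also have "\<dots> = (\<Prod>k\<in>{..<3}. t k x) * (\<Prod>k\<in>{3..<6}. t k x)"
    unfolding prod.distrib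
    by (intro arg_cong2[of _ _ _ _ "(*)"] refl prod.reindex_bij_witness[of _ "\<lambda>k. k - 3" "\<lambda>k. k + 3"]) auto
  also have "\<dots> = (\<Prod>k\<in>{..<3} \<union> {3..<6}. t k x)" by (rule prod.union_disjoint[symmetric]) auto
  also have "{..<3} \<union> {3..<6::nat} = {..<6}" by auto
  finally show ?thesis .
qed

lemma Nm_mult: "x \<in> F \<Longrightarrow> y \<in> F \<Longrightarrow> Nm (x * y) = Nm x * Nm y"
  unfolding Nm_def by (simp add: t_mult norm_mult power_mult_distrib prod.distrib)

lemma Nm_pos: "x \<in> F \<Longrightarrow> x \<noteq> 0 \<Longrightarrow> Nm x > 0"
  unfolding Nm_def by (intro prod_pos) (auto simp: t_eq_0)

lemma Nm_of_nat: "Nm (of_nat n) = real n ^ 6"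
  unfolding Nm_def by (simp add: t_of_nat norm_of_nat power_mult[symmetric])

lemma Nm_nat:
  assumes "x \<in> \<O>" obtains n :: nat where "Nm x = real n"
proof -
  have x: "x \<in> F" using assms by (rule O_F)
  define y where "y = (\<Prod>k<6. t k x)"
  have "y \<in> \<O>" unfolding y_def by (intro O_prod t_O assms)
  moreover have "\<tau> y = y"
  proof (cases "x = 0")
    case True
    then have "y = 0" unfolding y_def by (simp add: t_0)
    then show ?thesis using t_0[of 1] by simp
  next
    case False
    have "\<tau> y = (\<Prod>k<6. t (Suc k) x)"
      unfolding y_def using t_prod[of "{..<6}" "\<lambda>k. t k x" 1] t_F[OF x] by simp
    \<comment> \<open>Shifting the product by one replaces the factor \<open>t 0 x\<close> by
      \<open>t 6 x\<close>, and both equal \<open>x\<close>; the case \<open>x = 0\<close> was set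
      apart so that \<open>x\<close> can be cancelled.\<close>
    then have "t 0 x * \<tau> y = (\<Prod>k<Suc 6. t k x)"
      by (simp only: prod.lessThan_Suc_shift[of _ 6] o_def)
    also have "\<dots> = y * t 6 x" unfolding y_def by (rule prod.lessThan_Suc)
    finally show ?thesis using False t_6[OF x] by simp
  qed
  ultimately obtain z :: int where z: "y = of_int z" by (rule O_fixed_imp_int)
  then have "complex_of_real (Nm x) = of_real (of_int z)"
    using Nm_conjugates[OF x] unfolding y_def by simp
  then have e: "Nm x = of_int z" unfolding of_real_eq_iff .
  moreover have "Nm x \<ge> 0" unfolding Nm_def by (intro prod_nonneg) auto
  ultimately have "Nm x = real (nat z)" by simp
  then show ?thesis by (rule that)
qed

lemma Nm_ge_1: "x \<in> \<O> \<Longrightarrow> x \<noteq> 0 \<Longrightarrow> Nm x \<ge> 1"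
  using Nm_nat[of x] Nm_pos[OF O_F, of x] by (metis One_nat_def Suc_leI of_nat_0_less_iff of_nat_1 of_nat_le_iff)

text \<open>Every nonzero integer of the field thus divides a positive rational integer, which is
  how denominators and generators are replaced by natural numbers.\<close>

lemma Nm_multiple:
  assumes "x \<in> \<O>" obtains y where "y \<in> \<O>" "of_real (Nm x) = x * y"
proof -
  have "(\<Prod>k<Suc 5. t k x) = t 0 x * (\<Prod>k<5. t (Suc k) x)"
    by (simp only: prod.lessThan_Suc_shift[of _ 5] o_def)
  then have "of_real (Nm x) = x * (\<Prod>k<5. t (Suc k) x)"
    using Nm_conjugates[OF O_F[OF assms]] by simp
  moreover have "(\<Prod>k<5. t (Suc k) x) \<in> \<O>" by (intro O_prod t_O assms)
  ultimately show ?thesis using that by blast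
qed

text \<open>A pigeonhole argument takes the place of discriminants: the fractional parts of the
  coordinates fall into finitely many boxes, and two integers in one box are congruent modulo the
  span, as a nonzero integer cannot have norm below 1.\<close>

lemma O_finite_index_span:
  obtains e where "\<And>c :: nat \<Rightarrow> int. (\<Sum>i<6. of_int (c i) * e i) = 0 \<Longrightarrow> \<forall>i<6. c i = 0"
    "int_span 6 e \<subseteq> \<O>" "add_index \<O> (int_span 6 e) > 0"
proof -
  have "\<exists>d::nat. d > 0 \<and> of_nat d * basis i \<in> \<O>" if "i < 6" for i
    using multiple_in_O[OF basis_F[OF that]] by blast
  then obtain d :: "nat \<Rightarrow> nat" where d: "\<And>i. i < 6 \<Longrightarrow> d i > 0" "\<And>i. i < 6 \<Longrightarrow> of_nat (d i) * basis i \<in> \<O>"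
    by metis
  define e where "e i = of_nat (d i) * basis i" for i
  have e: "e i \<in> \<O>" if "i < 6" for i unfolding e_def using d(2)[OF that] .
  have indep: "\<forall>i<6. c i = 0" if h: "(\<Sum>i<6. of_int (c i) * e i) = 0" for c :: "nat \<Rightarrow> int"
  proof (intro allI impI)
    fix i :: nat assume i: "i < 6"
    have "(\<Sum>i<6. of_rat (of_int (c i) * of_nat (d i)) * basis i) = 0"
      using h unfolding e_def by (simp add: of_rat_mult mult.assoc)
    then have "of_int (c i) * of_nat (d i) = (0 :: rat)" using i by (rule basis_independent)
    then show "c i = 0" using d(1)[OF i] by simp
  qed
  define M where "M = int_span 6 e"
  have M_O: "M \<subseteq> \<O>" unfolding M_def int_span_def by (auto intro!: O_sum O_mult O_of_int e)
  have "\<exists>q :: nat \<Rightarrow> rat. x = (\<Sum>i<6. of_rat (q i) * e i)" if x: "x \<in> F" for x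
  proof -
    obtain q :: "nat \<Rightarrow> rat" where q: "x = (\<Sum>i<6. of_rat (q i) * basis i)" by (rule basis_coords[OF x])
    have "x = (\<Sum>i<6. of_rat (q i / of_nat (d i)) * e i)"
      unfolding q e_def
    proof (rule sum.cong[OF refl])
      fix i :: nat assume "i \<in> {..<6}"
      then have "d i \<noteq> 0" using d(1)[of i] by simp
      then show "of_rat (q i) * basis i = of_rat (q i / of_nat (d i)) * (of_nat (d i) * basis i)"
        by (simp add: of_rat_divide)
    qed
    then show ?thesis by (intro exI[of _ "\<lambda>i. q i / of_nat (d i)"])
  qed
  then obtain q :: "complex \<Rightarrow> nat \<Rightarrow> rat" where q: "\<And>x. x \<in> F \<Longrightarrow> x = (\<Sum>i<6. of_rat (q x i) * e i)"
    by metis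
  \<comment> \<open>\<open>B\<close> exceeds the sum of the moduli of the conjugates of the
    \<open>e i\<close> under each of the three embeddings; boxes of side \<open>1 / K\<close> with
    \<open>K \<ge> B\<close> then force all conjugates of the remainder below 1.\<close>
  define B where "B = (\<Sum>k<3. \<Sum>i<6. cmod (t k (e i))) + 1"
  have B: "(\<Sum>i<6. cmod (t k (e i))) < B" if "k < 3" for k
  proof -
    have "(\<Sum>i<6. cmod (t k (e i))) \<le> (\<Sum>k<3. \<Sum>i<6. cmod (t k (e i)))"
      using that by (intro member_le_sum[of k "{..<3}" "\<lambda>k. \<Sum>i<6. cmod (t k (e i))"]) (auto intro: sum_nonneg)
    then show ?thesis unfolding B_def by simp
  qed
  define K where "K = nat \<lceil>B\<rceil>"
  have K: "B \<le> real K" unfolding K_def by linarith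
  have B1: "B \<ge> 1" unfolding B_def by (auto intro!: sum_nonneg)
  then have K0: "K > 0" using K by (cases K) auto
  define code where "code x = restrict (\<lambda>i. \<lfloor>of_nat K * frac (q x i)\<rfloor>) {..<6}" for x
  text \<open>Two integers of F whose coordinates agree modulo 1 up to 1/K differ, modulo M, by an
    element of norm below 1.\<close>
  have code: "x - y \<in> M" if xy: "x \<in> \<O>" "y \<in> \<O>" "code x = code y" for x y
  proof -
    define m where "m = (\<Sum>i<6. of_int (\<lfloor>q x i\<rfloor> - \<lfloor>q y i\<rfloor>) * e i)"
    have m: "m \<in> M" unfolding m_def M_def int_span_def
      by (rule range_eqI[of _ _ "\<lambda>i. \<lfloor>q x i\<rfloor> - \<lfloor>q y i\<rfloor>"]) simp
    define r where "r i = frac (q x i) - frac (q y i)" for i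
    have rK: "\<bar>real_of_rat (r i)\<bar> \<le> 1 / real K" if "i < 6" for i
    proof -
      have "\<lfloor>of_nat K * frac (q x i)\<rfloor> = \<lfloor>of_nat K * frac (q y i)\<rfloor>"
        using fun_cong[OF xy(3), of i] that unfolding code_def by simp
      then have "\<bar>of_nat K * frac (q x i) - of_nat K * frac (q y i)\<bar> < 1" by linarith
      then have "\<bar>of_nat K * r i\<bar> < 1" unfolding r_def by (simp add: right_diff_distrib)
      then have *: "of_nat K * r i < 1" "- 1 < of_nat K * r i" by linarith+
      have "real_of_rat (of_nat K * r i) < real_of_rat 1" unfolding of_rat_less by (rule *(1))
      moreover have "real_of_rat (- 1) < real_of_rat (of_nat K * r i)" unfolding of_rat_less by (rule *(2))
      moreover have "real_of_rat (- 1) = - 1" "real_of_rat 1 = 1" by simp_all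
      ultimately have "\<bar>real_of_rat (of_nat K * r i)\<bar> < 1" unfolding abs_less_iff by linarith
      then have "real K * \<bar>real_of_rat (r i)\<bar> < 1" by (simp add: of_rat_mult abs_mult)
      then show ?thesis using K0 by (simp add: field_simps)
    qed
    have "x - y - m = (\<Sum>i<6. of_rat (r i) * e i)"
    proof -
      have "x - y - m = (\<Sum>i<6. (of_rat (q x i) - of_rat (q y i) - of_int (\<lfloor>q x i\<rfloor> - \<lfloor>q y i\<rfloor>)) * e i)"
        using q[OF O_F[OF xy(1)]] q[OF O_F[OF xy(2)]] unfolding m_def
        by (simp only: left_diff_distrib sum_subtractf)
      also have "\<dots> = (\<Sum>i<6. of_rat (r i) * e i)"
        unfolding r_def frac_def by (intro sum.cong refl) (simp add: of_rat_diff)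
      finally show ?thesis .
    qed
    then have tk: "\<And>k. t k (x - y - m) = (\<Sum>i<6. of_rat (r i) * t k (e i))"
    proof -
      fix k assume h: "x - y - m = (\<Sum>i<6. of_rat (r i) * e i)"
      have eF: "e i \<in> F" if "i < 6" for i using e[OF that] by (rule O_F)
      show "t k (x - y - m) = (\<Sum>i<6. of_rat (r i) * t k (e i))"
        unfolding h by (subst t_sum) (auto simp: t_mult t_of_rat F_of_rat F_mult eF)
    qed
    have small: "cmod (t k (x - y - m)) < 1" if "k < 3" for k
    proof -
      have "cmod (t k (x - y - m)) \<le> (\<Sum>i<6. cmod (of_rat (r i) * t k (e i)))"
        unfolding tk by (rule norm_sum)
      also have "\<dots> \<le> (\<Sum>i<6. 1 / real K * cmod (t k (e i)))"
      proof (rule sum_mono)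
        fix i :: nat assume "i \<in> {..<6}"
        then have "\<bar>real_of_rat (r i)\<bar> \<le> 1 / real K" using rK by simp
        moreover have "cmod (of_rat (r i)) = \<bar>real_of_rat (r i)\<bar>"
          by (cases "r i") (simp add: of_rat_rat norm_divide)
        ultimately show "cmod (of_rat (r i) * t k (e i)) \<le> 1 / real K * cmod (t k (e i))"
          unfolding norm_mult by (intro mult_right_mono) auto
      qed
      also have "\<dots> = (\<Sum>i<6. cmod (t k (e i))) / real K" by (simp add: sum_divide_distrib)
      also have "\<dots> < 1" using B[OF that] K K0 by simp
      finally show ?thesis .
    qed
    have "x - y - m = 0"
    proof (rule ccontr)
      assume "x - y - m \<noteq> 0"
      moreover have "x - y - m \<in> \<O>" using xy m M_O by (intro O_diff) auto
      ultimately have "Nm (x - y - m) \<ge> 1" by (intro Nm_ge_1)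
      moreover have "Nm (x - y - m) < (\<Prod>i<3::nat. 1)"
        unfolding Nm_def
      proof (rule prod_mono_strict[of 0])
        show "(cmod (t 0 (x - y - m)))\<^sup>2 < 1"
          using small[of 0] by (simp add: power_less_one_iff abs_square_less_1)
        show "\<And>i. i \<in> {..<3} \<Longrightarrow> 0 \<le> (cmod (t i (x - y - m)))\<^sup>2 \<and> (cmod (t i (x - y - m)))\<^sup>2 \<le> 1"
          using small by (simp add: abs_square_le_1 less_imp_le)
      qed auto
      ultimately show False by simp
    qed
    then show ?thesis using m by simp
  qed
  have finc: "finite (code ` \<O>)"
  proof (rule finite_subset)
    show "code ` \<O> \<subseteq> PiE {..<6} (\<lambda>_. {0..<int K})"
    proof (rule image_subsetI, unfold code_def, rule restrict_PiE_iff[THEN iffD2], rule ballI)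
      fix x i
      have "of_nat K * frac (q x i) < of_nat K * 1"
        using K0 frac_lt_1[of "q x i"] by (intro mult_strict_left_mono) auto
      then show "\<lfloor>of_nat K * frac (q x i)\<rfloor> \<in> {0..<int K}"
        by (auto simp: floor_less_iff le_floor_iff)
    qed
  qed (auto intro: finite_PiE)
  define cs where "cs x = (\<lambda>y. x + y) ` M" for x
  have Msub: "add_subgroup M" unfolding M_def by (rule int_span_subgroup)
  have "cs ` \<O> \<subseteq> (\<lambda>c. cs (SOME x. x \<in> \<O> \<and> code x = c)) ` (code ` \<O>)"
  proof
    fix X assume "X \<in> cs ` \<O>"
    then obtain x where x: "x \<in> \<O>" "X = cs x" by blast
    define y where "y = (SOME y. y \<in> \<O> \<and> code y = code x)"
    have "y \<in> \<O> \<and> code y = code x" unfolding y_def by (rule someI[of _ x]) (use x in auto)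
    then have "cs x = cs y" unfolding cs_def coset_eq_iff[OF Msub] using code[OF x(1)] by auto
    then show "X \<in> (\<lambda>c. cs (SOME x. x \<in> \<O> \<and> code x = c)) ` (code ` \<O>)"
      using x unfolding y_def by blast
  qed
  then have "finite (cs ` \<O>)" using finc by (meson finite_imageI finite_subset)
  then have "add_index \<O> M > 0" unfolding add_index_def cs_def
    using O_0 by (simp add: card_gt_0_iff) blast
  then show ?thesis using that[of e] indep M_O unfolding M_def by blast
qed

lemma index_O_nat: 
  assumes "m > 0" shows "add_index \<O> ((\<lambda>x. of_nat m * x) ` \<O>) = m ^ 6"
proof -
  obtain e where e: "\<And>c :: nat \<Rightarrow> int. (\<Sum>i<6. of_int (c i) * e i) = 0 \<Longrightarrow> \<forall>i<6. c i = 0"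
    "int_span 6 e \<subseteq> \<O>" "add_index \<O> (int_span 6 e) > 0"
    by (rule O_finite_index_span) (rule that)
  have "add_index \<O> ((\<lambda>x. of_nat m * x) ` \<O>) = add_index (int_span 6 e) ((\<lambda>x. of_nat m * x) ` int_span 6 e)"
    by (rule add_index_multiple_mono[OF O_subgroup int_span_subgroup e(2,3) assms])
  also have "\<dots> = m ^ 6" by (rule add_index_int_span[OF e(1) assms])
  finally show ?thesis .
qed

end

section \<open>Indices of ideals\<close>

context cyclic_sextic
begin

abbreviation scaled :: "complex \<Rightarrow> complex set \<Rightarrow> complex set" where
  "scaled g A \<equiv> (\<lambda>x. g * x) ` A"

lemma scaled_scaled: "scaled g (scaled h A) = scaled (g * h) A"
  by (simp add: image_image mult.assoc)

lemma scaled_subgroup: "add_subgroup A \<Longrightarrow> add_subgroup (scaled g A)"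
  by (intro add_subgroup_image) (auto simp: ring_distribs)

lemma index_scaled:
  assumes "add_subgroup A" "B \<subseteq> A" "g \<noteq> 0"
  shows "add_index (scaled g A) (scaled g B) = add_index A B"
  using assms by (intro add_index_image) (auto simp: inj_on_def ring_distribs)

lemma scaled_O_subset: "g \<in> \<O> \<Longrightarrow> scaled g \<O> \<subseteq> \<O>"
  by (auto intro: O_mult)

lemma index_O_mult:
  assumes "g \<in> \<O>" "h \<in> \<O>" "g \<noteq> 0"
  shows "add_index \<O> (scaled (g * h) \<O>) = add_index \<O> (scaled g \<O>) * add_index \<O> (scaled h \<O>)"
proof -
  have "add_index \<O> (scaled g (scaled h \<O>))
      = add_index \<O> (scaled g \<O>) * add_index (scaled g \<O>) (scaled g (scaled h \<O>))"
    using assms scaled_O_subset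
    by (intro add_index_tower O_subgroup scaled_subgroup image_mono) auto
  also have "add_index (scaled g \<O>) (scaled g (scaled h \<O>)) = add_index \<O> (scaled h \<O>)"
    using assms scaled_O_subset by (intro index_scaled O_subgroup) auto
  finally show ?thesis unfolding scaled_scaled .
qed

lemma index_O_conjugate:
  assumes "g \<in> \<O>" shows "add_index \<O> (scaled (t k g) \<O>) = add_index \<O> (scaled g \<O>)"
proof -
  have "t k ` (scaled g \<O>) = scaled (t k g) (t k ` \<O>)"
    unfolding image_image using assms by (intro image_cong refl) (simp add: t_mult O_F)
  then have "add_index \<O> (scaled (t k g) \<O>) = add_index (t k ` \<O>) (t k ` (scaled g \<O>))"
    unfolding t_image_O by simp
  also have "\<dots> = add_index \<O> (scaled g \<O>)"
    using assms t_inj[of k] O_F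
    by (intro add_index_image O_subgroup scaled_O_subset) (auto simp: t_add intro: inj_on_subset)
  finally show ?thesis .
qed

text \<open>Conjugate elements generate ideals of equal index, and the product of the conjugates
  of g is the rational integer Nm g.\<close>
lemma index_O: 
  assumes g: "g \<in> \<O>" "g \<noteq> 0" shows "real (add_index \<O> (scaled g \<O>)) = Nm g"
proof -
  obtain n :: nat where n: "Nm g = real n" using Nm_nat[OF g(1)] .
  have n0: "n > 0" using Nm_pos[OF O_F[OF g(1)] g(2)] n by simp
  have "add_index \<O> (scaled (\<Prod>k<m. t k g) \<O>) = add_index \<O> (scaled g \<O>) ^ m" for m
  proof (induction m)
    case 0
    have "(\<lambda>x. (\<lambda>y. x + y) ` \<O>) ` \<O> = {\<O>}"
    proof -
      have "(\<lambda>y. x + y) ` \<O> = \<O>" if "x \<in> \<O>" for x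
        using coset_eq_iff[OF O_subgroup, of x 0] that by simp
      then show ?thesis using O_0 by auto
    qed
    then show ?case by (simp add: add_index_def)
  next
    case (Suc m)
    have "(\<Prod>k<Suc m. t k g) = t m g * (\<Prod>k<m. t k g)" by simp
    moreover have "add_index \<O> (scaled (t m g * (\<Prod>k<m. t k g)) \<O>)
        = add_index \<O> (scaled (t m g) \<O>) * add_index \<O> (scaled (\<Prod>k<m. t k g) \<O>)"
      using g by (intro index_O_mult t_O O_prod) (auto simp: t_eq_0 O_F)
    ultimately show ?case using Suc g(1) by (simp only: index_O_conjugate power_Suc)
  qed
  from this[of 6] have "n ^ 6 = add_index \<O> (scaled g \<O>) ^ 6"
    using index_O_nat[OF n0] Nm_conjugates[OF O_F[OF g(1)]] n by simp
  then have "n = add_index \<O> (scaled g \<O>)" using power_eq_imp_eq_base[of n 6] by simp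
  then show ?thesis using n by simp
qed

lemma nat_multiple_in_scaled:
  assumes "f \<in> F" "f \<noteq> 0" obtains m :: nat where "m > 0" "scaled (of_nat m) \<O> \<subseteq> scaled f \<O>"
proof -
  obtain d :: nat where d: "d > 0" "of_nat d * f \<in> \<O>" by (rule multiple_in_O[OF assms(1)])
  obtain n :: nat where n: "Nm (of_nat d * f) = real n" by (rule Nm_nat[OF d(2)])
  obtain y where y: "y \<in> \<O>" "of_real (Nm (of_nat d * f)) = of_nat d * f * y"
    by (rule Nm_multiple[OF d(2)])
  have "n > 0" using Nm_pos[OF O_F[OF d(2)]] n d(1) assms(2) by simp
  moreover have "scaled (of_nat n) \<O> \<subseteq> scaled f \<O>"
  proof (rule image_subsetI)
    fix x assume x: "x \<in> \<O>"
    have "(of_nat n :: complex) = of_nat d * f * y" using y(2) n by simp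
    then have "of_nat n * x = f * (of_nat d * (y * x))" by (simp add: mult_ac)
    moreover have "of_nat d * (y * x) \<in> \<O>" by (intro O_mult O_of_nat y x)
    ultimately show "of_nat n * x \<in> scaled f \<O>" by blast
  qed
  ultimately show ?thesis by (rule that)
qed

context
  fixes I assumes I: "fractional_ideal F I"
begin

lemma ideal_F: "x \<in> I \<Longrightarrow> x \<in> F" and ideal_mult: "a \<in> \<O> \<Longrightarrow> x \<in> I \<Longrightarrow> a * x \<in> I"
  using I unfolding fractional_ideal_def by auto

lemma ideal_subgroup: "add_subgroup I"
proof -
  have "x - y \<in> I" if "x \<in> I" "y \<in> I" for x y
  proof -
    have "x + (- 1) * y \<in> I"
      using I that O_uminus[OF O_1] unfolding fractional_ideal_def by blast
    then show ?thesis by simp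
  qed
  then show ?thesis using I unfolding add_subgroup_def fractional_ideal_def by blast
qed

lemma scaled_subset_ideal: "f \<in> I \<Longrightarrow> scaled f \<O> \<subseteq> I"
  using ideal_mult by (auto simp: mult.commute[of f])

lemma ideal_nonzero: obtains f where "f \<in> I" "f \<noteq> 0"
  using I unfolding fractional_ideal_def by blast

lemma ideal_denominator: obtains D :: nat where "D > 0" "scaled (of_nat D) I \<subseteq> \<O>"
proof -
  obtain d where d: "d \<in> \<O>" "d \<noteq> 0" "\<And>x. x \<in> I \<Longrightarrow> d * x \<in> \<O>"
    using I unfolding fractional_ideal_def by blast
  obtain n :: nat where n: "Nm d = real n" by (rule Nm_nat[OF d(1)])
  obtain y where y: "y \<in> \<O>" "of_real (Nm d) = d * y" by (rule Nm_multiple[OF d(1)])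
  have "n > 0" using Nm_pos[OF O_F[OF d(1)] d(2)] n by simp
  moreover have "of_nat n * x \<in> \<O>" if "x \<in> I" for x
  proof -
    have "(of_nat n :: complex) = d * y" using y(2) n by simp
    then have "of_nat n * x = y * (d * x)" by (simp add: mult_ac)
    then show ?thesis by (simp only: O_mult[OF y(1) d(3)[OF that]])
  qed
  ultimately show ?thesis by (intro that[of n]) auto
qed

text \<open>With D I inside O, the index of m O in I equals that of D m O in D I, a factor of the
  known number \<open>(D * m) ^ 6\<close>.\<close>

lemma index_ideal_multiple_pos:
  assumes m: "m > 0" and sub: "scaled (of_nat m) \<O> \<subseteq> I"
  shows "add_index I (scaled (of_nat m) \<O>) > 0"
proof -
  obtain D :: nat where D: "D > 0" "scaled (of_nat D) I \<subseteq> \<O>" by (rule ideal_denominator)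
  let ?C = "scaled (of_nat m) \<O>"
  have "add_index \<O> (scaled (of_nat D) ?C) = add_index \<O> (scaled (of_nat D) I) *
      add_index (scaled (of_nat D) I) (scaled (of_nat D) ?C)"
    using sub by (intro add_index_tower O_subgroup scaled_subgroup ideal_subgroup D(2) image_mono)
  moreover have "add_index \<O> (scaled (of_nat D) ?C) = (D * m) ^ 6"
    using index_O_nat[of "D * m"] D(1) m by (simp add: scaled_scaled)
  moreover have "add_index (scaled (of_nat D) I) (scaled (of_nat D) ?C) = add_index I ?C"
    using D(1) sub by (intro index_scaled ideal_subgroup) auto
  ultimately show ?thesis using D(1) m by (metis mult_eq_0_iff neq0_conv power_eq_0_iff)
qed

lemma ideal_contains_multiple:
  obtains m :: nat where "m > 0" "scaled (of_nat m) \<O> \<subseteq> I"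
proof -
  obtain f where f: "f \<in> I" "f \<noteq> 0" by (rule ideal_nonzero)
  obtain m :: nat where "m > 0" "scaled (of_nat m) \<O> \<subseteq> scaled f \<O>"
    by (rule nat_multiple_in_scaled[OF ideal_F[OF f(1)] f(2)])
  then show ?thesis using scaled_subset_ideal[OF f(1)] by (intro that) auto
qed

lemma index_ideal:
  assumes "k > 0" shows "add_index I (scaled (of_nat k) I) = k ^ 6"
proof -
  obtain m :: nat where m: "m > 0" "scaled (of_nat m) \<O> \<subseteq> I" by (rule ideal_contains_multiple)
  have "add_index I (scaled (of_nat k) I)
      = add_index (scaled (of_nat m) \<O>) (scaled (of_nat k) (scaled (of_nat m) \<O>))"
    by (intro add_index_multiple_mono ideal_subgroup scaled_subgroup O_subgroup m(2)
        index_ideal_multiple_pos m assms)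
  also have "scaled (of_nat k) (scaled (of_nat m) \<O>) = scaled (of_nat m) (scaled (of_nat k) \<O>)"
    unfolding scaled_scaled by (simp only: mult.commute)
  also have "add_index (scaled (of_nat m) \<O>) \<dots> = add_index \<O> (scaled (of_nat k) \<O>)"
    using m(1) scaled_O_subset[OF O_of_nat] by (intro index_scaled O_subgroup) auto
  also have "\<dots> = k ^ 6" by (rule index_O_nat[OF assms])
  finally show ?thesis .
qed

text \<open>This ties the norm defined by indices to the field norm. All groups are compared with
  \<open>?C\<close>, a multiple m O inside f O: writing m = f g, the index of \<open>?C\<close> in O
  is m^6 = Nm f Nm g, that of \<open>?C\<close> in f O is Nm g, and the index of \<open>?C\<close>
  in the intersection of O and I cancels.\<close>

lemma Nm_ideal_element:
  assumes f: "f \<in> I" "f \<noteq> 0"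
  shows "Nm f = real (add_index I (scaled f \<O>)) * ideal_norm F I"
    and "add_index I (scaled f \<O>) > 0" and "ideal_norm F I > 0"
proof -
  have fF: "f \<in> F" by (rule ideal_F[OF f(1)])
  obtain m :: nat where m: "m > 0" "scaled (of_nat m) \<O> \<subseteq> scaled f \<O>"
    by (rule nat_multiple_in_scaled[OF fF f(2)])
  let ?J = "\<O> \<inter> I" and ?C = "scaled (of_nat m) \<O>"
  have C: "?C \<subseteq> \<O>" "?C \<subseteq> I" using scaled_O_subset[OF O_of_nat] m(2) scaled_subset_ideal[OF f(1)] by auto
  have J: "add_subgroup ?J"
    using add_subgroupD[OF O_subgroup] add_subgroupD[OF ideal_subgroup] by (auto simp: add_subgroup_def)
  note subs = O_subgroup ideal_subgroup J scaled_subgroup[OF O_subgroup]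
  have 1: "m ^ 6 = add_index \<O> ?J * add_index ?J ?C"
    unfolding index_O_nat[OF m(1), symmetric] using C by (intro add_index_tower subs) auto
  have 2: "add_index I ?C = add_index I ?J * add_index ?J ?C"
    using C by (intro add_index_tower subs) auto
  have 3: "add_index I ?C = add_index I (scaled f \<O>) * add_index (scaled f \<O>) ?C"
    using m(2) scaled_subset_ideal[OF f(1)] by (intro add_index_tower subs) auto
  have pos: "add_index I ?C > 0" by (rule index_ideal_multiple_pos[OF m(1) C(2)])
  show 4: "add_index I (scaled f \<O>) > 0" using pos 3 by (auto simp: zero_less_mult_iff)
  have "of_nat m * 1 \<in> scaled f \<O>" using m(2) O_1 by blast
  then obtain g where g: "g \<in> \<O>" "of_nat m = f * g" by auto
  have g0: "g \<noteq> 0" using g(2) m(1) by auto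
  have "?C = scaled f (scaled g \<O>)" unfolding scaled_scaled g(2) ..
  then have "add_index (scaled f \<O>) ?C = add_index \<O> (scaled g \<O>)"
    using index_scaled[OF O_subgroup scaled_O_subset[OF g(1)] f(2)] by simp
  then have 5: "real (add_index (scaled f \<O>) ?C) = Nm g" using index_O[OF g(1) g0] by simp
  have 6: "real m ^ 6 = Nm f * Nm g"
    using Nm_mult[OF fF O_F[OF g(1)]] g(2) Nm_of_nat by metis
  have J0: "add_index ?J ?C > 0" "add_index I ?J > 0" "add_index \<O> ?J > 0"
    using pos 1 2 m(1) by (auto simp: zero_less_mult_iff) (metis mult_0 neq0_conv power_not_zero)+
  show "ideal_norm F I > 0" unfolding ideal_norm_def using J0 by simp
  have 7: "Nm f * Nm g = real (add_index \<O> ?J) * real (add_index ?J ?C)"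
    unfolding 6[symmetric] of_nat_power[symmetric] 1 by simp
  have "add_index I ?J * add_index ?J ?C = add_index I (scaled f \<O>) * add_index (scaled f \<O>) ?C"
    using 2 3 by simp
  then have "real (add_index I ?J) * real (add_index ?J ?C) = real (add_index I (scaled f \<O>)) * Nm g"
    unfolding 5[symmetric] of_nat_mult[symmetric] by simp
  then have "Nm f * Nm g * real (add_index I ?J)
      = real (add_index \<O> ?J) * (real (add_index I (scaled f \<O>)) * Nm g)"
    unfolding 7 by (simp add: mult_ac)
  then have "(Nm f * real (add_index I ?J)) * Nm g = (real (add_index \<O> ?J) * real (add_index I (scaled f \<O>))) * Nm g"
    by (simp add: mult_ac)
  then have "Nm f * real (add_index I ?J) = real (add_index \<O> ?J) * real (add_index I (scaled f \<O>))"
    using Nm_pos[OF O_F[OF g(1)] g0] by simp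
  then show "Nm f = real (add_index I (scaled f \<O>)) * ideal_norm F I"
    unfolding ideal_norm_def using J0 by (simp add: field_simps)
qed

lemma index_1_imp_principal:
  assumes "f \<in> I" "add_index I (scaled f \<O>) = 1" shows "I = scaled f \<O>"
proof
  show "scaled f \<O> \<subseteq> I" by (rule scaled_subset_ideal[OF assms(1)])
  show "I \<subseteq> scaled f \<O>"
  proof
    fix x assume x: "x \<in> I"
    obtain X where X: "(\<lambda>x. (\<lambda>y. x + y) ` scaled f \<O>) ` I = {X}"
      using assms(2) unfolding add_index_def by (rule card_1_singletonE)
    have *: "(\<lambda>y. z + y) ` scaled f \<O> = X" if "z \<in> I" for z
    proof -
      have "(\<lambda>y. z + y) ` scaled f \<O> \<in> (\<lambda>x. (\<lambda>y. x + y) ` scaled f \<O>) ` I"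
        using that by (rule imageI)
      then show ?thesis unfolding X by simp
    qed
    have "(\<lambda>y. x + y) ` scaled f \<O> = (\<lambda>y. 0 + y) ` scaled f \<O>"
      unfolding *[OF x] *[OF add_subgroupD(1)[OF ideal_subgroup]] ..
    then have "x - 0 \<in> scaled f \<O>"
      by (simp only: coset_eq_iff[OF scaled_subgroup[OF O_subgroup]])
    then show "x \<in> scaled f \<O>" by simp
  qed
qed

end

end

section \<open>Traces of conjugates\<close>

lemma sum_lessThan_3: "(\<Sum>i<3. f i) = f 0 + f 1 + f (2::nat)" for f :: "nat \<Rightarrow> 'a::comm_monoid_add"
  by (simp add: numeral_3_eq_3 numeral_2_eq_2 add.assoc)

lemma prod_lessThan_3: "(\<Prod>i<3. f i) = f 0 * f 1 * f (2::nat)" for f :: "nat \<Rightarrow> 'a::comm_monoid_mult"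
  by (simp add: numeral_3_eq_3 numeral_2_eq_2 mult.assoc)

lemma arith_geo_mean_3:
  fixes x y z :: real
  assumes "x \<ge> 0" "y \<ge> 0" "z \<ge> 0"
  shows "27 * (x * y * z) \<le> (x + y + z) ^ 3"
proof -
  have *: "2 * ((x + y + z) ^ 3 - 27 * (x * y * z)) =
      (x + y + z + 6 * z) * (x - y)\<^sup>2 + (x + y + z + 6 * x) * (y - z)\<^sup>2
      + (x + y + z + 6 * y) * (z - x)\<^sup>2"
    by (simp add: power2_eq_square power3_eq_cube algebra_simps)
  have "0 \<le> 2 * ((x + y + z) ^ 3 - 27 * (x * y * z))"
    unfolding * using assms by (intro add_nonneg_nonneg mult_nonneg_nonneg) auto
  then show ?thesis by simp
qed

text \<open>This form avoids cube roots: \<open>c\<close> may be any number whose cube lies below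
  the product, so rational approximations from below can be inserted directly.\<close>

lemma arith_geo_mean_3_bound:
  fixes x y z :: real
  assumes "x \<ge> 0" "y \<ge> 0" "z \<ge> 0" "c ^ 3 \<le> x * y * z"
  shows "3 * c \<le> x + y + z"
proof (rule power_le_imp_le_base[of _ 2])
  have "(3 * c) ^ 3 \<le> (x + y + z) ^ 3"
    using arith_geo_mean_3[OF assms(1-3)] assms(4) by (simp add: power_mult_distrib)
  then show "(3 * c) ^ Suc 2 \<le> (x + y + z) ^ Suc 2" by (simp add: numeral_3_eq_3)
qed (use assms in auto)

text \<open>5 and 48 are the discriminants for the invariants (4, 4, 1) and (5, 5, 1).\<close>

lemma int_square_neq: "(d::int)\<^sup>2 \<noteq> 5" "d\<^sup>2 \<noteq> 48"
proof -
  have *: "\<not> (k\<^sup>2 < d\<^sup>2 \<and> d\<^sup>2 < (k + 1)\<^sup>2)" if "k \<ge> 0" for k :: int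
  proof
    assume h: "k\<^sup>2 < d\<^sup>2 \<and> d\<^sup>2 < (k + 1)\<^sup>2"
    then have "k < \<bar>d\<bar>" using that by (metis abs_ge_zero abs_of_nonneg power2_abs power_less_imp_less_base)
    moreover have "\<bar>d\<bar> < k + 1" using h that by (metis add_increasing zero_le_one power2_abs power_less_imp_less_base)
    ultimately show False by simp
  qed
  show "d\<^sup>2 \<noteq> 5" using *[of 2] by auto
  show "d\<^sup>2 \<noteq> 48" using *[of 6] by auto
qed

text \<open>The invariants belong to a totally positive cubic polynomial with square discriminant.\<close>
lemma cubic_trace_bound:
  fixes E1 E2 E3 D :: int
  assumes pos: "E1 > 0" "E2 > 0" "E3 > 0" and "D \<noteq> 0"
    and e: "3 * E2 \<le> E1\<^sup>2" "3 * E1 * E3 \<le> E2\<^sup>2"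
    and disc: "D\<^sup>2 = E1\<^sup>2 * E2\<^sup>2 - 4 * E2 ^ 3 - 4 * E1 ^ 3 * E3 + 18 * E1 * E2 * E3 - 27 * E3\<^sup>2"
  shows "E1 \<ge> 5" "E1 + E2 \<ge> 11"
proof -
  have D: "D\<^sup>2 > 0" using \<open>D \<noteq> 0\<close> by simp
  have sq: "E1\<^sup>2 = E1 * E1" "E2\<^sup>2 = E2 * E2" by (simp_all add: power2_eq_square)
  have "3 * E1 * 1 \<le> 3 * E1 * E3" using pos by (intro mult_left_mono) auto
  then have f: "3 * E2 \<le> E1 * E1" "3 * E1 \<le> E2 * E2" using e unfolding sq by auto
  have 3: "E1 \<ge> 5 \<and> E1 + E2 \<ge> 11"
  proof (rule ccontr)
    assume h: "\<not> ?thesis"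
    have "E1 \<le> 9 \<and> E2 \<le> 9"
    proof (cases "E1 \<ge> 5")
      case False
      then have "E1\<^sup>2 \<le> 4\<^sup>2" using pos by (intro power_mono) auto
      then show ?thesis using e False by auto
    qed (use h pos in auto)
    then have "E1 \<in> {1, 2, 3, 4, 5, 6, 7, 8, 9}" "E2 \<in> {1, 2, 3, 4, 5, 6, 7, 8, 9}" using pos by auto
    then have E12: "(E1, E2) \<in> {(3, 3), (4, 4), (4, 5), (5, 4), (5, 5)}"
      using f h by (elim insertE emptyE) simp_all
    have D2: "D\<^sup>2 = E1 * E1 * (E2 * E2) - 4 * (E2 * E2 * E2) - 4 * (E1 * E1 * E1) * E3 + 18 * E1 * E2 * E3 - 27 * (E3 * E3)"
      using disc by (simp add: power2_eq_square power3_eq_cube)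
    have e2: "3 * E1 * E3 \<le> E2 * E2" using e(2) unfolding sq .
    \<comment> \<open>Only these five pairs violate the claim and satisfy the inequalities between
      the invariants, which also bound \<open>E3\<close>. The discriminants are 0 for (3, 3, 1), 5
      for (4, 4, 1), -23 and 0 for (4, 5, 1) and (4, 5, 2), -23 for (5, 4, 1) and 48 for (5, 5, 1):
      none is a positive square.\<close>
    consider "E1 = 3" "E2 = 3" | "E1 = 4" "E2 = 4" | "E1 = 4" "E2 = 5" | "E1 = 5" "E2 = 4" | "E1 = 5" "E2 = 5"
      using E12 by auto
    then show False
    proof cases
      case 1
      then have "E3 = 1" using e2 pos by simp
      then show False using D2 1 D by simp
    next
      case 2
      then have "E3 = 1" using e2 pos by simp
      then show False using D2 2 int_square_neq(1)[of D] by simp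
    next
      case 3
      then have "E3 = 1 \<or> E3 = 2" using e2 pos by auto
      then show False using D2 3 D by auto
    next
      case 4
      then have "E3 = 1" using e2 pos by simp
      then show False using D2 4 D by simp
    next
      case 5
      then have "E3 = 1" using e2 pos by simp
      then show False using D2 5 int_square_neq(2)[of D] by simp
    qed
  qed
  then show "E1 \<ge> 5" "E1 + E2 \<ge> 11" by auto
qed

context cyclic_sextic
begin

abbreviation a :: "nat \<Rightarrow> complex \<Rightarrow> real" where "a i x \<equiv> (cmod (t i x))\<^sup>2"

definition Qf :: "(nat \<Rightarrow> real) \<Rightarrow> complex \<Rightarrow> real" where
  "Qf v x = (\<Sum>i<3. v i * a i x)"

lemma Qf_3: "Qf v x = v 0 * a 0 x + v 1 * a 1 x + v 2 * a 2 x"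
  unfolding Qf_def by (rule sum_lessThan_3)

lemma Nm_3: "Nm x = a 0 x * a 1 x * a 2 x"
  unfolding Nm_def by (rule prod_lessThan_3)

lemma a_pos: "x \<in> F \<Longrightarrow> x \<noteq> 0 \<Longrightarrow> a i x > 0"
  by (simp add: t_eq_0)

lemma a_mult: "x \<in> F \<Longrightarrow> y \<in> F \<Longrightarrow> a i (x * y) = a i x * a i y"
  by (simp add: t_mult norm_mult power_mult_distrib)

lemma a_3: "x \<in> F \<Longrightarrow> a 3 x = a 0 x"
  using cnj_eq[of x] by (metis complex_mod_cnj funpow_0)

text \<open>The three values are permuted cyclically by \<open>\<tau>\<close>, so their elementary
  symmetric functions are integers. If two of them coincide then all three do, and they are a common
  positive integer n: n = 1 is the first alternative, and n \<ge> 2 gives trace at least 6.\<close>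

lemma conjugate_trace:
  assumes x: "x \<in> \<O>" "x \<noteq> 0"
  shows "\<exists>n::nat. a 0 x + a 1 x + a 2 x = real n" (is ?nat)
    and "(a 0 x = 1 \<and> a 1 x = 1 \<and> a 2 x = 1) \<or>
      (a 0 x + a 1 x + a 2 x \<ge> 5 \<and>
       (a 0 x + a 1 x + a 2 x) + (a 0 x * a 1 x + a 1 x * a 2 x + a 2 x * a 0 x) \<ge> 11)" (is ?bound)
proof -
  have xF: "x \<in> F" by (rule O_F[OF x(1)])
  define A B C where "A = a 0 x" and "B = a 1 x" and "C = a 2 x"
  have pos: "A > 0" "B > 0" "C > 0" unfolding A_def B_def C_def by (simp_all only: a_pos[OF xF x(2)])
  define \<alpha> where "\<alpha> = x * t 3 x"
  have \<alpha>: "\<alpha> \<in> \<O>" unfolding \<alpha>_def by (intro O_mult t_O x)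
  define p q r where "p = \<alpha>" and "q = t 1 \<alpha>" and "r = t 2 \<alpha>"
  have pO: "p \<in> \<O>" "q \<in> \<O>" "r \<in> \<O>" unfolding p_def q_def r_def using \<alpha> by (simp_all only: t_O)
  have pF: "p \<in> F" "q \<in> F" "r \<in> F" using pO O_F by auto
  have conv: "p = of_real A" "q = of_real B" "r = of_real C"
    using complex_norm_t[OF xF, of 0] complex_norm_t[OF xF, of 1] complex_norm_t[OF xF, of 2]
    unfolding p_def q_def r_def \<alpha>_def A_def B_def C_def by (auto simp del: funpow.simps(2))
  have t3: "t 3 \<alpha> = \<alpha>"
    unfolding \<alpha>_def using t_plus[of 3 3 x] t_6[OF xF] by (simp add: t_mult xF t_F mult.commute)
  have \<tau>: "\<tau> p = q" "\<tau> q = r" "\<tau> r = p"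
    unfolding p_def q_def r_def using t3 by (simp_all add: numeral_2_eq_2 numeral_3_eq_3)
  have \<tau>_add: "\<tau> (u + w) = \<tau> u + \<tau> w" and \<tau>_mult: "\<tau> (u * w) = \<tau> u * \<tau> w"
    and \<tau>_diff: "\<tau> (u - w) = \<tau> u - \<tau> w" if "u \<in> F" "w \<in> F" for u w
    using t_add[OF that, of 1] t_mult[OF that, of 1] t_diff[OF that, of 1] by auto
  have int: "\<exists>z::int. y = of_int z" if w: "w \<in> \<O>" "\<tau> w = w" "w = of_real y" for w and y :: real
  proof -
    obtain z :: int where "w = of_int z" by (rule O_fixed_imp_int[OF w(1,2)])
    then have "of_real y = (of_real (of_int z) :: complex)" using w(3) by simp
    then show ?thesis unfolding of_real_eq_iff by blast
  qed
  note Fs = pF F_add F_mult F_diff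
  have "\<exists>z::int. A + B + C = of_int z"
    by (rule int[of "p + q + r"]) (intro O_add pO, simp add: \<tau>_add Fs \<tau>, simp add: conv)
  then obtain E1 :: int where E1: "A + B + C = of_int E1" by blast
  have "\<exists>z::int. A * B + B * C + C * A = of_int z"
    by (rule int[of "p * q + q * r + r * p"]) (intro O_add O_mult pO, simp add: \<tau>_add \<tau>_mult Fs \<tau>, simp add: conv)
  then obtain E2 :: int where E2: "A * B + B * C + C * A = of_int E2" by blast
  have "\<exists>z::int. A * B * C = of_int z"
    by (rule int[of "p * q * r"]) (intro O_mult pO, simp add: \<tau>_mult Fs \<tau>, simp add: conv)
  then obtain E3 :: int where E3: "A * B * C = of_int E3" by blast
  \<comment> \<open>This product changes sign under transpositions but is invariant under the cyclic
    shift; here the Galois group being cyclic enters.\<close>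
  have "\<exists>z::int. (A - B) * (B - C) * (C - A) = of_int z"
    by (rule int[of "(p - q) * (q - r) * (r - p)"])
      (intro O_mult O_diff pO, simp add: \<tau>_mult \<tau>_diff Fs \<tau>, simp add: conv)
  then obtain D :: int where D: "(A - B) * (B - C) * (C - A) = of_int D" by blast
  have e_pos: "E1 > 0" "E2 > 0" "E3 > 0"
  proof -
    have "real_of_int E1 > 0" "real_of_int E2 > 0" "real_of_int E3 > 0"
      unfolding E1[symmetric] E2[symmetric] E3[symmetric] using pos by (auto intro!: add_pos_pos)
    then show "E1 > 0" "E2 > 0" "E3 > 0" by auto
  qed
  have "a 0 x + a 1 x + a 2 x = real (nat E1)"
    using E1 e_pos unfolding A_def B_def C_def by simp
  then show ?nat by blast
  show ?bound
  proof (cases "D = 0")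
    case True
    then have "A = B \<or> B = C \<or> C = A" using D by simp
    then have "p = q \<or> q = r \<or> r = p" unfolding conv by auto
    then have eq: "p = q" "q = r" using \<tau> by metis+
    then have AB: "B = A" "C = A" unfolding conv by auto
    obtain n :: int where n: "A = of_int n" using int[OF pO(1) _ conv(1)] \<tau>(1) eq by auto
    have "n \<ge> 1" using pos n by auto
    show ?thesis
    proof (cases "n = 1")
      case True
      then show ?thesis using AB n unfolding A_def B_def C_def by auto
    next
      case False
      then have "A \<ge> 2" using n \<open>n \<ge> 1\<close> by simp
      then have "A * A \<ge> 2 * 2" by (intro mult_mono) auto
      then show ?thesis using AB \<open>A \<ge> 2\<close> unfolding A_def B_def C_def by auto
    qed
  next
    case False
    have "2 * ((A + B + C)\<^sup>2 - 3 * (A * B + B * C + C * A)) = (A - B)\<^sup>2 + (B - C)\<^sup>2 + (C - A)\<^sup>2"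
      by (simp add: power2_eq_square algebra_simps)
    then have "3 * (A * B + B * C + C * A) \<le> (A + B + C)\<^sup>2"
      by (smt (verit) zero_le_power2)
    then have "real_of_int (3 * E2) \<le> real_of_int (E1\<^sup>2)" unfolding E1 E2 by simp
    then have e1: "3 * E2 \<le> E1\<^sup>2" unfolding of_int_le_iff .
    have "2 * ((A * B + B * C + C * A)\<^sup>2 - 3 * (A + B + C) * (A * B * C))
        = (A * B - B * C)\<^sup>2 + (B * C - C * A)\<^sup>2 + (C * A - A * B)\<^sup>2"
      by (simp add: power2_eq_square algebra_simps)
    then have "3 * (A + B + C) * (A * B * C) \<le> (A * B + B * C + C * A)\<^sup>2"
      by (smt (verit) zero_le_power2)
    then have "real_of_int (3 * E1 * E3) \<le> real_of_int (E2\<^sup>2)" unfolding E1 E2 E3 by simp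
    then have e2: "3 * E1 * E3 \<le> E2\<^sup>2" unfolding of_int_le_iff .
    have "((A - B) * (B - C) * (C - A))\<^sup>2 = (A + B + C)\<^sup>2 * (A * B + B * C + C * A)\<^sup>2
        - 4 * (A * B + B * C + C * A) ^ 3 - 4 * (A + B + C) ^ 3 * (A * B * C)
        + 18 * (A + B + C) * (A * B + B * C + C * A) * (A * B * C) - 27 * (A * B * C)\<^sup>2"
      by (simp add: power2_eq_square power3_eq_cube algebra_simps)
    then have "real_of_int (D\<^sup>2) = real_of_int (E1\<^sup>2 * E2\<^sup>2 - 4 * E2 ^ 3 - 4 * E1 ^ 3 * E3 + 18 * E1 * E2 * E3 - 27 * E3\<^sup>2)"
      unfolding E1 E2 E3 D by simp
    then have disc: "D\<^sup>2 = E1\<^sup>2 * E2\<^sup>2 - 4 * E2 ^ 3 - 4 * E1 ^ 3 * E3 + 18 * E1 * E2 * E3 - 27 * E3\<^sup>2"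
      unfolding of_int_eq_iff .
    have "E1 \<ge> 5" "E1 + E2 \<ge> 11"
      using cubic_trace_bound[OF e_pos False e1 e2 disc] by auto
    then have "real_of_int E1 \<ge> 5" "real_of_int E1 + real_of_int E2 \<ge> 11" by linarith+
    then show ?thesis unfolding A_def[symmetric] B_def[symmetric] C_def[symmetric] E1 E2 by blast
  qed
qed

lemma lattice6_Qf:
  assumes L: "add_subgroup L" "L \<subseteq> F"
    and index: "\<And>m. m > 0 \<Longrightarrow> add_index L ((\<lambda>x. of_nat m * x) ` L) = m ^ 6"
    and v: "v 0 > 0" "v 1 > 0" "v 2 > 0"
    and Nm: "\<And>x. x \<in> L \<Longrightarrow> x \<noteq> 0 \<Longrightarrow> v 0 * v 1 * v 2 * Nm x \<ge> 1"
  shows "lattice6 L (Qf v)"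
proof
  fix x y assume xy: "x \<in> L" "y \<in> L"
  have "(cmod (p + q))\<^sup>2 + (cmod (p - q))\<^sup>2 = 2 * (cmod p)\<^sup>2 + 2 * (cmod q)\<^sup>2" for p q
    unfolding cmod_power2 by (simp add: power2_eq_square algebra_simps)
  then have "a i (x + y) + a i (x - y) = 2 * a i x + 2 * a i y" for i
    using xy L(2) by (simp add: t_add t_diff subset_iff)
  then have "v i * a i (x + y) + v i * a i (x - y) = 2 * (v i * a i x) + 2 * (v i * a i y)" for i
    by (metis distrib_left mult.left_commute)
  then show "Qf v (x + y) + Qf v (x - y) = 2 * Qf v x + 2 * Qf v y"
    unfolding Qf_def sum.distrib[symmetric] sum_distrib_left by simp
next
  fix m :: nat and x assume x: "x \<in> L"
  have am: "a i (of_nat m * x) = (real m)\<^sup>2 * a i x" for i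
    using x L(2) by (auto simp: t_mult t_of_nat F_of_nat subset_iff norm_mult power_mult_distrib)
  show "Qf v (of_nat m * x) = (real m)\<^sup>2 * Qf v x"
    unfolding Qf_def sum_distrib_left am by (intro sum.cong refl mult.left_commute)
next
  fix x
  show "Qf v x \<ge> 0" unfolding Qf_3 using v by auto
next
  fix x assume x: "x \<in> L" "x \<noteq> 0"
  have "3 * 1 \<le> v 0 * a 0 x + v 1 * a 1 x + v 2 * a 2 x"
    by (rule arith_geo_mean_3_bound) (use v Nm[OF x] in \<open>auto simp: Nm_3 mult_ac\<close>)
  then show "3 \<le> Qf v x" unfolding Qf_3 by simp
qed (use L index in auto)

end

section \<open>Numerical estimates\<close>

text \<open>The exponential is bounded below by a quadratic Taylor polynomial at 1/64 of the argument,
  followed by six rounded squarings.\<close>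
lemma exp_neg_two_pi_le:
  fixes t :: real
  assumes t: "0 \<le> t" and r0: "r0 \<le> 1 + 6283 / 64000 * t + (6283 / 64000 * t)\<^sup>2 / 2"
    and r: "r1 \<le> r0\<^sup>2" "r2 \<le> r1\<^sup>2" "r3 \<le> r2\<^sup>2" "r4 \<le> r3\<^sup>2" "r5 \<le> r4\<^sup>2" "r6 \<le> r5\<^sup>2"
    and nonneg: "0 \<le> r0" "0 \<le> r1" "0 \<le> r2" "0 \<le> r3" "0 \<le> r4" "0 \<le> r5" and c: "1 \<le> c * r6" "0 \<le> c"
  shows "exp (- 2 * pi * t) \<le> c"
proof -
  \<comment> \<open>6.283 approximates 2 \<pi> from below, so \<open>64 * y\<close> is a lower bound
    of \<open>2 * pi * t\<close>.\<close>
  define y where "y = 6283 / 64000 * t"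
  have y: "y \<ge> 0" unfolding y_def using t by simp
  have sq: "q \<le> exp (2 * z)" if "q \<le> p\<^sup>2" "p \<le> exp z" "0 \<le> p" for p q z :: real
  proof -
    have "p\<^sup>2 \<le> (exp z)\<^sup>2" using that by (intro power_mono) auto
    then show ?thesis using that(1) by (simp add: exp_double)
  qed
  have "r0 \<le> exp y" using r0 exp_lower_Taylor_quadratic[OF y] unfolding y_def by linarith
  from sq[OF r(6) sq[OF r(5) sq[OF r(4) sq[OF r(3) sq[OF r(2) sq[OF r(1) this]]]]]] nonneg
  have "r6 \<le> exp (64 * y)" by simp
  also have "64 * y \<le> 2 * pi * t"
  proof -
    have "6283 / 1000 * t \<le> 2 * pi * t" using pi_approx(1) t by (intro mult_right_mono) auto
    then show ?thesis unfolding y_def by simp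
  qed
  finally have "r6 \<le> exp (2 * pi * t)" by simp
  then have "1 \<le> c * exp (2 * pi * t)" using c mult_left_mono[of r6 "exp (2 * pi * t)" c] by linarith
  then show ?thesis by (simp add: exp_minus field_simps)
qed

text \<open>The size of a term with \<open>Q = s\<close> in units of \<open>exp (- 6 * pi)\<close>,
  the largest term that a nonzero vector can have. In this unit the gain and the losses are numbers
  of moderate size.\<close>

definition gauss_ratio :: "real \<Rightarrow> real" where "gauss_ratio s = exp (- 2 * pi * (s - 3))"

lemma gauss_ratio_mono: "s \<le> s' \<Longrightarrow> gauss_ratio s' \<le> gauss_ratio s"
  unfolding gauss_ratio_def by simp

lemma gauss_ratio_pos: "gauss_ratio s > 0" unfolding gauss_ratio_def by simp

lemma exp_eq_gauss_ratio: "exp (- 2 * pi * s) = exp (- 6 * pi) * gauss_ratio s"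
  unfolding gauss_ratio_def exp_add[symmetric] by (simp add: algebra_simps)

lemma gauss_ratio_values:
  shows "gauss_ratio 3.002 \<le> 0.988" "gauss_ratio 3.02 \<le> 0.89" "gauss_ratio 3.1 \<le> 0.615"
    "gauss_ratio 3.2 \<le> 0.45" "gauss_ratio 3.27 \<le> 0.2" "gauss_ratio 3.35 \<le> 0.12" "gauss_ratio 3.52 \<le> 0.04"
    "gauss_ratio 3.7 \<le> 0.0125" "gauss_ratio 3.779 \<le> 0.0076" "gauss_ratio 3.89 \<le> 0.005" "gauss_ratio 4.19 \<le> 0.0015" "gauss_ratio 4.43 \<le> 0.00018"
proof -
  show "gauss_ratio 3.002 \<le> 0.988"
    unfolding gauss_ratio_def by (rule exp_neg_two_pi_le[of _ "100019 / 100000" "100038 / 100000" "100076 / 100000" "100152 / 100000"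
        "100304 / 100000" "100608 / 100000" "101219 / 100000"]) (simp_all add: power2_eq_square)
  show "gauss_ratio 3.02 \<le> 0.89"
    unfolding gauss_ratio_def by (rule exp_neg_two_pi_le[of _ "100196 / 100000" "100392 / 100000" "100785 / 100000" "101576 / 100000"
        "103176 / 100000" "106452 / 100000" "113320 / 100000"]) (simp_all add: power2_eq_square)
  show "gauss_ratio 3.1 \<le> 0.615"
    unfolding gauss_ratio_def by (rule exp_neg_two_pi_le[of _ "100986 / 100000" "101981 / 100000" "104001 / 100000" "108162 / 100000"
        "116990 / 100000" "136866 / 100000" "187323 / 100000"]) (simp_all add: power2_eq_square)
  show "gauss_ratio 3.2 \<le> 0.45"
    unfolding gauss_ratio_def by (rule exp_neg_two_pi_le[of _ "101982 / 100000" "104003 / 100000" "108166 / 100000" "116998 / 100000"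
        "136885 / 100000" "187375 / 100000" "351093 / 100000"]) (simp_all add: power2_eq_square)
  show "gauss_ratio 3.27 \<le> 0.2"
    unfolding gauss_ratio_def by (rule exp_neg_two_pi_le[of _ "102685 / 100000" "105442 / 100000" "111180 / 100000" "123609 / 100000"
        "152791 / 100000" "233450 / 100000" "544989 / 100000"]) (simp_all add: power2_eq_square)
  show "gauss_ratio 3.35 \<le> 0.12"
    unfolding gauss_ratio_def by (rule exp_neg_two_pi_le[of _ "103495 / 100000" "107112 / 100000" "114729 / 100000" "131627 / 100000"
        "173256 / 100000" "300176 / 100000" "901056 / 100000"]) (simp_all add: power2_eq_square)
  show "gauss_ratio 3.52 \<le> 0.04"
    unfolding gauss_ratio_def by (rule exp_neg_two_pi_le[of _ "105235 / 100000" "110744 / 100000" "122642 / 100000" "150410 / 100000"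
        "226231 / 100000" "511804 / 100000" "261943 / 10000"]) (simp_all add: power2_eq_square)
  show "gauss_ratio 3.7 \<le> 0.0125"
    unfolding gauss_ratio_def by (rule exp_neg_two_pi_le[of _ "107108 / 100000" "114721 / 100000" "131609 / 100000" "173209 / 100000"
        "300013 / 100000" "900078 / 100000" "810140 / 10000"]) (simp_all add: power2_eq_square)
  show "gauss_ratio 3.779 \<le> 0.0076"
    unfolding gauss_ratio_def by (rule exp_neg_two_pi_le[of _ "107940 / 100000" "116510 / 100000" "135745 / 100000" "184267 / 100000"
        "339543 / 100000" "115289 / 10000" "132915 / 1000"]) (simp_all add: power2_eq_square)
  show "gauss_ratio 3.89 \<le> 0.005"
    unfolding gauss_ratio_def by (rule exp_neg_two_pi_le[of _ "109118 / 100000" "119067 / 100000" "141769 / 100000" "200984 / 100000"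
        "403945 / 100000" "163171 / 10000" "266247 / 1000"]) (simp_all add: power2_eq_square)
  show "gauss_ratio 4.19 \<le> 0.0015"
    unfolding gauss_ratio_def by (rule exp_neg_two_pi_le[of _ "112364 / 100000" "126256 / 100000" "159405 / 100000" "254099 / 100000"
        "645663 / 100000" "416880 / 10000" "173788 / 100"]) (simp_all add: power2_eq_square)
  show "gauss_ratio 4.43 \<le> 0.00018"
    unfolding gauss_ratio_def by (rule exp_neg_two_pi_le[of _ "115023 / 100000" "132302 / 100000" "175038 / 100000" "306383 / 100000"
        "938705 / 100000" "881167 / 10000" "776455 / 100"]) (simp_all add: power2_eq_square)
qed

lemma exp_6_pi: "exp (- 6 * pi) \<le> 1 / 10 ^ 8"
proof -
  have "exp (- 2 * pi * 3) \<le> 1 / 10 ^ 8"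
    by (rule exp_neg_two_pi_le[of _ "133788 / 100000" "178992 / 100000" "320381 / 100000" "102643 / 10000"
        "105355 / 1000" "110996 / 10" "123201000"]) (simp_all add: power2_eq_square)
  then show ?thesis by simp
qed

lemma exp_two_pi_le: "exp (- 2 * pi) \<le> 1 / 6"
proof -
  have "exp (- 2 * pi * 1) \<le> 1 / 6"
    by (rule exp_neg_two_pi_le[of _ "110299 / 100000" "121658 / 100000" "148006 / 100000" "219057 / 100000"
        "479859 / 100000" "230264 / 10000" "530215 / 1000"]) (simp_all add: power2_eq_square)
  then show ?thesis by simp
qed

text \<open>Half of the inequality needed when \<open>W\<close> has two elements: 63 and 4096 are
  half of the count 126 and of the tail constant 8192. The lower bounds for \<open>s'\<close> are
  those of the vectors in \<open>R\<close>.\<close>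

lemma gauss_ratio_combined:
  assumes s: "3.002 \<le> s" "s \<le> 3.35" and s': "13.49 - 3 * s \<le> s'" "7.05 - s \<le> s'"
  shows "gauss_ratio s + 63 * gauss_ratio s' + 4096 * exp (- 6 * pi) < 1"
proof -
  have small: "4096 * exp (- 6 * pi) \<le> 1 / 10000" using exp_6_pi by simp
  have *: ?thesis if "l \<le> s" "l' \<le> s'" "gauss_ratio l + 63 * gauss_ratio l' \<le> 9998 / 10000" for l l'
    using gauss_ratio_mono[OF that(1)] gauss_ratio_mono[OF that(2)] that(3) small by linarith
  \<comment> \<open>On each interval \<open>s\<close> is replaced by its left end and
    \<open>s'\<close> by the bound at the right end. The bound \<open>13.49 - 3 * s\<close> is used
    up to 3.2 and \<open>7.05 - s\<close> after that; they cross at 3.22.\<close>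
  consider "s \<le> 3.02" | "3.02 \<le> s" "s \<le> 3.1" | "3.1 \<le> s" "s \<le> 3.2" | "3.2 \<le> s" "s \<le> 3.27" | "3.27 \<le> s"
    by linarith
  then show ?thesis
  proof cases
    case 1 then show ?thesis using s s' gauss_ratio_values by (intro *[of "3.002" "4.43"]) auto
  next
    case 2 then show ?thesis using s s' gauss_ratio_values by (intro *[of "3.02" "4.19"]) auto
  next
    case 3 then show ?thesis using s s' gauss_ratio_values by (intro *[of "3.1" "3.89"]) auto
  next
    case 4 then show ?thesis using s s' gauss_ratio_values by (intro *[of "3.2" "3.779"]) auto
  next
    case 5 then show ?thesis using s s' gauss_ratio_values by (intro *[of "3.27" "3.7"]) auto
  qed
qed

section \<open>Elementary inequalities, mostly for three numbers of product 1\<close>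

lemma exp_le_quadratic: "exp (x::real) \<le> 1 + x + x\<^sup>2 / 2 * exp \<bar>x\<bar>"
proof -
  obtain t where t: "\<bar>t\<bar> \<le> \<bar>x\<bar>" "exp x = (\<Sum>m<2. x ^ m / fact m) + exp t / fact 2 * x ^ 2"
    using Maclaurin_exp_le[of x 2] by blast
  have "exp t \<le> exp \<bar>x\<bar>" using t(1) by simp
  then have "exp t * (x\<^sup>2 / 2) \<le> exp \<bar>x\<bar> * (x\<^sup>2 / 2)" by (intro mult_right_mono) auto
  then show ?thesis using t(2) by (simp add: numeral_2_eq_2 mult.commute)
qed

text \<open>With x = t^2 and y z = 1 / x one has x + y + z - 3 >= (t - 1)^2 (t + 2) / t.\<close>
lemma deviation_bound:
  fixes x y z :: real
  assumes pos: "x > 0" "y > 0" "z > 0" and prd: "x * y * z = 1" and s: "x + y + z \<le> 3.002"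
  shows "(x - 1)\<^sup>2 \<le> 1.5 * (x + y + z - 3)"
proof -
  define t where "t = sqrt x"
  have t: "t > 0" "x = t\<^sup>2" unfolding t_def using pos by auto
  have "4 * (y * z) \<le> (y + z)\<^sup>2"
    using zero_le_power2[of "y - z"] by (simp add: power2_eq_square algebra_simps)
  moreover have "y * z = (1 / t)\<^sup>2" using prd t by (simp add: field_simps power2_eq_square)
  ultimately have "(2 * (1 / t))\<^sup>2 \<le> (y + z)\<^sup>2" unfolding power_mult_distrib by simp
  then have yz: "2 / t \<le> y + z" using pos power2_le_imp_le[of "2 * (1 / t)" "y + z"] by simp
  define \<eta> where "\<eta> = x + y + z - 3"
  have e: "t * \<eta> \<ge> (t - 1)\<^sup>2 * (t + 2)"
  proof -
    have "t * (t\<^sup>2 + 2 / t - 3) \<le> t * \<eta>"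
      unfolding \<eta>_def using yz t by (intro mult_left_mono) auto
    moreover have "t * (t\<^sup>2 + 2 / t - 3) = (t - 1)\<^sup>2 * (t + 2)"
      using t by (simp add: field_simps power2_eq_square)
    ultimately show ?thesis by simp
  qed
  have \<eta>: "\<eta> \<le> 0.002" unfolding \<eta>_def using s by simp
  have "(t - 1)\<^sup>2 * t \<le> (t - 1)\<^sup>2 * (t + 2)" by (intro mult_left_mono) auto
  then have "t * (t - 1)\<^sup>2 \<le> t * \<eta>" using e by (simp add: mult.commute)
  then have "(t - 1)\<^sup>2 \<le> \<eta>" using t(1) by simp
  then have "(t - 1)\<^sup>2 \<le> (0.05)\<^sup>2" using \<eta> by (simp add: power2_eq_square)
  then have t_le: "t \<le> 1.05" using power2_le_imp_le[of "t - 1" "0.05"] by simp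
  have "(x - 1)\<^sup>2 * (t + 2) = (t - 1)\<^sup>2 * (t + 2) * (t + 1)\<^sup>2"
    unfolding t(2) by (simp add: power2_eq_square algebra_simps)
  also have "\<dots> \<le> t * \<eta> * (t + 1)\<^sup>2" using e by (intro mult_right_mono) auto
  also have "\<dots> = \<eta> * (t * (t + 1)\<^sup>2)" by simp
  \<comment> \<open>At \<open>t = 1\<close> the quotient of \<open>t * (t + 1)\<^sup>2\<close> by
    \<open>t + 2\<close> is 4/3, the sharp second-order constant; 1.5 leaves room for
    \<open>t\<close> up to 1.05.\<close>
  also have "\<dots> \<le> \<eta> * (1.5 * (t + 2))"
  proof (rule mult_left_mono)
    have "(t + 1) * (t + 1) \<le> 2.05 * 2.05" using t t_le by (intro mult_mono) auto
    then have "t * ((t + 1) * (t + 1)) \<le> t * (2.05 * 2.05)" using t by (intro mult_left_mono) auto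
    then show "t * (t + 1)\<^sup>2 \<le> 1.5 * (t + 2)" using t_le by (simp add: power2_eq_square)
    show "\<eta> \<ge> 0" using \<open>(t - 1)\<^sup>2 \<le> \<eta>\<close> by (smt (verit) zero_le_power2)
  qed
  finally have "(x - 1)\<^sup>2 * (t + 2) \<le> (1.5 * \<eta>) * (t + 2)" by (simp add: mult_ac)
  then show ?thesis unfolding \<eta>_def using t by simp
qed

lemma sum_eq_3_imp_1:
  fixes x y z :: real
  assumes "x > 0" "y > 0" "z > 0" "x * y * z = 1"
  shows "3 \<le> x + y + z" and "x + y + z = 3 \<Longrightarrow> x = 1"
proof -
  show "3 \<le> x + y + z" using arith_geo_mean_3_bound[of x y z 1] assms by simp
  assume "x + y + z = 3"
  then show "x = 1" using deviation_bound[OF assms] by simp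
qed

text \<open>A product 1 forces \<open>x * (y + z)\<^sup>2 \<ge> 4\<close>, which leaves
  \<open>x\<close> a bounded interval. Its ends are 0.9 / 3 and 0.9 * 3, so that two values on the
  same side of 0.9 have a quotient between 1/3 and 3.\<close>

lemma short_unit_coordinate:
  fixes x y z :: real
  assumes pos: "x > 0" "y > 0" "z > 0" and prd: "x * y * z = 1" and s: "x + y + z < 3.779"
  shows "0.3 < x" "x < 2.7"
proof -
  have "4 * (y * z) \<le> (y + z)\<^sup>2"
    using zero_le_power2[of "y - z"] by (simp add: power2_eq_square algebra_simps)
  then have "x * (4 * (y * z)) \<le> x * (y + z)\<^sup>2" using pos by (intro mult_left_mono) auto
  then have 4: "4 \<le> x * (y + z)\<^sup>2" using prd by simp
  have x: "x < 3.779" using s pos by simp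
  have le: "x * (y + z)\<^sup>2 \<le> x * (3.779 - x)\<^sup>2"
    using s pos by (intro mult_left_mono power_mono) auto
  show "0.3 < x"
  proof (rule ccontr)
    assume h: "\<not> ?thesis"
    have "x * (3.779 - x)\<^sup>2 < 4"
    \<comment> \<open>The two factors are bounded separately, which is too crude over the whole
      range; splitting at 0.28 keeps both products below 4.\<close>
    proof (cases "x \<le> 0.28")
      case True
      have "(3.779 - x)\<^sup>2 \<le> (3.779)\<^sup>2" using pos x by (intro power_mono) auto
      then have "x * (3.779 - x)\<^sup>2 \<le> 0.28 * (3.779)\<^sup>2" using True pos by (intro mult_mono) auto
      then show ?thesis by (simp add: power2_eq_square)
    next
      case False
      then have "(3.779 - x)\<^sup>2 \<le> (3.499)\<^sup>2" using x by (intro power_mono) auto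
      then have "x * (3.779 - x)\<^sup>2 \<le> 0.3 * (3.499)\<^sup>2" using h pos by (intro mult_mono) auto
      then show ?thesis by (simp add: power2_eq_square)
    qed
    then show False using 4 le by simp
  qed
  show "x < 2.7"
  proof (rule ccontr)
    assume h: "\<not> ?thesis"
    have "x * (3.779 - x)\<^sup>2 < 4"
    proof (cases "x \<le> 3.2")
      case True
      have "(3.779 - x)\<^sup>2 \<le> (1.079)\<^sup>2" using h x by (intro power_mono) auto
      then have "x * (3.779 - x)\<^sup>2 \<le> 3.2 * (1.079)\<^sup>2" using True pos by (intro mult_mono) auto
      then show ?thesis by (simp add: power2_eq_square)
    next
      case False
      then have "(3.779 - x)\<^sup>2 \<le> (0.579)\<^sup>2" using x by (intro power_mono) auto
      then have "x * (3.779 - x)\<^sup>2 \<le> 3.779 * (0.579)\<^sup>2" using x pos by (intro mult_mono) auto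
      then show ?thesis by (simp add: power2_eq_square)
    qed
    then show False using 4 le by simp
  qed
qed

text \<open>Three such sums stay below 10, hence below the bound 11 for the first two symmetric
  functions together.\<close>

lemma ratio_sum_bound:
  fixes t :: real
  assumes "1/3 < t" "t < 3" shows "t + 1 / t < 10 / 3"
proof -
  have "(t - 1/3) * (t - 3) < 0" using assms by (simp add: mult_pos_neg)
  moreover have "(t - 1/3) * (t - 3) = t * t + 1 - 10 / 3 * t" by (simp add: field_simps)
  ultimately have "t * t + 1 < 10 / 3 * t" by simp
  then show ?thesis using assms by (simp add: field_simps)
qed

section \<open>Theta series\<close>

context lattice6
begin

abbreviation "gauss x \<equiv> exp (- 2 * pi * Q x)"

lemma gauss_tail:
  "gauss summable_on {x\<in>L. Q x \<ge> 6}" "infsum gauss {x\<in>L. Q x \<ge> 6} \<le> 8192 * (exp (- 6 * pi))\<^sup>2"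
proof -
  have decay: "gauss x \<le> 1 * exp (- 2 * pi) ^ nat \<lfloor>Q x\<rfloor>" if "x \<in> L" for x
  proof -
    have "real (nat \<lfloor>Q x\<rfloor>) \<le> Q x" using Q_nonneg[OF that] by simp
    then have "2 * pi * real (nat \<lfloor>Q x\<rfloor>) \<le> 2 * pi * Q x" by (intro mult_left_mono) auto
    then show ?thesis by (simp add: exp_of_nat_mult[symmetric] mult_ac)
  qed
  note tail = tail_bound[of gauss 1 "exp (- 2 * pi)", OF _ decay _ exp_two_pi_le]
  show "gauss summable_on {x\<in>L. Q x \<ge> 6}" by (rule tail(1)) auto
  have "infsum gauss {x\<in>L. Q x \<ge> 6} \<le> 8192 * 1 * exp (- 2 * pi) ^ 6" by (rule tail(2)) auto
  also have "exp (- 2 * pi) ^ 6 = (exp (- 6 * pi))\<^sup>2"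
    by (simp add: exp_of_nat_mult[symmetric])
  finally show "infsum gauss {x\<in>L. Q x \<ge> 6} \<le> 8192 * (exp (- 6 * pi))\<^sup>2" by simp
qed

lemma gauss_summable: "gauss summable_on L"
  by (rule summable_if_tail[OF gauss_tail(1)])

lemma theta_le:
  "infsum gauss L \<le> 1 + (\<Sum>x\<in>{x\<in>L. x \<noteq> 0 \<and> Q x < 6}. gauss x) + 8192 * (exp (- 6 * pi))\<^sup>2"
proof -
  have split: "{x\<in>L. Q x < 6} = insert 0 {x\<in>L. x \<noteq> 0 \<and> Q x < 6}" using L(1) Q_0 by auto
  have fin: "finite {x\<in>L. x \<noteq> 0 \<and> Q x < 6}" by (rule finite_subset[OF _ finite_less_6]) auto
  have "infsum gauss L = infsum gauss ({x\<in>L. Q x < 6} \<union> {x\<in>L. Q x \<ge> 6})"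
    by (rule arg_cong[of _ _ "infsum gauss"]) auto
  also have "\<dots> = infsum gauss {x\<in>L. Q x < 6} + infsum gauss {x\<in>L. Q x \<ge> 6}"
    by (rule infsum_Un_disjoint[OF summable_on_finite[OF finite_less_6] gauss_tail(1)]) auto
  also have "infsum gauss {x\<in>L. Q x < 6} = 1 + (\<Sum>x\<in>{x\<in>L. x \<noteq> 0 \<and> Q x < 6}. gauss x)"
    unfolding infsum_finite[OF finite_less_6] unfolding split using fin by (subst sum.insert) (auto simp: Q_0)
  finally show ?thesis using gauss_tail(2) by simp
qed

text \<open>The comparison value is the contribution of 0, 1 and -1 to the trivial theta
  series.\<close>

lemma theta_bound_far:
  assumes "\<And>x. x \<in> L \<Longrightarrow> x \<noteq> 0 \<Longrightarrow> Q x \<ge> 3.779"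
  shows "infsum gauss L < 1 + 2 * exp (- 6 * pi)"
proof -
  let ?S = "{x\<in>L. x \<noteq> 0 \<and> Q x < 6}" and ?e = "exp (- 6 * pi) :: real"
  have "(\<Sum>x\<in>?S. gauss x) \<le> (\<Sum>x\<in>?S. ?e * gauss_ratio 3.779)"
    unfolding exp_eq_gauss_ratio using assms by (intro sum_mono mult_left_mono gauss_ratio_mono) auto
  also have "\<dots> \<le> 126 * (?e * gauss_ratio 3.779)"
    using count_below_6 gauss_ratio_pos[of "3.779"] by (simp add: mult_right_mono)
  finally have "infsum gauss L \<le> 1 + ?e * (126 * gauss_ratio 3.779 + 8192 * ?e)"
    using theta_le by (simp add: power2_eq_square algebra_simps)
  moreover have "126 * gauss_ratio 3.779 + 8192 * ?e < 2" using gauss_ratio_values(9) exp_6_pi by simp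
  then have "?e * (126 * gauss_ratio 3.779 + 8192 * ?e) < ?e * 2" by (intro mult_strict_left_mono) auto
  ultimately show ?thesis by linarith
qed

end

section \<open>Theta series of the ring of integers\<close>

context cyclic_sextic
begin

abbreviation G :: "(nat \<Rightarrow> real) \<Rightarrow> complex \<Rightarrow> real" where "G v x \<equiv> exp (- 2 * pi * Qf v x)"

abbreviation "trivial \<equiv> (\<lambda>_::nat. 1 :: real)"

text \<open>By a theorem of Kronecker (not needed here) these are the roots of unity of F.\<close>
definition W :: "complex set" where
  "W = {x\<in>\<O>. a 0 x = 1 \<and> a 1 x = 1 \<and> a 2 x = 1}"

definition R :: "complex set" where
  "R = {x\<in>\<O>. x \<noteq> 0 \<and> x \<notin> W}"

lemma lattice6_O:
  assumes "v 0 > 0" "v 1 > 0" "v 2 > 0" "v 0 * v 1 * v 2 = 1"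
  shows "lattice6 \<O> (Qf v)"
  using assms O_F Nm_ge_1 by (intro lattice6_Qf O_subgroup index_O_nat) auto

interpretation O1: lattice6 \<O> "Qf trivial" by (rule lattice6_O) auto

lemma W_O: "x \<in> W \<Longrightarrow> x \<in> \<O>" and W_nonzero: "x \<in> W \<Longrightarrow> x \<noteq> 0"
  unfolding W_def by (auto simp: t_0)

lemma Qf_W: "x \<in> W \<Longrightarrow> Qf v x = v 0 + v 1 + v 2"
  unfolding W_def Qf_3 by simp

lemma W_finite: "finite W"
  by (rule finite_subset[OF _ O1.finite_less_6]) (auto simp: Qf_W W_O)

lemma W_card: "card W \<ge> 2"
proof -
  have ai: "a i 1 = 1" "a i (- 1) = 1" for i by (simp_all add: t_1 t_uminus F_1)
  have "{1, - 1} \<subseteq> W"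
    unfolding W_def using O_1 O_uminus[OF O_1] by (simp only: insert_subset mem_Collect_eq ai) simp
  then have "card {1, - 1 :: complex} \<le> card W" by (intro card_mono W_finite)
  then show ?thesis by simp
qed

lemma R_trace:
  assumes "x \<in> R"
  shows "Qf trivial x \<ge> 5" "Qf trivial x + (a 0 x * a 1 x + a 1 x * a 2 x + a 2 x * a 0 x) \<ge> 11"
    "\<exists>n::nat. Qf trivial x = real n"
  using assms conjugate_trace[of x] unfolding R_def W_def Qf_3 by auto

lemma O_split: "\<O> = insert 0 (W \<union> R)" "0 \<notin> W \<union> R" "W \<inter> R = {}"
  unfolding R_def using W_O W_nonzero O_0 by auto

text \<open>This is the arithmetic-geometric mean inequality for the numbers v i * (a i x + l).\<close>
lemma R_separation:
  assumes v: "v 0 > 0" "v 1 > 0" "v 2 > 0" "v 0 * v 1 * v 2 = 1" and x: "x \<in> R"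
    and l: "l \<ge> 1" and c: "c ^ 3 \<le> 1 + 6 * l + 5 * l\<^sup>2 + l ^ 3"
  shows "Qf v x \<ge> 3 * c - l * (v 0 + v 1 + v 2)"
proof -
  define A B C where "A = a 0 x" and "B = a 1 x" and "C = a 2 x"
  have nonneg: "A \<ge> 0" "B \<ge> 0" "C \<ge> 0" unfolding A_def B_def C_def by auto
  have tr: "A + B + C \<ge> 5" "A + B + C + (A * B + B * C + C * A) \<ge> 11"
    using R_trace[OF x] unfolding Qf_3 A_def B_def C_def by auto
  have N: "A * B * C \<ge> 1" using Nm_ge_1[of x] x unfolding R_def Nm_3 A_def B_def C_def by auto
  \<comment> \<open>In terms of the symmetric functions, the product of the \<open>a i x + l\<close>
    is E3 + l (E1 + E2) + (l^2 - l) E1 + l^3. This is why E1 and E1 + E2 are the quantities bounded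
    below and why \<open>l \<ge> 1\<close> is asked for.\<close>
  have "(l * l - l) * 5 \<le> (l * l - l) * (A + B + C)" using l tr by (intro mult_left_mono) auto
  moreover have "l * 11 \<le> l * (A + B + C + (A * B + B * C + C * A))" using l tr by (intro mult_left_mono) auto
  ultimately have "1 + 6 * l + 5 * l\<^sup>2 + l ^ 3 \<le> (A + l) * (B + l) * (C + l)"
    using N by (simp add: power2_eq_square power3_eq_cube algebra_simps)
  also have "\<dots> = (v 0 * v 1 * v 2) * ((A + l) * (B + l) * (C + l))" using v by simp
  also have "\<dots> = (v 0 * (A + l)) * (v 1 * (B + l)) * (v 2 * (C + l))" by (simp add: mult_ac)
  finally have "3 * c \<le> v 0 * (A + l) + v 1 * (B + l) + v 2 * (C + l)"
    using c v nonneg l by (intro arith_geo_mean_3_bound) auto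
  then show ?thesis unfolding Qf_3 A_def B_def C_def by (simp add: algebra_simps)
qed

text \<open>3.779 is 3 times the cube root of 2, rounded down.\<close>

lemma large_norm_far:
  assumes v: "v 0 > 0" "v 1 > 0" "v 2 > 0" and N: "v 0 * v 1 * v 2 * Nm x \<ge> 2"
  shows "Qf v x \<ge> 3.779"
proof -
  have "3 * (3.779 / 3) \<le> v 0 * a 0 x + v 1 * a 1 x + v 2 * a 2 x"
    by (rule arith_geo_mean_3_bound)
       (use v N in \<open>auto simp: Nm_3 mult_ac power3_eq_cube intro: order_trans\<close>)
  then show ?thesis unfolding Qf_3 by simp
qed

lemma Nm_cases: "x \<in> \<O> \<Longrightarrow> x \<noteq> 0 \<Longrightarrow> Nm x = 1 \<or> Nm x \<ge> 2"
  using Nm_nat[of x] Nm_ge_1[of x] by (metis of_nat_1 of_nat_le_iff of_nat_numeral not_less_eq_eq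
      numeral_2_eq_2 One_nat_def le_antisym)

lemma unit_quotient:
  assumes "x \<in> \<O>" "y \<in> \<O>" "Nm x = 1" "Nm y = 1"
  obtains z where "z \<in> \<O>" "x = z * y" "z \<noteq> 0"
proof -
  obtain w where w: "w \<in> \<O>" "of_real (Nm y) = y * w" by (rule Nm_multiple[OF assms(2)])
  then have "x = x * w * y" using assms(4) by (simp add: mult_ac)
  moreover have "x \<noteq> 0" using assms(3) by (auto simp: Nm_def t_0)
  ultimately show ?thesis using O_mult[OF assms(1) w(1)] by (intro that[of "x * w"]) auto
qed

lemma theta_trivial_ge: "1 + real (card W) * exp (- 6 * pi) \<le> infsum (G trivial) \<O>"
proof -
  have "(\<Sum>x\<in>insert 0 W. G trivial x) \<le> infsum (G trivial) \<O>"
    using W_finite W_O O_0 by (intro finite_sum_le_infsum O1.gauss_summable) auto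
  also have "(\<Sum>x\<in>insert 0 W. G trivial x) = 1 + (\<Sum>x\<in>W. exp (- 6 * pi))"
    using W_finite W_nonzero by (subst sum.insert) (auto simp: O1.Q_0 Qf_W intro!: sum.cong)
  finally show ?thesis by simp
qed

section \<open>Principal ideals with \<open>s\<close> at a distance from 3\<close>

context
  fixes v :: "nat \<Rightarrow> real" and s :: real
  assumes v: "v 0 > 0" "v 1 > 0" "v 2 > 0" "v 0 * v 1 * v 2 = 1"
    and s: "s = v 0 + v 1 + v 2"
    and units: "\<And>x. x \<in> \<O> \<Longrightarrow> Nm x = 1 \<Longrightarrow> Qf v x \<ge> s"
begin

interpretation Ov: lattice6 \<O> "Qf v" by (rule lattice6_O) (rule v)+

lemma theta_le_R:
  assumes "s < 3.779"
  shows "infsum (G v) \<O> \<le> 1 + exp (- 6 * pi) *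
    (real (card W) * gauss_ratio s + (\<Sum>x\<in>{x\<in>R. Qf v x < 6}. gauss_ratio (Qf v x)) + 8192 * exp (- 6 * pi))"
proof -
  have "{x\<in>\<O>. x \<noteq> 0 \<and> Qf v x < 6} = W \<union> {x\<in>R. Qf v x < 6}"
    using O_split assms by (auto simp: Qf_W s)
  moreover have "finite {x\<in>R. Qf v x < 6}"
    by (rule finite_subset[OF _ Ov.finite_less_6]) (auto simp: R_def)
  ultimately have "(\<Sum>x\<in>{x\<in>\<O>. x \<noteq> 0 \<and> Qf v x < 6}. G v x)
      = (\<Sum>x\<in>W. G v x) + (\<Sum>x\<in>{x\<in>R. Qf v x < 6}. G v x)"
    using O_split(3) W_finite by (simp only:) (intro sum.union_disjoint, auto)
  moreover have "(\<Sum>x\<in>W. G v x) = real (card W) * (exp (- 6 * pi) * gauss_ratio s)"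
  proof -
    have "(\<Sum>x\<in>W. G v x) = (\<Sum>x\<in>W. exp (- 6 * pi) * gauss_ratio s)"
      by (rule sum.cong[OF refl]) (simp only: Qf_W s exp_eq_gauss_ratio)
    then show ?thesis by simp
  qed
  moreover have "(\<Sum>x\<in>{x\<in>R. Qf v x < 6}. G v x) = exp (- 6 * pi) * (\<Sum>x\<in>{x\<in>R. Qf v x < 6}. gauss_ratio (Qf v x))"
    by (simp only: exp_eq_gauss_ratio sum_distrib_left)
  ultimately have "(\<Sum>x\<in>{x\<in>\<O>. x \<noteq> 0 \<and> Qf v x < 6}. G v x) = real (card W) * (exp (- 6 * pi) * gauss_ratio s)
      + exp (- 6 * pi) * (\<Sum>x\<in>{x\<in>R. Qf v x < 6}. gauss_ratio (Qf v x))" by (simp only:)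
  then have "infsum (G v) \<O> \<le> 1 + (real (card W) * (exp (- 6 * pi) * gauss_ratio s)
      + exp (- 6 * pi) * (\<Sum>x\<in>{x\<in>R. Qf v x < 6}. gauss_ratio (Qf v x))) + 8192 * (exp (- 6 * pi))\<^sup>2"
    using Ov.theta_le by (simp only:)
  also have "\<dots> = 1 + exp (- 6 * pi) *
      (real (card W) * gauss_ratio s + (\<Sum>x\<in>{x\<in>R. Qf v x < 6}. gauss_ratio (Qf v x)) + 8192 * exp (- 6 * pi))"
    by (simp add: power2_eq_square algebra_simps)
  finally show ?thesis .
qed

lemma R_card: "card {x\<in>R. Qf v x < 6} \<le> 126"
proof -
  have "card {x\<in>R. Qf v x < 6} \<le> card {x\<in>\<O>. x \<noteq> 0 \<and> Qf v x < 6}"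
    by (rule card_mono[OF finite_subset[OF _ Ov.finite_less_6]]) (auto simp: R_def)
  then show ?thesis using Ov.count_below_6 by simp
qed

text \<open>\<open>R_separation\<close> with \<open>l = 1\<close> and \<open>l = 3\<close>: 7.05 and
  13.49 are three times the cube roots of 13 and 91, rounded down. The second bound is the better
  one for \<open>s\<close> below 3.22.\<close>

lemma R_far: "x \<in> R \<Longrightarrow> Qf v x \<ge> 7.05 - s" "x \<in> R \<Longrightarrow> Qf v x \<ge> 13.49 - 3 * s"
  using R_separation[OF v, of x 1 "2.35"] R_separation[OF v, of x 3 "13.49 / 3"] unfolding s
  by (simp_all add: power2_eq_square power3_eq_cube)

lemma theta_middle:
  assumes "3.002 \<le> s" "s \<le> 3.35"
  shows "infsum (G v) \<O> < infsum (G trivial) \<O>"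
proof -
  let ?e = "exp (- 6 * pi) :: real" and ?w = "real (card W)"
  define s' where "s' = max (7.05 - s) (13.49 - 3 * s)"
  have "(\<Sum>x\<in>{x\<in>R. Qf v x < 6}. gauss_ratio (Qf v x)) \<le> (\<Sum>x\<in>{x\<in>R. Qf v x < 6}. gauss_ratio s')"
    using R_far unfolding s'_def by (intro sum_mono gauss_ratio_mono) auto
  also have "\<dots> \<le> 126 * gauss_ratio s'" using R_card gauss_ratio_pos[of s'] by (simp add: mult_right_mono)
  finally have sum: "(\<Sum>x\<in>{x\<in>R. Qf v x < 6}. gauss_ratio (Qf v x)) \<le> 126 * gauss_ratio s'" .
  have "gauss_ratio s + 63 * gauss_ratio s' + 4096 * ?e < 1" by (rule gauss_ratio_combined[OF assms]) (auto simp: s'_def)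
  then have lt: "126 * gauss_ratio s' + 8192 * ?e < 2 * (1 - gauss_ratio s)" by simp
  \<comment> \<open>The gain grows with the size of \<open>W\<close> and the bound for the losses
    does not, so two elements are the worst case. That \<open>1 - gauss_ratio s\<close> is
    nonnegative is read off from \<open>lt\<close>.\<close>
  moreover have "2 * (1 - gauss_ratio s) \<le> ?w * (1 - gauss_ratio s)"
  proof (rule mult_right_mono)
    have "0 < 126 * gauss_ratio s' + 8192 * ?e" by (intro add_pos_pos mult_pos_pos gauss_ratio_pos) auto
    then have "0 < 2 * (1 - gauss_ratio s)" using lt by (rule less_trans)
    then show "0 \<le> 1 - gauss_ratio s" by simp
  qed (use W_card in simp)
  ultimately have "?w * gauss_ratio s + (\<Sum>x\<in>{x\<in>R. Qf v x < 6}. gauss_ratio (Qf v x)) + 8192 * ?e < ?w"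
    using sum by (simp add: algebra_simps)
  then have "?e * (?w * gauss_ratio s + (\<Sum>x\<in>{x\<in>R. Qf v x < 6}. gauss_ratio (Qf v x)) + 8192 * ?e) < ?e * ?w"
    by (intro mult_strict_left_mono) auto
  then have lt: "?e * (?w * gauss_ratio s + (\<Sum>x\<in>{x\<in>R. Qf v x < 6}. gauss_ratio (Qf v x)) + 8192 * ?e) < ?w * ?e"
    by (simp only: mult.commute)
  have "infsum (G v) \<O> \<le> 1 + ?e * (?w * gauss_ratio s + (\<Sum>x\<in>{x\<in>R. Qf v x < 6}. gauss_ratio (Qf v x)) + 8192 * ?e)"
    by (rule theta_le_R) (use assms in simp)
  also have "\<dots> < 1 + ?w * ?e" by (rule add_strict_left_mono[OF lt])
  also have "\<dots> \<le> infsum (G trivial) \<O>" by (rule theta_trivial_ge)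
  finally show ?thesis .
qed

text \<open>Comparing the coordinates v i * a i x with 0.9 puts the short units into eight cells;
  the quotient of two units in one cell has trace and dual trace adding up to less than 11.\<close>
lemma short_units_card:
  "card {x\<in>R. Nm x = 1 \<and> Qf v x < 3.779} \<le> 8 * card W"
proof -
  define S where "S = {x\<in>R. Nm x = 1 \<and> Qf v x < 3.779}"
  define cell where "cell x = (v 0 * a 0 x < 0.9, v 1 * a 1 x < 0.9, v 2 * a 2 x < 0.9)" for x
  have finS: "finite S"
    by (rule finite_subset[OF _ Ov.finite_less_6]) (auto simp: S_def R_def)
  have coord: "0.3 < v i * a i x \<and> v i * a i x < 2.7" if x: "x \<in> S" "i < 3" for x i
  proof -
    have xF: "x \<in> F" "x \<noteq> 0" using x unfolding S_def R_def by (auto intro: O_F)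
    have p: "v 0 * a 0 x > 0" "v 1 * a 1 x > 0" "v 2 * a 2 x > 0"
      using v by (simp_all only: zero_less_mult_iff a_pos[OF xF]) auto
    have "(v 0 * v 1 * v 2) * Nm x = 1" using x v unfolding S_def by simp
    then have prd: "(v 0 * a 0 x) * (v 1 * a 1 x) * (v 2 * a 2 x) = 1" unfolding Nm_3 by (simp add: mult_ac)
    have sm: "v 0 * a 0 x + v 1 * a 1 x + v 2 * a 2 x < 3.779" using x unfolding S_def Qf_3 by simp
    have "i = 0 \<or> i = 1 \<or> i = 2" using x(2) by auto
    then show ?thesis
      using short_unit_coordinate[OF p prd sm]
        short_unit_coordinate[of "v 1 * a 1 x" "v 2 * a 2 x" "v 0 * a 0 x"]
        short_unit_coordinate[of "v 2 * a 2 x" "v 0 * a 0 x" "v 1 * a 1 x"] p prd sm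
      by (elim disjE) (simp_all only: mult_ac add_ac simp_thms)
  qed
  have fiber: "card {x\<in>S. cell x = b} \<le> card W" for b
  proof (cases "{x\<in>S. cell x = b} = {}")
    case False
    then obtain y where y: "y \<in> S" "cell y = b" by blast
    have "{x\<in>S. cell x = b} \<subseteq> (\<lambda>z. z * y) ` W"
    proof
      fix x assume "x \<in> {x\<in>S. cell x = b}"
      then have x: "x \<in> S" "cell x = cell y" using y by auto
      have O: "x \<in> \<O>" "y \<in> \<O>" "Nm x = 1" "Nm y = 1" "y \<noteq> 0" using x y unfolding S_def R_def by auto
      obtain z where z: "z \<in> \<O>" "x = z * y" "z \<noteq> 0" using unit_quotient[OF O(1-4)] by metis
      have Nz: "Nm z = 1" using Nm_mult[OF O_F[OF z(1)] O_F[OF O(2)]] O z(2) by simp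
      have az: "a i z > 0" for i by (rule a_pos[OF O_F[OF z(1)] z(3)])
      have ay: "a i y > 0" for i by (rule a_pos[OF O_F[OF O(2)] O(5)])
      have ratio: "a i z + 1 / a i z < 10 / 3" if i: "i < 3" for i
      proof (rule ratio_sum_bound)
        have c: "v i * a i x < 0.9 \<longleftrightarrow> v i * a i y < 0.9"
          using x(2) i unfolding cell_def by (auto simp: numeral_3_eq_3 numeral_2_eq_2 less_Suc_eq)
        have e: "v i * a i x = a i z * (v i * a i y)" unfolding z(2)
          using a_mult[OF O_F[OF z(1)] O_F[OF O(2)], of i] by simp
        note cx = coord[OF x(1) i] and cy = coord[OF y(1) i]
        have "v i * a i x < 3 * (v i * a i y)" using c cx cy by linarith
        then have "a i z * (v i * a i y) < 3 * (v i * a i y)" unfolding e .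
        then show "a i z < 3" using cy by (simp only: mult_less_cancel_right) auto
        have "v i * a i y < 3 * (v i * a i x)" using c cx cy by linarith
        then have "1 * (v i * a i y) < (3 * a i z) * (v i * a i y)" unfolding e by simp
        then have "1 < 3 * a i z" using cy by (simp only: mult_less_cancel_right) auto
        then show "1 / 3 < a i z" by simp
      qed
      have "z \<in> W"
      proof (rule ccontr)
        assume "z \<notin> W"
        then have "z \<in> R" using z unfolding R_def by auto
        then have "a 0 z + a 1 z + a 2 z + (a 0 z * a 1 z + a 1 z * a 2 z + a 2 z * a 0 z) \<ge> 11"
          using R_trace(2)[of z] unfolding Qf_3 by simp
        \<comment> \<open>As \<open>z\<close> has norm 1, the reciprocals are the products of pairs,
          so the three sums bounded in \<open>ratio\<close> add up to the first two symmetric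
          functions.\<close>
        moreover have "1 / a 0 z = a 1 z * a 2 z" "1 / a 1 z = a 2 z * a 0 z" "1 / a 2 z = a 0 z * a 1 z"
          using Nz az[of 0] az[of 1] az[of 2] unfolding Nm_3 by (auto simp: field_simps)
        ultimately show False using ratio[of 0] ratio[of 1] ratio[of 2] by simp
      qed
      then show "x \<in> (\<lambda>z. z * y) ` W" using z(2) by blast
    qed
    then have "card {x\<in>S. cell x = b} \<le> card ((\<lambda>z. z * y) ` W)" using W_finite by (intro card_mono) auto
    also have "\<dots> \<le> card W" by (rule card_image_le[OF W_finite])
    finally show ?thesis .
  qed (metis card.empty zero_le)
  have "card S \<le> card (\<Union>b\<in>UNIV. {x\<in>S. cell x = b})" using finS by (intro card_mono) auto
  also have "\<dots> \<le> (\<Sum>b\<in>UNIV. card {x\<in>S. cell x = b})" by (rule card_UN_le) simp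
  also have "\<dots> \<le> (\<Sum>b\<in>(UNIV :: (bool \<times> bool \<times> bool) set). card W)" by (intro sum_mono fiber)
  also have "\<dots> = 8 * card W" by (simp add: card_UNIV_bool flip: UNIV_Times_UNIV)
  finally show ?thesis unfolding S_def .
qed

text \<open>The crude count 126 is affordable from 3.779 on, but not at 3.52, where it would exceed
  the gain for two elements of \<open>W\<close>. Only units can lie below 3.779, and their number is
  at most 8 times the size of \<open>W\<close>, so their loss is a fixed fraction of the
  gain.\<close>

lemma theta_outer:
  assumes "3.35 \<le> s" "s < 3.779"
  shows "infsum (G v) \<O> < infsum (G trivial) \<O>"
proof -
  let ?e = "exp (- 6 * pi) :: real" and ?w = "real (card W)"
  define S where "S = {x\<in>R. Nm x = 1 \<and> Qf v x < 3.779}"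
  define T where "T = {x\<in>R. Qf v x < 6}"
  have fin: "finite T" by (rule finite_subset[OF _ Ov.finite_less_6]) (auto simp: T_def R_def)
  have sub: "S \<subseteq> T" unfolding S_def T_def by auto
  have S: "gauss_ratio (Qf v x) \<le> gauss_ratio 3.52" if "x \<in> S" for x
  proof (rule gauss_ratio_mono)
    have "Qf v x \<ge> s" using units that unfolding S_def R_def by auto
    \<comment> \<open>By minimality of \<open>s\<close> the value is at least both \<open>s\<close>
      and \<open>7.05 - s\<close>, hence at least their mean 3.525.\<close>
    then show "3.52 \<le> Qf v x" using R_far(1)[of x] that unfolding S_def by simp
  qed
  have T: "gauss_ratio (Qf v x) \<le> gauss_ratio 3.779" if "x \<in> T - S" for x
  proof (rule gauss_ratio_mono)
    show "3.779 \<le> Qf v x"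
    proof (cases "Nm x = 1")
      case False
      then have "Nm x \<ge> 2" using Nm_cases[of x] that unfolding T_def R_def by auto
      then show ?thesis using v by (intro large_norm_far) auto
    qed (use that in \<open>auto simp: S_def T_def\<close>)
  qed
  have "(\<Sum>x\<in>T. gauss_ratio (Qf v x)) = (\<Sum>x\<in>S. gauss_ratio (Qf v x)) + (\<Sum>x\<in>T - S. gauss_ratio (Qf v x))"
    using sum.subset_diff[OF sub fin] by (simp add: add.commute)
  also have "\<dots> \<le> (\<Sum>x\<in>S. gauss_ratio 3.52) + (\<Sum>x\<in>T - S. gauss_ratio 3.779)"
    using S T by (intro add_mono sum_mono) auto
  also have "\<dots> \<le> (8 * ?w) * gauss_ratio 3.52 + 126 * gauss_ratio 3.779"
  proof -
    have "card (T - S) \<le> 126" using card_mono[OF fin, of "T - S"] R_card unfolding T_def by auto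
    moreover have "real (card S) \<le> 8 * ?w" using short_units_card unfolding S_def by linarith
    ultimately show ?thesis using gauss_ratio_pos[of "3.52"] gauss_ratio_pos[of "3.779"]
      by (simp only: sum_constant) (intro add_mono mult_right_mono, auto)
  qed
  finally have sum: "(\<Sum>x\<in>T. gauss_ratio (Qf v x)) \<le> (8 * ?w) * gauss_ratio 3.52 + 126 * gauss_ratio 3.779" .
  have "gauss_ratio s \<le> 0.12" using gauss_ratio_mono[OF assms(1)] gauss_ratio_values(6) by simp
  \<comment> \<open>0.44 = 0.12 + 8 * 0.04. The remaining 0.56 per element of \<open>W\<close>
    amounts to at least 1.12, which covers the other vectors and the tail.\<close>
  then have "?w * (gauss_ratio s + 8 * gauss_ratio 3.52) \<le> ?w * 0.44"
    using gauss_ratio_values(7) by (intro mult_left_mono) auto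
  moreover have "126 * gauss_ratio 3.779 + 8192 * ?e < 1.12" using gauss_ratio_values(9) exp_6_pi by simp
  moreover have "?w \<ge> 2" using W_card by simp
  ultimately have "?w * gauss_ratio s + (\<Sum>x\<in>T. gauss_ratio (Qf v x)) + 8192 * ?e < ?w"
    using sum by (simp add: algebra_simps)
  then have "?e * (?w * gauss_ratio s + (\<Sum>x\<in>T. gauss_ratio (Qf v x)) + 8192 * ?e) < ?e * ?w"
    by (intro mult_strict_left_mono) auto
  then have lt: "?e * (?w * gauss_ratio s + (\<Sum>x\<in>T. gauss_ratio (Qf v x)) + 8192 * ?e) < ?w * ?e"
    by (simp only: mult.commute)
  have "infsum (G v) \<O> \<le> 1 + ?e * (?w * gauss_ratio s + (\<Sum>x\<in>T. gauss_ratio (Qf v x)) + 8192 * ?e)"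
    by (rule theta_le_R[folded T_def]) (use assms in simp)
  also have "\<dots> < 1 + ?w * ?e" by (rule add_strict_left_mono[OF lt])
  also have "\<dots> \<le> infsum (G trivial) \<O>" by (rule theta_trivial_ge)
  finally show ?thesis .
qed

lemma theta_far:
  assumes "3.779 \<le> s"
  shows "infsum (G v) \<O> < infsum (G trivial) \<O>"
proof -
  have "infsum (G v) \<O> < 1 + 2 * exp (- 6 * pi)"
  proof (rule Ov.theta_bound_far)
    fix x assume x: "x \<in> \<O>" "x \<noteq> 0"
    show "Qf v x \<ge> 3.779"
    proof (cases "Nm x = 1")
      case True
      then show ?thesis using units[OF x(1)] assms by simp
    next
      case False
      then show ?thesis using Nm_cases[OF x] v by (intro large_norm_far) auto
    qed
  qed
  also have "\<dots> \<le> 1 + real (card W) * exp (- 6 * pi)" using W_card by (intro add_left_mono mult_right_mono) auto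
  finally show ?thesis using theta_trivial_ge by simp
qed

end

end

section \<open>Units near the trivial class\<close>

text \<open>14/15 is the part of the exponent left after 1/15 is spent on a Taylor remainder, and 5
  * 14/15 = 3 + 5/3 compares the trace 5 of a vector in \<open>R\<close> with the minimum 3.\<close>

lemma exp_values:
  "exp (- 2 * pi * (5 / 3)) \<le> 1 / 20000" "exp (- 2 * pi * (14 / 15)) \<le> 1 / 250"
  by (rule exp_neg_two_pi_le[of _ "117700 / 100000" "138532 / 100000" "191911 / 100000" "368298 / 100000"
        "135643 / 10000" "183990 / 1000" "338523 / 10"]; simp add: power2_eq_square)
     (rule exp_neg_two_pi_le[of _ "109582 / 100000" "120082 / 100000" "144196 / 100000" "207924 / 100000"
        "432323 / 100000" "186903 / 10000" "349327 / 1000"]; simp add: power2_eq_square)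

text \<open>With equality at n = 6, this absorbs the factor n^2 of the weight \<open>H\<close> into
  a doubled base of the geometric decay.\<close>

lemma square_le_power2: "6 \<le> n \<Longrightarrow> 16 * n\<^sup>2 \<le> 9 * 2 ^ n" for n :: nat
proof (induction n rule: dec_induct)
  case (step n)
  have "6 * n \<le> n * n" using step by (intro mult_right_mono) auto
  moreover have "16 * (Suc n)\<^sup>2 = 16 * (n * n) + 32 * n + 16" by (simp add: power2_eq_square)
  ultimately have "16 * (Suc n)\<^sup>2 \<le> 2 * (16 * n\<^sup>2)" using step(1) unfolding power2_eq_square by linarith
  then show ?case using step by simp
qed simp

context cyclic_sextic
begin

interpretation O1: lattice6 \<O> "Qf trivial" by (rule lattice6_O) auto

lemma a_conjugate: "a i (t j x) = a (i + j) x"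
  by (simp add: t_plus)

text \<open>Applying \<open>\<tau>\<close> shifts the \<open>a i x\<close> cyclically because
  \<open>t 3\<close> preserves the modulus. Summed over the three conjugates, \<open>v\<close>
  enters only through the sum of its entries.\<close>

lemma conjugate_sums:
  assumes "x \<in> F" 
  shows "Qf v (t 0 x) + Qf v (t 1 x) + Qf v (t 2 x) = (v 0 + v 1 + v 2) * Qf trivial x"
    and "j < 3 \<Longrightarrow> Qf trivial (t j x) = Qf trivial x"
proof -
  have a3: "a 3 x = a 0 x" by (rule a_3[OF assms])
  have a4: "a 4 x = a 1 x" using a_3[OF t_F[OF assms, of 1]] a_conjugate[of 3 1 x] a_conjugate[of 0 1 x] by simp
  have idx: "(0::nat) + 0 = 0" "(0::nat) + 1 = 1" "(0::nat) + 2 = 2" "(1::nat) + 0 = 1" "(1::nat) + 1 = 2"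
    "(1::nat) + 2 = 3" "(2::nat) + 0 = 2" "(2::nat) + 1 = 3" "(2::nat) + 2 = 4" by simp_all
  define A B C where "A = a 0 x" and "B = a 1 x" and "C = a 2 x"
  show "Qf v (t 0 x) + Qf v (t 1 x) + Qf v (t 2 x) = (v 0 + v 1 + v 2) * Qf trivial x"
    unfolding Qf_3 a_conjugate idx a3 a4 A_def[symmetric] B_def[symmetric] C_def[symmetric]
    by (simp add: algebra_simps)
  assume "j < 3"
  then have "j = 0 \<or> j = 1 \<or> j = 2" by auto
  then show "Qf trivial (t j x) = Qf trivial x"
    unfolding Qf_3 a_conjugate
    by (elim disjE; simp only: idx a3 a4; simp only: A_def[symmetric] B_def[symmetric] C_def[symmetric]; simp)
qed

lemma W_iff: "x \<in> \<O> \<Longrightarrow> x \<noteq> 0 \<Longrightarrow> x \<in> W \<longleftrightarrow> Qf trivial x = 3"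
  using conjugate_trace(2)[of x] unfolding W_def Qf_3 by auto

lemma t_bij_R: 
  assumes j: "j < 3" shows "bij_betw (t j) R R"
proof (rule bij_betw_imageI)
  show "inj_on (t j) R" by (rule inj_on_subset[OF t_inj]) (auto simp: R_def O_F)
  have closed: "t k x \<in> R" if x: "x \<in> R" and k: "Qf trivial (t k x) = Qf trivial x" for k x
  proof -
    have "x \<in> \<O>" "x \<noteq> 0" using x unfolding R_def by auto
    moreover from this have "t k x \<in> \<O>" "t k x \<noteq> 0" using t_O t_eq_0 O_F by auto
    ultimately show ?thesis using x k W_iff unfolding R_def by simp
  qed
  show "t j ` R = R"
  proof
    show "t j ` R \<subseteq> R" using closed conjugate_sums(2) j by (auto simp: R_def O_F)
    show "R \<subseteq> t j ` R"
    proof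
      fix x assume x: "x \<in> R"
      then have xF: "x \<in> F" unfolding R_def by (auto intro: O_F)
      define y where "y = t (6 - j) x"
      have ty: "t j y = x" unfolding y_def t_plus[symmetric] using j t_6[OF xF] by simp
      have "Qf trivial y = Qf trivial x" using conjugate_sums(2)[OF t_F[OF xF], of j "6 - j"] j ty y_def by simp
      then have "y \<in> R" unfolding y_def by (intro closed x)
      then show "x \<in> t j ` R" using ty by blast
    qed
  qed
qed

text \<open>The shape of the second-order Taylor remainder: a squared trace, and a Gaussian whose
  exponent has been lowered by 1/15 to pay for the remainder factor.\<close>

abbreviation "H x \<equiv> (Qf trivial x)\<^sup>2 * exp (- 2 * pi * (14 / 15) * Qf trivial x)"

text \<open>Traces on \<open>R\<close> are natural numbers of at least 5, so below 6 only the value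
  5 occurs, for at most 126 vectors; the rest is a tail with base \<open>2 * r\<close>. The constant
  collects 126 * 25 = 3150 and 294912 / 250 < 1180.\<close>

lemma H_sum:
  "H summable_on R" "infsum H R \<le> 4330 * exp (- 2 * pi * (14 / 15)) ^ 5"
proof -
  define r where "r = exp (- 2 * pi * (14 / 15))"
  have r: "0 < r" "r \<le> 1 / 250" unfolding r_def using exp_values(2) by auto
  have H_nat: "H x = (real n)\<^sup>2 * r ^ n" if "Qf trivial x = real n" for x n
    unfolding that r_def exp_of_nat_mult[symmetric] by (simp add: mult.commute)
  have far: "{x\<in>\<O>. Qf trivial x \<ge> 6} = {x\<in>R. Qf trivial x \<ge> 6}"
    unfolding R_def by (auto simp: Qf_W O1.Q_0)
  have decay: "H x \<le> 36 / 64 * (2 * r) ^ nat \<lfloor>Qf trivial x\<rfloor>" if "x \<in> \<O>" "6 \<le> Qf trivial x" for x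
  proof -
    have "x \<in> R" using far that by blast
    then obtain n :: nat where n: "Qf trivial x = real n" using R_trace(3) by blast
    then have "6 \<le> n" using that(2) by simp
    then have "real (16 * n\<^sup>2) \<le> real (9 * 2 ^ n)" using square_le_power2 of_nat_le_iff by blast
    then have "(real n)\<^sup>2 * r ^ n \<le> (36 / 64 * 2 ^ n) * r ^ n" using r by (intro mult_right_mono) auto
    then show ?thesis unfolding H_nat[OF n] unfolding n by (simp add: power_mult_distrib)
  qed
  have tail: "H summable_on {x\<in>\<O>. Qf trivial x \<ge> 6}"
    "infsum H {x\<in>\<O>. Qf trivial x \<ge> 6} \<le> 8192 * (36 / 64) * (2 * r) ^ 6"
    by (rule O1.tail_bound[of H "36 / 64" "2 * r", OF _ decay]; use r in simp)+
  have fin: "finite {x\<in>R. Qf trivial x < 6}"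
    by (rule finite_subset[OF _ O1.finite_less_6]) (auto simp: R_def)
  have R: "R = {x\<in>R. Qf trivial x < 6} \<union> {x\<in>R. Qf trivial x \<ge> 6}" by auto
  show "H summable_on R"
    by (subst R, rule summable_on_Un_disjoint[OF summable_on_finite[OF fin] tail(1)[unfolded far]]) auto
  have "infsum H R = infsum H {x\<in>R. Qf trivial x < 6} + infsum H {x\<in>R. Qf trivial x \<ge> 6}"
    by (subst R, rule infsum_Un_disjoint[OF summable_on_finite[OF fin] tail(1)[unfolded far]]) auto
  also have "infsum H {x\<in>R. Qf trivial x < 6} = (\<Sum>x\<in>{x\<in>R. Qf trivial x < 6}. 25 * r ^ 5)"
    unfolding infsum_finite[OF fin]
  proof (rule sum.cong[OF refl])
    fix x assume x: "x \<in> {x\<in>R. Qf trivial x < 6}"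
    then obtain n :: nat where n: "Qf trivial x = real n" using R_trace(3) by blast
    then have "n = 5" using R_trace(1)[of x] x by simp
    then show "H x = 25 * r ^ 5" using H_nat[OF n] by simp
  qed
  also have "\<dots> \<le> 126 * (25 * r ^ 5)"
  proof -
    have "card {x\<in>R. Qf trivial x < 6} \<le> card {x\<in>\<O>. x \<noteq> 0 \<and> Qf trivial x < 6}"
      by (rule card_mono[OF finite_subset[OF _ O1.finite_less_6]]) (auto simp: R_def)
    then have "card {x\<in>R. Qf trivial x < 6} \<le> 126" using O1.count_below_6 by simp
    then show ?thesis using r by (simp add: mult_right_mono)
  qed
  finally have "infsum H R \<le> 126 * (25 * r ^ 5) + 8192 * (36 / 64) * (2 * r) ^ 6"
    using tail(2) unfolding far by simp
  also have "\<dots> = r ^ 5 * (3150 + 294912 * r)"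
    by (simp add: power_mult_distrib eval_nat_numeral algebra_simps)
  also have "\<dots> \<le> r ^ 5 * 4330" using r by (intro mult_left_mono) auto
  finally show "infsum H R \<le> 4330 * exp (- 2 * pi * (14 / 15)) ^ 5" unfolding r_def by (simp add: mult.commute)
qed

lemma theta_eq:
  assumes v: "v 0 > 0" "v 1 > 0" "v 2 > 0" "v 0 * v 1 * v 2 = 1"
  shows "infsum (G v) \<O> = 1 + real (card W) * exp (- 2 * pi * (v 0 + v 1 + v 2)) + infsum (G v) R"
    and "G v summable_on R"
proof -
  interpret Ov: lattice6 \<O> "Qf v" by (rule lattice6_O) (rule v)+
  show R: "G v summable_on R"
    by (rule summable_on_subset_banach[OF Ov.gauss_summable]) (auto simp: R_def)
  have "\<O> = insert 0 W \<union> R" using O_split(1) by auto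
  then have "infsum (G v) \<O> = infsum (G v) (insert 0 W \<union> R)" by simp
  also have "\<dots> = infsum (G v) (insert 0 W) + infsum (G v) R"
    using O_split(2,3) W_finite by (intro infsum_Un_disjoint summable_on_finite R) auto
  also have "infsum (G v) (insert 0 W) = (\<Sum>x\<in>insert 0 W. G v x)" using W_finite by (intro infsum_finite) auto
  also have "\<dots> = G v 0 + (\<Sum>x\<in>W. G v x)" using W_finite O_split(2) by (intro sum.insert) auto
  also have "(\<Sum>x\<in>W. G v x) = (\<Sum>x\<in>W. exp (- 2 * pi * (v 0 + v 1 + v 2)))"
    by (rule sum.cong[OF refl]) (simp only: Qf_W)
  finally show "infsum (G v) \<O> = 1 + real (card W) * exp (- 2 * pi * (v 0 + v 1 + v 2)) + infsum (G v) R"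
    by (simp add: Ov.Q_0)
qed

text \<open>Averaging over the conjugates of x turns the first order term in v - 1 into a
  nonpositive one.\<close>
lemma conjugate_average:
  assumes v: "v 0 > 0" "v 1 > 0" "v 2 > 0" "v 0 * v 1 * v 2 = 1"
    and s: "v 0 + v 1 + v 2 \<le> 3.002" and x: "x \<in> F"
  shows "G v (t 0 x) + G v (t 1 x) + G v (t 2 x)
    \<le> 3 * G trivial x + 3 * (3 * pi\<^sup>2 * (v 0 + v 1 + v 2 - 3)) * H x"
proof -
  define \<eta> where "\<eta> = v 0 + v 1 + v 2 - 3"
  define A where "A = Qf trivial x"
  have A0: "A \<ge> 0" unfolding A_def Qf_3 by simp
  have \<eta>: "0 \<le> \<eta>" "\<eta> \<le> 0.002" unfolding \<eta>_def using sum_eq_3_imp_1(1)[OF v] s by auto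
  have dev: "(v i - 1)\<^sup>2 \<le> 1.5 * \<eta>" if "i < 3" for i
  proof -
    have "i = 0 \<or> i = 1 \<or> i = 2" using that by auto
    then show ?thesis
      using deviation_bound[of "v 0" "v 1" "v 2"] deviation_bound[of "v 1" "v 2" "v 0"]
        deviation_bound[of "v 2" "v 0" "v 1"] v s unfolding \<eta>_def
      by (elim disjE) (simp_all add: mult_ac add_ac)
  qed
  \<comment> \<open>\<open>\<delta>\<close> bounds every \<open>\<bar>v i - 1\<bar>\<close>. The
    limit 3.002 keeps it below 1/15, so the remainder factor \<open>exp \<bar>z j\<bar>\<close> uses
    up at most 1/15 of the decay.\<close>
  define \<delta> where "\<delta> = sqrt (1.5 * \<eta>)"
  have \<delta>: "0 \<le> \<delta>" "\<delta>\<^sup>2 = 1.5 * \<eta>" unfolding \<delta>_def using \<eta> by auto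
  have "\<delta>\<^sup>2 \<le> (1 / 15)\<^sup>2" unfolding \<delta>(2) using \<eta> by (simp add: power2_eq_square)
  then have \<delta>15: "\<delta> \<le> 1 / 15" by (rule power2_le_imp_le) simp
  have dev': "\<bar>v i - 1\<bar> \<le> \<delta>" if "i < 3" for i
    using dev[OF that] \<delta> by (intro power2_le_imp_le[of "\<bar>v i - 1\<bar>"]) auto
  define z where "z j = 2 * pi * (Qf v (t j x) - A)" for j
  have bound: "G v (t j x) \<le> exp (- 2 * pi * A) * (1 - z j) + 3 * pi\<^sup>2 * \<eta> * H x" if j: "j < 3" for j
  proof -
    have A: "A = (\<Sum>i<3. a i (t j x))"
      using conjugate_sums(2)[OF x j] unfolding A_def Qf_def by simp
    have "Qf v (t j x) - A = (\<Sum>i<3. (v i - 1) * a i (t j x))"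
      unfolding A Qf_def by (simp only: left_diff_distrib sum_subtractf mult_1)
    also have "\<bar>\<dots>\<bar> \<le> (\<Sum>i<3. \<delta> * a i (t j x))"
    proof (rule order_trans[OF sum_abs sum_mono])
      fix i :: nat assume "i \<in> {..<3}"
      then show "\<bar>(v i - 1) * a i (t j x)\<bar> \<le> \<delta> * a i (t j x)"
        unfolding abs_mult using dev'[of i] by (intro mult_mono) auto
    qed
    also have "\<dots> = \<delta> * A" unfolding A by (simp only: sum_distrib_left)
    finally have "2 * pi * \<bar>Qf v (t j x) - A\<bar> \<le> 2 * pi * (\<delta> * A)" by (intro mult_left_mono) auto
    then have zd: "\<bar>z j\<bar> \<le> 2 * pi * \<delta> * A" unfolding z_def abs_mult by simp
    then have "\<bar>z j\<bar>\<^sup>2 \<le> (2 * pi * \<delta> * A)\<^sup>2" by (intro power_mono) auto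
    also have "\<dots> = 6 * pi\<^sup>2 * \<eta> * A\<^sup>2" unfolding power_mult_distrib \<delta>(2) by simp
    finally have z2: "(z j)\<^sup>2 / 2 \<le> 3 * pi\<^sup>2 * \<eta> * A\<^sup>2" by simp
    have "2 * pi * A * \<delta> \<le> 2 * pi * A * (1 / 15)" using \<delta>15 A0 by (intro mult_left_mono) auto
    then have ez: "exp \<bar>z j\<bar> \<le> exp (2 * pi * (1 / 15) * A)" using zd by (simp add: mult_ac)
    have "exp (- z j) \<le> 1 + (- z j) + (- z j)\<^sup>2 / 2 * exp \<bar>- z j\<bar>" by (rule exp_le_quadratic)
    also have "(- z j)\<^sup>2 / 2 * exp \<bar>- z j\<bar> \<le> (3 * pi\<^sup>2 * \<eta> * A\<^sup>2) * exp (2 * pi * (1 / 15) * A)"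
      using z2 ez \<eta> by (intro mult_mono) auto
    finally have "exp (- z j) \<le> 1 - z j + 3 * pi\<^sup>2 * \<eta> * A\<^sup>2 * exp (2 * pi * (1 / 15) * A)" by simp
    then have "exp (- 2 * pi * A) * exp (- z j)
        \<le> exp (- 2 * pi * A) * (1 - z j + 3 * pi\<^sup>2 * \<eta> * A\<^sup>2 * exp (2 * pi * (1 / 15) * A))"
      by (intro mult_left_mono) auto
    also have "\<dots> = exp (- 2 * pi * A) * (1 - z j)
        + 3 * pi\<^sup>2 * \<eta> * (A\<^sup>2 * (exp (- 2 * pi * A) * exp (2 * pi * (1 / 15) * A)))"
      by (simp add: algebra_simps)
    also have "exp (- 2 * pi * A) * exp (2 * pi * (1 / 15) * A) = exp (- 2 * pi * (14 / 15) * A)"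
      unfolding exp_add[symmetric] by (rule arg_cong[of _ _ exp]) (simp add: field_simps)
    also have "exp (- 2 * pi * A) * exp (- z j) = G v (t j x)"
      unfolding exp_add[symmetric] z_def by (rule arg_cong[of _ _ exp]) (simp add: algebra_simps)
    finally show ?thesis unfolding A_def .
  qed
  have "z 0 + z 1 + z 2 = 2 * pi * ((Qf v (t 0 x) + Qf v (t 1 x) + Qf v (t 2 x)) - 3 * A)"
    unfolding z_def by (simp add: algebra_simps del: funpow.simps)
  also have "\<dots> = 2 * pi * (\<eta> * A)"
    unfolding conjugate_sums(1)[OF x] \<eta>_def A_def by (simp add: algebra_simps)
  \<comment> \<open>The first-order terms add up to \<open>2 * pi * \<eta> * A\<close>, and
    \<open>\<eta> \<ge> 0\<close> by the arithmetic-geometric mean inequality.\<close>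
  finally have "0 \<le> z 0 + z 1 + z 2" using \<eta> A0 by simp
  then have "0 \<le> exp (- 2 * pi * A) * (z 0 + z 1 + z 2)" by (intro mult_nonneg_nonneg) auto
  moreover have "G v (t 0 x) + G v (t 1 x) + G v (t 2 x) \<le> (exp (- 2 * pi * A) * (1 - z 0) + 3 * pi\<^sup>2 * \<eta> * H x)
      + (exp (- 2 * pi * A) * (1 - z 1) + 3 * pi\<^sup>2 * \<eta> * H x) + (exp (- 2 * pi * A) * (1 - z 2) + 3 * pi\<^sup>2 * \<eta> * H x)"
    by (intro add_mono bound) auto
  moreover have "\<dots> = 3 * exp (- 2 * pi * A) + 3 * (3 * pi\<^sup>2 * \<eta>) * H x - exp (- 2 * pi * A) * (z 0 + z 1 + z 2)"
    by (simp add: algebra_simps del: funpow.simps)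
  ultimately show ?thesis unfolding \<eta>_def A_def by linarith
qed

text \<open>Gain and loss are both linear in \<open>\<eta> = s - 3\<close>: reindexing the sum over
  \<open>R\<close> by the three conjugations cancels the first-order variation up to a favourable
  sign, and the second-order one is controlled by \<open>H\<close>.\<close>

lemma theta_local:
  assumes v: "v 0 > 0" "v 1 > 0" "v 2 > 0" "v 0 * v 1 * v 2 = 1"
    and s: "s = v 0 + v 1 + v 2" "3 < s" "s \<le> 3.002"
  shows "infsum (G v) \<O> < infsum (G trivial) \<O>"
proof -
  define \<eta> where "\<eta> = s - 3"
  have \<eta>: "0 < \<eta>" "\<eta> \<le> 0.002" unfolding \<eta>_def using s by auto
  define K where "K = 3 * pi\<^sup>2 * \<eta>"
  note Rv = theta_eq(2)[OF v]
  have R1: "G trivial summable_on R" by (rule theta_eq(2)) auto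
  have conj: "(\<lambda>x. G v (t j x)) summable_on R" "infsum (\<lambda>x. G v (t j x)) R = infsum (G v) R" if "j < 3" for j
    using summable_on_reindex_bij_betw[OF t_bij_R[OF that], of "G v"] Rv
      infsum_reindex_bij_betw[OF t_bij_R[OF that], of "G v"] by auto
  have conj3: "(\<lambda>x. G v (t 0 x)) summable_on R" "(\<lambda>x. G v (t 1 x)) summable_on R"
    "(\<lambda>x. G v (t 2 x)) summable_on R"
    by (rule conj(1), simp)+
  have "3 * infsum (G v) R = infsum (\<lambda>x. G v (t 0 x)) R + infsum (\<lambda>x. G v (t 1 x)) R + infsum (\<lambda>x. G v (t 2 x)) R"
    using conj(2)[of 0] conj(2)[of 1] conj(2)[of 2] by (simp del: funpow.simps)
  also have "\<dots> = infsum (\<lambda>x. G v (t 0 x) + G v (t 1 x)) R + infsum (\<lambda>x. G v (t 2 x)) R"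
    by (simp only: infsum_add[OF conj3(1,2)])
  also have "\<dots> = infsum (\<lambda>x. G v (t 0 x) + G v (t 1 x) + G v (t 2 x)) R"
    by (rule infsum_add[symmetric, OF summable_on_add[OF conj3(1,2)] conj3(3)])
  also have "\<dots> \<le> infsum (\<lambda>x. 3 * G trivial x + 3 * K * H x) R"
  proof (rule infsum_mono)
    show "(\<lambda>x. G v (t 0 x) + G v (t 1 x) + G v (t 2 x)) summable_on R"
      by (intro summable_on_add conj3)
    show "(\<lambda>x. 3 * G trivial x + 3 * K * H x) summable_on R"
      by (intro summable_on_add summable_on_cmult_right R1 H_sum(1))
    fix x assume "x \<in> R"
    then have "x \<in> F" unfolding R_def by (auto intro: O_F)
    then show "G v (t 0 x) + G v (t 1 x) + G v (t 2 x) \<le> 3 * G trivial x + 3 * K * H x"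
      using conjugate_average[OF v] s unfolding K_def \<eta>_def by blast
  qed
  also have "\<dots> = infsum (\<lambda>x. 3 * G trivial x) R + infsum (\<lambda>x. 3 * K * H x) R"
    by (intro infsum_add summable_on_cmult_right R1 H_sum(1))
  also have "\<dots> = 3 * infsum (G trivial) R + 3 * K * infsum H R"
    by (simp only: infsum_cmult_right'[of 3 "G trivial"] infsum_cmult_right'[of "3 * K" H])
  finally have le: "infsum (G v) R \<le> infsum (G trivial) R + K * infsum H R" by simp
  define e where "e = exp (- 6 * pi)"
  define r where "r = exp (- 2 * pi * (14 / 15)) ^ 5"
  have e0: "e > 0" unfolding e_def by simp
  have pi2: "pi\<^sup>2 \<le> 10"
    using power_mono[of pi "3.15" 2] pi_approx by (simp add: power2_eq_square)
  have r: "r \<le> e / 20000"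
  proof -
    have "r = e * exp (- 2 * pi * (5 / 3))"
      unfolding r_def e_def exp_of_nat_mult[symmetric] exp_add[symmetric]
      by (rule arg_cong[of _ _ exp]) (simp add: field_simps)
    also have "\<dots> \<le> e * (1 / 20000)" using e0 exp_values(1) by (intro mult_left_mono) auto
    finally show ?thesis by simp
  qed
  have "K \<le> 30 * \<eta>" unfolding K_def using pi2 \<eta> by (intro mult_right_mono) auto
  moreover have "K \<ge> 0" unfolding K_def using \<eta> by simp
  moreover have "infsum H R \<le> 4330 * r" using H_sum(2) unfolding r_def .
  ultimately have "K * infsum H R \<le> 30 * \<eta> * (4330 * r)"
    using \<eta> unfolding r_def by (intro order_trans[OF mult_left_mono mult_right_mono]) auto
  also have "\<dots> \<le> 30 * \<eta> * (4330 * (e / 20000))" using r \<eta> by (intro mult_left_mono) auto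
  \<comment> \<open>The loss is at most 30 * 4330 / 20000 = 6.495 times \<open>e * \<eta>\<close>,
    against a gain of at least 8 times.\<close>
  also have "\<dots> < 2 * (e * (4 * \<eta>))" using e0 \<eta> by simp
  also have "\<dots> \<le> real (card W) * (e * (1 - gauss_ratio s))"
  proof (intro mult_mono)
    define y where "y = 2 * pi * \<eta>"
    have "6 * \<eta> \<le> y" "y \<le> 8 * \<eta>" unfolding y_def using pi_gt3 pi_less_4 \<eta> by auto
    then have y: "6 * \<eta> \<le> y" "0 < y" "y \<le> 1 / 10" using \<eta> by auto
    have "gauss_ratio s = exp (- y)" unfolding gauss_ratio_def y_def \<eta>_def by simp
    also have "\<dots> \<le> 1 / (1 + y)"
      unfolding exp_minus using y exp_ge_add_one_self[of y] by (simp add: field_simps)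
    finally have "1 - gauss_ratio s \<ge> y / (1 + y)" using y by (simp add: field_simps)
    moreover have "y / (1 + y) \<ge> 4 * \<eta>"
    proof -
      have "4 * \<eta> * (1 + y) \<le> 4 * \<eta> * (11 / 10)" using y \<eta> by (intro mult_left_mono) auto
      also have "\<dots> \<le> y" using y \<eta> by simp
      finally have "4 * \<eta> * (1 + y) \<le> y" .
      then show ?thesis using y by (simp add: pos_le_divide_eq)
    qed
    ultimately show "4 * \<eta> \<le> 1 - gauss_ratio s" by simp
  qed (use W_card e0 \<eta> in auto)
  finally have lt: "K * infsum H R < real (card W) * (e * (1 - gauss_ratio s))" .
  have "infsum (G v) \<O> = 1 + real (card W) * (e * gauss_ratio s) + infsum (G v) R"
    using theta_eq(1)[OF v] unfolding s(1)[symmetric] exp_eq_gauss_ratio[of s] e_def .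
  also have "\<dots> \<le> 1 + real (card W) * (e * gauss_ratio s) + infsum (G trivial) R + K * infsum H R" using le by simp
  also have "\<dots> < 1 + real (card W) * (e * gauss_ratio s) + infsum (G trivial) R + real (card W) * (e * (1 - gauss_ratio s))"
    using lt by simp
  also have "\<dots> = 1 + real (card W) * e + infsum (G trivial) R" by (simp add: algebra_simps)
  also have "\<dots> = infsum (G trivial) \<O>"
    using theta_eq(1)[of trivial] unfolding e_def by simp
  finally show ?thesis .
qed

lemma theta_principal:
  assumes v: "v 0 > 0" "v 1 > 0" "v 2 > 0" "v 0 * v 1 * v 2 = 1"
    and s: "3 < v 0 + v 1 + v 2"
    and units: "\<And>x. x \<in> \<O> \<Longrightarrow> Nm x = 1 \<Longrightarrow> Qf v x \<ge> v 0 + v 1 + v 2"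
  shows "infsum (G v) \<O> < infsum (G trivial) \<O>"
proof -
  consider "v 0 + v 1 + v 2 \<le> 3.002" | "3.002 \<le> v 0 + v 1 + v 2" "v 0 + v 1 + v 2 \<le> 3.35"
    | "3.35 \<le> v 0 + v 1 + v 2" "v 0 + v 1 + v 2 < 3.779" | "3.779 \<le> v 0 + v 1 + v 2"
    by linarith
  then show ?thesis
  proof cases
    case 1 then show ?thesis by (rule theta_local[OF v refl s])
  next
    case 2 then show ?thesis by (intro theta_middle[OF v refl] units)
  next
    case 3 then show ?thesis by (intro theta_outer[OF v refl] units)
  next
    case 4 then show ?thesis by (intro theta_far[OF v refl] units)
  qed
qed

section \<open>Divisors of degree 0\<close>

lemma arak_norm_sq_Qf: "arak_norm_sq \<tau> u x = 2 * Qf (\<lambda>i. (u i)\<^sup>2) x"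
  unfolding arak_norm_sq_def Qf_def ..

lemma k0_eq: "k0 \<tau> I u = infsum (G (\<lambda>i. (u i)\<^sup>2)) I"
  unfolding k0_def arak_norm_sq_Qf by (rule infsum_cong) simp

text \<open>The first claim provides the positivity under which \<open>ln\<close> is strictly
  monotone. For the second, \<open>T\<close> consists of the generators of \<open>I\<close>. If it
  is empty, every nonzero vector has index at least 2 and is far; otherwise the shortest generator
  reduces the divisor to one with ideal O.\<close>

lemma k0_less:
  assumes I: "fractional_ideal F I" and u: "\<forall>i<3. u i > 0"
    and deg: "arak_degree F I u = 0" and np: "\<not> principal_divisor F \<tau> I u"
  shows "1 \<le> k0 \<tau> I u" "k0 \<tau> I u < k0 \<tau> \<O> (\<lambda>_. 1)"
proof -
  define v where "v i = (u i)\<^sup>2" for i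
  have v: "v 0 > 0" "v 1 > 0" "v 2 > 0" unfolding v_def using u[rule_format, of 0] u[rule_format, of 1] u[rule_format, of 2] by auto
  have vfun: "v = (\<lambda>i. (u i)\<^sup>2)" unfolding v_def ..
  have vprod: "v 0 * v 1 * v 2 = u_norm u" unfolding u_norm_def v_def by (rule prod_lessThan_3[symmetric])
  define idx where "idx x = add_index I (scaled x \<O>)" for x
  obtain f1 where f1: "f1 \<in> I" "f1 \<noteq> 0" by (rule ideal_nonzero[OF I])
  have "u_norm u > 0" unfolding vprod[symmetric] using v by simp
  \<comment> \<open>Degree 0 yields the value 1 only once the argument of \<open>ln\<close> is known
    to be positive.\<close>
  then have "u_norm u * ideal_norm F I > 0" using Nm_ideal_element(3)[OF I f1] by simp
  then have deg1: "u_norm u * ideal_norm F I = 1" using deg unfolding arak_degree_def by simp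
  have idx: "v 0 * v 1 * v 2 * Nm x = real (idx x)" "idx x > 0" if "x \<in> I" "x \<noteq> 0" for x
  proof -
    have "v 0 * v 1 * v 2 * Nm x = real (idx x) * (u_norm u * ideal_norm F I)"
      unfolding Nm_ideal_element(1)[OF I that] vprod idx_def by simp
    then show "v 0 * v 1 * v 2 * Nm x = real (idx x)" unfolding deg1 by simp
    show "idx x > 0" unfolding idx_def by (rule Nm_ideal_element(2)[OF I that])
  qed
  have "lattice6 I (Qf v)"
  proof (rule lattice6_Qf)
    show "I \<subseteq> F" using ideal_F[OF I] by blast
    show "1 \<le> v 0 * v 1 * v 2 * Nm x" if "x \<in> I" "x \<noteq> 0" for x
      using idx[OF that] by simp
  qed (use v ideal_subgroup[OF I] index_ideal[OF I] in auto)
  then interpret I: lattice6 I "Qf v" .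
  have k0I: "k0 \<tau> I u = infsum (G v) I" unfolding k0_eq vfun ..
  have k0O: "k0 \<tau> \<O> (\<lambda>_. 1) = infsum (G trivial) \<O>" unfolding k0_eq by simp
  have "(\<Sum>x\<in>{0}. G v x) \<le> infsum (G v) I"
    using I.L(1) by (intro finite_sum_le_infsum I.gauss_summable) auto
  then show "1 \<le> k0 \<tau> I u" unfolding k0I by (simp add: I.Q_0)
  define T where "T = {x\<in>I. x \<noteq> 0 \<and> idx x = 1}"
  show "k0 \<tau> I u < k0 \<tau> \<O> (\<lambda>_. 1)"
  proof (cases "T = {}")
    case True
    have "infsum (G v) I < 1 + 2 * exp (- 6 * pi)"
    proof (rule I.theta_bound_far)
      fix x assume x: "x \<in> I" "x \<noteq> 0"
      then have "idx x \<noteq> 1" using True unfolding T_def by auto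
      then have "idx x \<ge> 2" using idx(2)[OF x] by simp
      then show "Qf v x \<ge> 3.779" using idx(1)[OF x] v by (intro large_norm_far) auto
    qed
    also have "\<dots> \<le> 1 + real (card W) * exp (- 6 * pi)" using W_card by (intro add_left_mono mult_right_mono) auto
    finally show ?thesis unfolding k0I k0O using theta_trivial_ge by simp
  next
    case False
    then obtain f1 where f1: "f1 \<in> T" by blast
    obtain m :: nat where m: "Qf v f1 < real m" using reals_Archimedean2 by blast
    have m0: "m > 0" using m I.Q_nonneg[of f1] f1 unfolding T_def by (cases m) auto
    have "finite {x\<in>I. Qf v x < real m}"
    proof (rule I.count_short(1))
      show "real m \<le> 3 * (real (2 * m))\<^sup>2 / 4"
        using m0 by (simp add: power2_eq_square)
    qed (use m0 in simp)
    then have fin: "finite {x\<in>T. Qf v x < real m}" by (rule finite_subset[rotated]) (auto simp: T_def)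
    \<comment> \<open>\<open>T\<close> may be infinite, but only finitely many of its elements have
      \<open>Q\<close> below \<open>m\<close>, and \<open>f1\<close> is one of them.\<close>
    obtain f where f: "f \<in> T" "\<And>x. x \<in> T \<Longrightarrow> Qf v f \<le> Qf v x"
    proof -
      have ne: "{x\<in>T. Qf v x < real m} \<noteq> {}" using f1 m by auto
      define f where "f = arg_min_on (Qf v) {x\<in>T. Qf v x < real m}"
      have "f \<in> {x\<in>T. Qf v x < real m}" unfolding f_def by (rule arg_min_if_finite(1)[OF fin ne])
      moreover have "Qf v f \<le> Qf v x" if "x \<in> {x\<in>T. Qf v x < real m}" for x
        unfolding f_def by (rule arg_min_least[OF fin ne that])
      ultimately show ?thesis using that by (metis (mono_tags, lifting) leI less_le_trans mem_Collect_eq less_imp_le)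
    qed
    have fI: "f \<in> I" "f \<noteq> 0" "idx f = 1" using f(1) unfolding T_def by auto
    have fF: "f \<in> F" by (rule ideal_F[OF I fI(1)])
    have If: "I = scaled f \<O>" by (rule index_1_imp_principal[OF I fI(1)]) (use fI(3) idx_def in simp)
    \<comment> \<open>Multiplication by \<open>f\<close> carries O onto \<open>I\<close> and turns
      the form of \<open>v\<close> into that of \<open>v'\<close>. The minimality of
      \<open>f\<close> among the generators becomes the hypothesis on units, since \<open>f\<close>
      times a unit is again a generator.\<close>
    define v' where "v' i = v i * a i f" for i
    have v': "v' 0 > 0" "v' 1 > 0" "v' 2 > 0"
      unfolding v'_def using v by (simp_all only: zero_less_mult_iff a_pos[OF fF fI(2)]) auto
    have prd: "v' 0 * v' 1 * v' 2 = 1"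
      using idx(1)[OF fI(1,2)] fI(3) unfolding v'_def Nm_3 by (simp add: mult_ac)
    have Qf': "Qf v' x = Qf v (f * x)" if "x \<in> F" for x
      unfolding Qf_def v'_def by (intro sum.cong refl) (simp only: a_mult[OF fF that] mult.assoc)
    have Qff: "v' 0 + v' 1 + v' 2 = Qf v f" unfolding Qf_3 v'_def ..
    have "infsum (G v) I = infsum (\<lambda>x. G v (f * x)) \<O>"
      unfolding If by (subst infsum_reindex) (use fI(2) in \<open>auto simp: inj_on_def o_def\<close>)
    also have "\<dots> = infsum (G v') \<O>" by (rule infsum_cong) (simp add: Qf' O_F)
    also have "\<dots> < infsum (G trivial) \<O>"
    proof (rule theta_principal[OF v' prd])
      show "Qf v' x \<ge> v' 0 + v' 1 + v' 2" if x: "x \<in> \<O>" "Nm x = 1" for x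
      proof -
        have x0: "x \<noteq> 0" using x(2) by (auto simp: Nm_def t_0)
        have fx: "f * x \<in> I" "f * x \<noteq> 0" using If x(1) fI(2) x0 by auto
        have "real (idx (f * x)) = real (idx f)"
          unfolding idx(1)[OF fx, symmetric] idx(1)[OF fI(1,2), symmetric]
          using Nm_mult[OF fF O_F[OF x(1)]] x(2) by simp
        then have "f * x \<in> T" using fx fI(3) unfolding T_def by simp
        then show ?thesis unfolding Qff Qf'[OF O_F[OF x(1)]] by (rule f(2))
      qed
      \<comment> \<open>Equality in the arithmetic-geometric mean inequality would make all
        \<open>v' i\<close> equal to 1, and the divisor would be the principal one of
        \<open>inverse f\<close>.\<close>
      show "3 < v' 0 + v' 1 + v' 2"
      proof (rule ccontr)
        assume "\<not> ?thesis"
        then have s3: "v' 0 + v' 1 + v' 2 = 3" using sum_eq_3_imp_1(1)[OF v' prd] by simp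
        have "v' 0 = 1" by (rule sum_eq_3_imp_1(2)[OF v' prd s3])
        moreover have "v' 1 = 1" by (rule sum_eq_3_imp_1(2)[of _ "v' 2" "v' 0"]) (use v' prd s3 in \<open>simp_all add: mult_ac\<close>)
        moreover have "v' 2 = 1" by (rule sum_eq_3_imp_1(2)[of _ "v' 0" "v' 1"]) (use v' prd s3 in \<open>simp_all add: mult_ac\<close>)
        ultimately have v1: "v' i = 1" if "i < 3" for i
          using that by (auto simp: numeral_3_eq_3 numeral_2_eq_2 less_Suc_eq)
        have "u i = cmod (t i (inverse f))" if i: "i < 3" for i
        proof -
          have "(u i * cmod (t i f))\<^sup>2 = 1" using v1[OF i] unfolding v'_def v_def by (simp only: power_mult_distrib)
          moreover have "u i * cmod (t i f) \<ge> 0" using u i by (simp add: less_imp_le)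
          ultimately have "u i * cmod (t i f) = 1" by (simp add: power2_eq_1_iff) 
          then show ?thesis unfolding t_inverse[OF fF fI(2)] norm_inverse by (metis inverse_unique mult.commute)
        qed
        then have "principal_divisor F \<tau> I u"
          unfolding principal_divisor_def using fF fI(2) If F_inverse
          by (intro bexI[of _ "inverse f"]) auto
        then show False using np by blast
      qed
    qed
    finally show ?thesis unfolding k0I k0O .
  qed
qed

end

theorem theorem1p1:
  fixes F :: "complex set" and \<tau> :: "complex \<Rightarrow> complex"
    and I :: "complex set" and u :: "nat \<Rightarrow> real"
  assumes "cyclic_sextic_galois F \<tau>"
    and "totally_imaginary F"
    and "fractional_ideal F I"
    and "\<forall>i<3. u i > 0"
    and "arak_degree F I u = 0"
    and "\<not> principal_divisor F \<tau> I u"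
  shows "h0 \<tau> (ring_of_integers F) (\<lambda>_. 1) > h0 \<tau> I u"
proof -
  interpret cyclic_sextic F \<tau> by unfold_locales (rule assms)+
  show ?thesis
    unfolding h0_def using k0_less[OF assms(3-6)] by simp
qed

end
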